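(* Let $G$ be a group acting on a non-empty set $S$. Then the abstract twisted Brin--Thompson group $SV_G$ is boundedly acyclic, i.e. its bounded cohomology $H^i_b(SV_G,\mathbb R)$ with trivial real coefficients vanishes for all $i\ge 1$.
   Context: Abstract twisted Brin--Thompson groups. Let $G$ act on the left on a non-empty set $S$ (not necessarily faithfully). Let $C=\{0,1\}^{\mathbb N}$ be the Cantor set, $C^S$ the space of functions $S\to C$ with the product topology, and $C^S(m)$ the disjoint union of $m$ copies of $C^S$ ($m\ge 1$). For $\psi\colon S\to\{0,1\}^*$ (finite words) with $\psi(s)$ empty for all but finitely many $s$, the dyadic brick $B(\psi)$ is $\{\kappa\in C^S\mid \psi(s)\text{ is a prefix of }\kappa(s)\ \forall s\}$, with canonical homeomorphism $h_\psi\colon C^S\to B(\psi)$, $h_\psi(\kappa)(s)=\psi(s)\cdot\kappa(s)$. The Brin--Thompson groupoid $S\mathcal V$ consists of all homeomorphisms $C^S(m)\to C^S(n)$ obtained by partitioning domain and range into the same finite number of dyadic bricks (inside the copies of $C^S$) and mapping domain bricks to range bricks via canonical homeomorphisms $h_\varphi\circ h_\psi^{-1}$. It contains, for $s\in S$, the simple split $x_s\colon C^S\to C^S(2)$ (sending the half where $\kappa(s)$ starts with $0$, resp. $1$, to the first, resp. second, copy by deleting that first letter of $\kappa(s)$), and for $\sigma\in\Sigma_n$ the permutation $p_\sigma$ of the copies in $C^S(n)$ (copy $i$ goes to copy $\sigma(i)$); it has an obvious direct sum $\oplus$ (juxtaposition). The groupoid $S\mathcal V_G$ has objects the positive integers and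 is generated by $S\mathcal V$ together with, for each $n$, a copy of $G^n$ based at the object $n$ (with $(g_1,\dots,g_n)$ also written $g_1\oplus\cdots\oplus g_n$), subject to the set of relations that is closed under compositions and direct sums and contains $x_{g.s}\circ g=(g\oplus g)\circ x_s$ for $s\in S,g\in G$, and $(g_1\oplus\cdots\oplus g_n)\circ p_\sigma=p_\sigma\circ(g_{\sigma(1)}\oplus\cdots\oplus g_{\sigma(n)})$ for $\sigma\in\Sigma_n$, $g_i\in G$. The group $SV_G$ is the group of morphisms of $S\mathcal V_G$ from the object $1$ to itself. (Equivalently, letting $G$ act on $C^S$ by $(g\kappa)(s)=\kappa(g^{-1}.s)$, $SV_G$ is the group of pairs $(h,\gamma)$, $h$ a homeomorphism of $C^S$ and $\gamma\colon C^S\to G$, for which there are finite partitions of $C^S$ into dyadic bricks $B(\psi_1),\dots,B(\psi_n)$ and $B(\varphi_1),\dots,B(\varphi_n)$ and $g_1,\dots,g_n\in G$ with $h|_{B(\psi_i)}=h_{\varphi_i}\circ g_i\circ h_{\psi_i}^{-1}$ and $\gamma|_{B(\psi_i)}\equiv g_i$; the product is $(h,\gamma)(h',\gamma')=(hh',\ \kappa\mapsto\gamma(h'(\kappa))\gamma'(\kappa))$.) *)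

theory Defs
  imports "HOL-Algebra.Algebra" "HOL-Analysis.Analysis" "HOL-Library.Omega_Words_Fun"
begin

section \<open>Twisted Brin--Thompson groups\<close>

text \<open>
  Letters 0 and 1 are the booleans False and True, so the Cantor set C is the type
  nat => bool, finite words are boolean lists, and \<open>w \<frown> x\<close> is concatenation of a
  finite word with an infinite one.  For a set S, the points of C^S are the functions in
  \<open>S \<rightarrow>\<^sub>E UNIV\<close>.
\<close>

definition cantor_power :: "'s set \<Rightarrow> ('s \<Rightarrow> nat \<Rightarrow> bool) set" where
  "cantor_power S = (S \<rightarrow>\<^sub>E UNIV)"

definition cantor_topology :: "(nat \<Rightarrow> bool) topology" where
  "cantor_topology = product_topology (\<lambda>_. discrete_topology UNIV) UNIV"

definition cantor_power_topology :: "'s set \<Rightarrow> ('s \<Rightarrow> nat \<Rightarrow> bool) topology" where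
  "cantor_power_topology S = product_topology (\<lambda>_. cantor_topology) S"

lemma topspace_cantor_power_topology: "topspace (cantor_power_topology S) = cantor_power S"
  by (simp add: cantor_power_topology_def cantor_topology_def cantor_power_def)

text \<open>Only the values of a brick label on S matter in what follows.\<close>

definition brick_label :: "'s set \<Rightarrow> ('s \<Rightarrow> bool list) \<Rightarrow> bool" where
  "brick_label S \<psi> \<longleftrightarrow> finite {s \<in> S. \<psi> s \<noteq> []}"

definition brick :: "'s set \<Rightarrow> ('s \<Rightarrow> bool list) \<Rightarrow> ('s \<Rightarrow> nat \<Rightarrow> bool) set" where
  "brick S \<psi> = {\<kappa> \<in> cantor_power S. \<forall>s\<in>S. prefix (length (\<psi> s)) (\<kappa> s) = \<psi> s}"

definition brick_map ::
  "'s set \<Rightarrow> ('s \<Rightarrow> bool list) \<Rightarrow> ('s \<Rightarrow> nat \<Rightarrow> bool) \<Rightarrow> ('s \<Rightarrow> nat \<Rightarrow> bool)" where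
  "brick_map S \<psi> \<kappa> = (\<lambda>s\<in>S. \<psi> s \<frown> \<kappa> s)"

lemma brick_map_bij: "bij_betw (brick_map S \<psi>) (cantor_power S) (brick S \<psi>)"
proof (rule bij_betw_byWitness[where f' = "\<lambda>\<kappa>. \<lambda>s\<in>S. suffix (length (\<psi> s)) (\<kappa> s)"])
  show "\<forall>\<kappa>\<in>cantor_power S. (\<lambda>s\<in>S. suffix (length (\<psi> s)) (brick_map S \<psi> \<kappa> s)) = \<kappa>"
    by (auto simp: cantor_power_def brick_map_def fun_eq_iff PiE_iff extensional_def)
  show "\<forall>\<kappa>\<in>brick S \<psi>. brick_map S \<psi> (\<lambda>s\<in>S. suffix (length (\<psi> s)) (\<kappa> s)) = \<kappa>"
  proof (rule ballI, rule ext)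
    fix \<kappa> s assume k: "\<kappa> \<in> brick S \<psi>"
    show "brick_map S \<psi> (\<lambda>s\<in>S. suffix (length (\<psi> s)) (\<kappa> s)) s = \<kappa> s"
    proof (cases "s \<in> S")
      case True
      with k have "prefix (length (\<psi> s)) (\<kappa> s) = \<psi> s" by (simp add: brick_def)
      with True show ?thesis using prefix_suffix[of "\<kappa> s" "length (\<psi> s)"]
        by (simp add: brick_map_def)
    next
      case False
      with k show ?thesis by (auto simp: brick_map_def brick_def cantor_power_def PiE_iff extensional_def)
    qed
  qed
  show "brick_map S \<psi> ` cantor_power S \<subseteq> brick S \<psi>"
    by (auto simp: cantor_power_def brick_map_def brick_def)
  show "(\<lambda>\<kappa>. \<lambda>s\<in>S. suffix (length (\<psi> s)) (\<kappa> s)) ` brick S \<psi> \<subseteq> cantor_power S"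
    by (auto simp: cantor_power_def)
qed

text \<open>The bricks labelled \<psi> 0, ..., \<psi> (n - 1) partition C^S.\<close>

definition brick_partition :: "'s set \<Rightarrow> nat \<Rightarrow> (nat \<Rightarrow> 's \<Rightarrow> bool list) \<Rightarrow> bool" where
  "brick_partition S n \<psi> \<longleftrightarrow>
     (\<forall>i<n. brick_label S (\<psi> i)) \<and>
     disjoint_family_on (\<lambda>i. brick S (\<psi> i)) {..<n} \<and>
     (\<Union>i<n. brick S (\<psi> i)) = cantor_power S"

definition shift_action ::
  "('g, 'm) monoid_scheme \<Rightarrow> 's set \<Rightarrow> ('g \<Rightarrow> 's \<Rightarrow> 's) \<Rightarrow> 'g \<Rightarrow>
   ('s \<Rightarrow> nat \<Rightarrow> bool) \<Rightarrow> ('s \<Rightarrow> nat \<Rightarrow> bool)" where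
  "shift_action G S \<phi> g \<kappa> = (\<lambda>s\<in>S. \<kappa> (\<phi> (inv\<^bsub>G\<^esub> g) s))"

text \<open>
  The group SV_G in its description by pairs: a homeomorphism h of C^S that is locally of
  the form "delete a prefix, act by a group element, add a prefix", together with the locally
  constant record of the group elements used.  The second component is what makes the group
  depend on G itself and not just on the image of G in the permutations of S.
  The equation on h below is the identity of h and
  \<open>brick_map \<beta> \<circ> g \<circ> (brick_map \<alpha>)\<inverse>\<close> on the brick of \<alpha>, written on points of the form
  \<open>brick_map \<alpha> \<kappa>\<close>.  Both components are extensional functions on C^S.
\<close>

definition twisted_BT_elements ::
  "('g, 'm) monoid_scheme \<Rightarrow> 's set \<Rightarrow> ('g \<Rightarrow> 's \<Rightarrow> 's) \<Rightarrow>
   ((('s \<Rightarrow> nat \<Rightarrow> bool) \<Rightarrow> ('s \<Rightarrow> nat \<Rightarrow> bool)) \<times> (('s \<Rightarrow> nat \<Rightarrow> bool) \<Rightarrow> 'g)) set" where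
  "twisted_BT_elements G S \<phi> =
     {(h, \<gamma>).
        h \<in> extensional (cantor_power S) \<and>
        homeomorphic_map (cantor_power_topology S) (cantor_power_topology S) h \<and>
        \<gamma> \<in> cantor_power S \<rightarrow>\<^sub>E carrier G \<and>
        (\<exists>n \<alpha> \<beta> g.
           brick_partition S n \<alpha> \<and> brick_partition S n \<beta> \<and>
           (\<forall>i<n. g i \<in> carrier G \<and>
              (\<forall>\<kappa>\<in>cantor_power S.
                 h (brick_map S (\<alpha> i) \<kappa>) = brick_map S (\<beta> i) (shift_action G S \<phi> (g i) \<kappa>)) \<and>
              (\<forall>\<kappa>\<in>brick S (\<alpha> i). \<gamma> \<kappa> = g i)))}"

definition abstract_twisted_BT ::
  "('g, 'm) monoid_scheme \<Rightarrow> 's set \<Rightarrow> ('g \<Rightarrow> 's \<Rightarrow> 's) \<Rightarrow>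
   ((('s \<Rightarrow> nat \<Rightarrow> bool) \<Rightarrow> ('s \<Rightarrow> nat \<Rightarrow> bool)) \<times> (('s \<Rightarrow> nat \<Rightarrow> bool) \<Rightarrow> 'g)) monoid" where
  "abstract_twisted_BT G S \<phi> =
     \<lparr>carrier = twisted_BT_elements G S \<phi>,
      monoid.mult = (\<lambda>(h, \<gamma>) (h', \<gamma>').
        (compose (cantor_power S) h h',
         \<lambda>\<kappa>\<in>cantor_power S. \<gamma> (h' \<kappa>) \<otimes>\<^bsub>G\<^esub> \<gamma>' \<kappa>)),
      one = (\<lambda>\<kappa>\<in>cantor_power S. \<kappa>, \<lambda>\<kappa>\<in>cantor_power S. \<one>\<^bsub>G\<^esub>)\<rparr>"

section \<open>Bounded cohomology with trivial real coefficients\<close>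

text \<open>
  Homogeneous resolution: n-cochains are the bounded functions on (n+1)-tuples that are
  invariant under diagonal left translation.  Tuples are lists, and cochains are extensional
  functions on them.
\<close>

definition tuples :: "('a, 'm) monoid_scheme \<Rightarrow> nat \<Rightarrow> 'a list set" where
  "tuples \<Gamma> k = {xs. length xs = k \<and> set xs \<subseteq> carrier \<Gamma>}"

definition bounded_cochains :: "('a, 'm) monoid_scheme \<Rightarrow> nat \<Rightarrow> ('a list \<Rightarrow> real) monoid" where
  "bounded_cochains \<Gamma> n =
     \<lparr>carrier = {f \<in> extensional (tuples \<Gamma> (Suc n)).
        (\<exists>c. \<forall>xs\<in>tuples \<Gamma> (Suc n). \<bar>f xs\<bar> \<le> c) \<and>
        (\<forall>a\<in>carrier \<Gamma>. \<forall>xs\<in>tuples \<Gamma> (Suc n). f (map (\<lambda>x. a \<otimes>\<^bsub>\<Gamma>\<^esub> x) xs) = f xs)},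
      monoid.mult = (\<lambda>f f'. \<lambda>xs\<in>tuples \<Gamma> (Suc n). f xs + f' xs),
      one = (\<lambda>xs\<in>tuples \<Gamma> (Suc n). 0)\<rparr>"

definition coboundary ::
  "('a, 'm) monoid_scheme \<Rightarrow> nat \<Rightarrow> ('a list \<Rightarrow> real) \<Rightarrow> ('a list \<Rightarrow> real)" where
  "coboundary \<Gamma> n f =
     (\<lambda>xs\<in>tuples \<Gamma> (Suc (Suc n)). \<Sum>i\<le>Suc n. (- 1) ^ i * f (take i xs @ drop (Suc i) xs))"

definition bounded_cocycles :: "('a, 'm) monoid_scheme \<Rightarrow> nat \<Rightarrow> ('a list \<Rightarrow> real) set" where
  "bounded_cocycles \<Gamma> n =
     kernel (bounded_cochains \<Gamma> n) (bounded_cochains \<Gamma> (Suc n)) (coboundary \<Gamma> n)"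

definition bounded_coboundaries :: "('a, 'm) monoid_scheme \<Rightarrow> nat \<Rightarrow> ('a list \<Rightarrow> real) set" where
  "bounded_coboundaries \<Gamma> n =
     (case n of
        0 \<Rightarrow> {\<one>\<^bsub>bounded_cochains \<Gamma> 0\<^esub>}
      | Suc k \<Rightarrow> coboundary \<Gamma> k ` carrier (bounded_cochains \<Gamma> k))"

text \<open>
  The underlying additive group of the real vector space of bounded cohomology classes, in
  the multiplicative notation of HOL-Algebra; its vanishing does not see the scalars.
\<close>

definition bounded_cohomology ::
  "('a, 'm) monoid_scheme \<Rightarrow> nat \<Rightarrow> ('a list \<Rightarrow> real) set monoid" where
  "bounded_cohomology \<Gamma> n =
     (bounded_cochains \<Gamma> n)\<lparr>carrier := bounded_cocycles \<Gamma> n\<rparr> Mod bounded_coboundaries \<Gamma> n"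

definition boundedly_acyclic :: "('a, 'm) monoid_scheme \<Rightarrow> bool" where
  "boundedly_acyclic \<Gamma> \<longleftrightarrow> (\<forall>i\<ge>1. trivial_group (bounded_cohomology \<Gamma> i))"

end

theory Submission
  imports Defs
begin

text \<open>
  Let \<Gamma> be SV_G.  For clopen N different from C^S, the fixator of N in \<Gamma> is isomorphic to \<Gamma>, because
  C^S and every non-empty clopen subset of it are isomorphic in the groupoid generated by brick
  maps and G.  The vanishing of bounded cohomology, with uniform norm bounds on primitives, is
  proved by induction on the degree n.

  First, a bounded n-cocycle f becomes a coboundary when pulled back along an embedding \<rho> of \<Gamma>
  with image in such a fixator.  Some t in \<Gamma> moves the support of \<rho> off itself, so
  \<rho>'(a) = \<rho>(a) t \<rho>(a) t^-1 is again such an embedding, and by a Kuenneth argument using the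
  vanishing in degrees below n, the pullback along \<rho>' is cohomologous to twice the one along \<rho>.
  Iterating this halving writes the pullback of f along \<rho> as a geometric series of coboundaries.

  Secondly, \<Gamma> acts on the germs of its elements at a base point.  Tuples of germs with distinct
  image points form a boundedly acyclic complex on which \<Gamma> is transitive in every degree, and each
  stabiliser of a tuple is a directed union of fixators.  The double complex of this action then
  expresses f as a coboundary.
\<close>

section \<open>Alternating coboundaries and generalised limits\<close>

text \<open>Uniform constants are forced by the stabilisers. These are only directed unions of
  copies of the group, and primitives chosen on the pieces need not be compatible; a generalised
  limit merges them, provided they share one bound. In the halving series the same uniformity keeps
  the primitives of all stages bounded by one constant.

  Germs replace points because an element can fix a point of C^S without being trivial near it, or
  be the identity near it with a non-trivial label in G. Stabilisers of points would not be unions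
  of fixators.

  Halving rests on two facts: conjugation by t does not change the pulled back class, and f is
  bounded, so the remainder after k steps is at most 2^-k times its norm. It treats only cocycles
  restricted from the whole group, and the double complex asks for no more in the top degree; below
  it the induction hypothesis covers all cocycles of the stabilisers.

  One descent through a double complex serves both the Kuenneth argument and the germ action. They
  differ in how the tail of the descent ends: in a function pulled back from the second factor, or
  in 0.\<close>

fun cobd :: "('a list \<Rightarrow> real) \<Rightarrow> 'a list \<Rightarrow> real" where
  "cobd f [] = 0"
| "cobd f (x # xs) = f xs - cobd (\<lambda>l. f (x # l)) xs"

lemma cobd_eq_sum:
  "cobd f xs = (\<Sum>i<length xs. (-1)^i * f (take i xs @ drop (Suc i) xs))"
proof (induction xs arbitrary: f)
  case (Cons x xs)
  then show ?case
    by (simp add: sum.lessThan_Suc_shift sum_negf del: sum.lessThan_Suc)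
qed simp

lemma cobd_cong:
  assumes "\<And>i. i < length xs \<Longrightarrow> f (take i xs @ drop (Suc i) xs) = g (take i xs @ drop (Suc i) xs)"
  shows "cobd f xs = cobd g xs"
  unfolding cobd_eq_sum by (intro sum.cong) (use assms in auto)

lemma cobd_diff: "cobd (\<lambda>l. f l - g l) xs = cobd f xs - cobd g xs"
  by (induction xs arbitrary: f g) auto

lemma cobd_add: "cobd (\<lambda>l. f l + g l) xs = cobd f xs + cobd g xs"
  by (induction xs arbitrary: f g) auto

lemma cobd_scale: "cobd (\<lambda>l. c * f l) xs = c * cobd f xs"
  by (induction xs arbitrary: f) (auto simp: algebra_simps)

lemma cobd_zero [simp]: "cobd (\<lambda>l. 0) xs = 0"
  by (induction xs) auto

lemma cobd_map: "cobd (\<lambda>l. f (map a l)) xs = cobd f (map a xs)"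
  by (induction xs arbitrary: f) auto

lemma cobd_cobd [simp]: "cobd (cobd f) xs = 0"
  by (induction xs arbitrary: f) (auto simp: cobd_diff)

lemma cobd_append:
  "cobd f (xs @ ys) = cobd (\<lambda>l. f (l @ ys)) xs + (-1) ^ length xs * cobd (\<lambda>l. f (xs @ l)) ys"
  by (induction xs arbitrary: f) auto

lemma cobd_replicate:
  "cobd f (replicate m x) = (if even m then 0 else f (replicate (m - 1) x))"
proof (induction m arbitrary: f)
  case (Suc m)
  have "x # replicate (m - 1) x = replicate m x" if "odd m"
    using that by (cases m) auto
  with Suc[of "\<lambda>l. f (x # l)"] show ?case by simp
qed simp

lemma cobd_const: "cobd (\<lambda>_. k) xs = (if even (length xs) then 0 else k)"
  by (induction xs arbitrary: k) auto

lemma abs_cobd_le: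
  assumes "\<And>i. i < length xs \<Longrightarrow> \<bar>f (take i xs @ drop (Suc i) xs)\<bar> \<le> c"
  shows "\<bar>cobd f xs\<bar> \<le> real (length xs) * c"
proof -
  have "\<bar>cobd f xs\<bar> \<le> (\<Sum>i<length xs. \<bar>(-1)^i * f (take i xs @ drop (Suc i) xs)\<bar>)"
    unfolding cobd_eq_sum by (rule sum_abs)
  also have "\<dots> \<le> (\<Sum>i<length xs. c)"
    by (intro sum_mono) (use assms in \<open>auto simp: abs_mult power_abs\<close>)
  finally show ?thesis by simp
qed

text \<open>Both differentials of the later double complex are instances of \<open>cobd\<close> in
  separate variables. They commute without a sign, so no sign convention for a total complex
  enters.\<close>

lemma cobd_swap:
  "cobd (\<lambda>l. cobd (\<lambda>m. F l m) ys) xs = cobd (\<lambda>m. cobd (\<lambda>l. F l m) xs) ys"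
  unfolding cobd_eq_sum sum_distrib_left
  by (subst sum.swap) (intro sum.cong refl, simp add: algebra_simps)

text \<open>Unfolded, this is the alternating sum over i of f(a x_0, ..., a x_i, b x_i, ..., b x_k):
  the simplicial prism operator between the maps induced by \<open>a\<close> and
  \<open>b\<close>.\<close>

fun prism :: "('a \<Rightarrow> 'b) \<Rightarrow> ('a \<Rightarrow> 'b) \<Rightarrow> ('b list \<Rightarrow> real) \<Rightarrow> 'a list \<Rightarrow> real" where
  "prism a b f [] = 0"
| "prism a b f (x # xs) = f (a x # b x # map b xs) - prism a b (\<lambda>l. f (a x # l)) xs"

lemma prism_diff: "prism a b (\<lambda>l. f l - g l) xs = prism a b f xs - prism a b g xs"
  by (induction xs arbitrary: f g) auto

lemma prism_homotopy:
  "cobd (prism a b f) xs + prism a b (cobd f) xs = f (map b xs) - f (map a xs)"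
proof (induction xs arbitrary: f)
  case (Cons x xs)
  have "cobd (\<lambda>l. f (a x # b x # map b l)) xs = cobd (\<lambda>l. f (a x # b x # l)) (map b xs)"
    by (rule cobd_map)
  with Cons[of "\<lambda>l. f (a x # l)"] show ?case
    by (simp add: prism_diff cobd_diff)
qed simp

lemma prism_bound:
  assumes "\<And>ys. length ys = Suc (length xs) \<Longrightarrow> set ys \<subseteq> Y \<Longrightarrow> \<bar>f ys\<bar> \<le> c"
    and "a ` set xs \<subseteq> Y" "b ` set xs \<subseteq> Y"
  shows "\<bar>prism a b f xs\<bar> \<le> real (length xs) * c"
  using assms
proof (induction xs arbitrary: f)
  case (Cons x xs)
  have "\<bar>f (a x # b x # map b xs)\<bar> \<le> c"
    using Cons.prems by (intro Cons.prems) auto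
  moreover have "\<bar>prism a b (\<lambda>l. f (a x # l)) xs\<bar> \<le> real (length xs) * c"
    using Cons.prems by (intro Cons.IH) auto
  ultimately show ?case by (simp add: algebra_simps)
qed simp

lemma prism_zero:
  assumes "\<And>ys. length ys = Suc (length xs) \<Longrightarrow> set ys \<subseteq> Y \<Longrightarrow> f ys = 0"
    and "a ` set xs \<subseteq> Y" "b ` set xs \<subseteq> Y"
  shows "prism a b f xs = 0"
proof -
  have "\<bar>prism a b f xs\<bar> \<le> real (length xs) * 0"
    by (rule prism_bound[where Y = Y]) (use assms in auto)
  then show ?thesis by simp
qed

text \<open>When \<open>a\<close> and \<open>b\<close> intertwine the same two translations, the
  homotopy preserves invariance. This lets the prism of an invariant function serve as a
  cochain.\<close>

lemma prism_equivariant: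
  assumes "\<And>ys. length ys = Suc (length xs) \<Longrightarrow> set ys \<subseteq> Y \<Longrightarrow> f (map \<tau> ys) = f' ys"
    and "a ` set xs \<subseteq> Y" "b ` set xs \<subseteq> Y"
    and "\<And>x. x \<in> set xs \<Longrightarrow> a (\<sigma> x) = \<tau> (a x)" "\<And>x. x \<in> set xs \<Longrightarrow> b (\<sigma> x) = \<tau> (b x)"
  shows "prism a b f (map \<sigma> xs) = prism a b f' xs"
  using assms
proof (induction xs arbitrary: f f')
  case (Cons x xs)
  have m: "map b (map \<sigma> xs) = map \<tau> (map b xs)" using Cons.prems(5) by auto
  have "f (map \<tau> (a x # b x # map b xs)) = f' (a x # b x # map b xs)"
    using Cons.prems by (intro Cons.prems) auto
  moreover have "prism a b (\<lambda>l. f (\<tau> (a x) # l)) (map \<sigma> xs) = prism a b (\<lambda>l. f' (a x # l)) xs"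
  proof (rule Cons.IH)
    fix ys assume "length ys = Suc (length xs)" "set ys \<subseteq> Y"
    then show "f (\<tau> (a x) # map \<tau> ys) = f' (a x # ys)"
      using Cons.prems(1)[of "a x # ys"] Cons.prems(2) by simp
  qed (use Cons.prems in auto)
  ultimately show ?case using Cons.prems(4,5) m by (simp del: map_map)
qed simp

text \<open>Generalised limits exist because a cluster point of the evaluations is additive.\<close>

definition gen_limit :: "'i filter \<Rightarrow> (('i \<Rightarrow> real) \<Rightarrow> real) \<Rightarrow> bool" where
  "gen_limit F L \<longleftrightarrow>
     (\<forall>f g. bounded (range f) \<longrightarrow> bounded (range g) \<longrightarrow> L (\<lambda>i. f i + g i) = L f + L g) \<and>
     (\<forall>f c. bounded (range f) \<longrightarrow> L (\<lambda>i. c * f i) = c * L f) \<and>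
     (\<forall>f c. bounded (range f) \<longrightarrow> eventually (\<lambda>i. \<bar>f i\<bar> \<le> c) F \<longrightarrow> \<bar>L f\<bar> \<le> c) \<and>
     (\<forall>c. L (\<lambda>_. c) = c)"

lemma gen_limit_exists:
  fixes F :: "'i filter"
  assumes "F \<noteq> bot"
  obtains L where "gen_limit F L"
proof -
  \<comment> \<open>Unbounded functions get the value 0, so every coordinate lives in a compact
    interval and the Tychonoff theorem applies to all real functions at once.\<close>
  define B where "B f = (if bounded (range f) then (SUP i. \<bar>f i\<bar>) else 0)" for f :: "'i \<Rightarrow> real"
  define ev where "ev i f = (if bounded (range f) then f i else 0)" for i and f :: "'i \<Rightarrow> real"
  define K where "K = Pi\<^sub>E UNIV (\<lambda>f. {- B f..B f})"
  have "compact K"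
    using compactin_PiE[of "\<lambda>_. euclidean" UNIV "\<lambda>f. {- B f..B f}"]
    by (simp add: K_def euclidean_product_topology)
  have evK: "ev i \<in> K" for i
  proof -
    have "ev i f \<in> {- B f..B f}" for f
    proof (cases "bounded (range f)")
      case True
      then have "bdd_above (range (\<lambda>i. \<bar>f i\<bar>))"
        unfolding bounded_iff bdd_above_def by auto
      then have "\<bar>f i\<bar> \<le> (SUP i. \<bar>f i\<bar>)" by (intro cSUP_upper) auto
      with True show ?thesis by (auto simp: ev_def B_def abs_le_iff)
    qed (auto simp: ev_def B_def)
    then show ?thesis by (auto simp: K_def)
  qed
  have "filtermap ev F \<noteq> bot" using assms by (simp add: filtermap_bot_iff)
  moreover have "eventually (\<lambda>\<phi>. \<phi> \<in> K) (filtermap ev F)"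
    using evK by (simp add: eventually_filtermap)
  ultimately obtain L where L: "inf (nhds L) (filtermap ev F) \<noteq> bot"
    using \<open>compact K\<close> unfolding compact_filter by blast
  \<comment> \<open>Additivity, homogeneity and the bounds are closed conditions on finitely many
    coordinates. The evaluations satisfy them always or eventually, so the cluster point does
    too.\<close>
  have closed_imp: "L \<in> A" if "closed A" "eventually (\<lambda>i. ev i \<in> A) F" for A
  proof (rule ccontr)
    assume "L \<notin> A"
    with that(1) have "eventually (\<lambda>x. x \<in> - A) (nhds L)"
      by (intro eventually_nhds_in_open) auto
    moreover have "eventually (\<lambda>x. x \<in> A) (filtermap ev F)"
      using that(2) by (simp add: eventually_filtermap)
    ultimately have "eventually (\<lambda>x. False) (inf (nhds L) (filtermap ev F))"
      unfolding eventually_inf by blast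
    with L show False by simp
  qed
  have cont: "continuous_on UNIV (\<lambda>\<phi>. \<phi> f)" for f :: "'i \<Rightarrow> real"
    by (rule continuous_on_product_coordinates)
  have "gen_limit F L"
    unfolding gen_limit_def
  proof (intro conjI allI impI)
    fix f g :: "'i \<Rightarrow> real" assume b: "bounded (range f)" "bounded (range g)"
    have b2: "bounded (range (\<lambda>i. f i + g i))" using b by (intro bounded_plus_comp)
    have "L \<in> {\<phi>. \<phi> (\<lambda>i. f i + g i) = \<phi> f + \<phi> g}"
      using b b2 by (intro closed_imp closed_Collect_eq continuous_intros cont) (auto simp: ev_def)
    then show "L (\<lambda>i. f i + g i) = L f + L g" by simp
  next
    fix f :: "'i \<Rightarrow> real" and c assume b: "bounded (range f)"
    have b2: "bounded (range (\<lambda>i. c * f i))"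
      using bounded_scaling[OF b, of c] by (simp add: image_image)
    have "L \<in> {\<phi>. \<phi> (\<lambda>i. c * f i) = c * \<phi> f}"
      using b b2 by (intro closed_imp closed_Collect_eq continuous_intros cont) (auto simp: ev_def)
    then show "L (\<lambda>i. c * f i) = c * L f" by simp
  next
    fix f :: "'i \<Rightarrow> real" and c assume b: "bounded (range f)" "eventually (\<lambda>i. \<bar>f i\<bar> \<le> c) F"
    have "L \<in> {\<phi>. \<bar>\<phi> f\<bar> \<le> c}"
      using b by (intro closed_imp closed_Collect_le continuous_intros cont) (simp add: ev_def)
    then show "\<bar>L f\<bar> \<le> c" by simp
  next
    fix c :: real
    have "bounded (range (\<lambda>_::'i. c))" by (simp add: image_constant_conv)
    then have "L \<in> {\<phi>. \<phi> (\<lambda>_. c) = c}"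
      by (intro closed_imp closed_Collect_eq continuous_intros cont) (auto simp: ev_def)
    then show "L (\<lambda>_. c) = c" by simp
  qed
  then show ?thesis using that by blast
qed

lemma gen_limit_add:
  "gen_limit F L \<Longrightarrow> bounded (range f) \<Longrightarrow> bounded (range g) \<Longrightarrow> L (\<lambda>i. f i + g i) = L f + L g"
  and gen_limit_scale: "gen_limit F L \<Longrightarrow> bounded (range f) \<Longrightarrow> L (\<lambda>i. c * f i) = c * L f"
  and gen_limit_bound:
    "gen_limit F L \<Longrightarrow> bounded (range f) \<Longrightarrow> eventually (\<lambda>i. \<bar>f i\<bar> \<le> c) F \<Longrightarrow> \<bar>L f\<bar> \<le> c"
  and gen_limit_const: "gen_limit F L \<Longrightarrow> L (\<lambda>_. c) = c"
  unfolding gen_limit_def by blast+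

lemma gen_limit_diff:
  assumes "gen_limit F L" "bounded (range f)" "bounded (range g)"
  shows "L (\<lambda>i. f i - g i) = L f - L g"
proof -
  have "bounded (range (\<lambda>i. - 1 * g i))"
    using bounded_scaling[OF assms(3), of "-1"] by (simp add: image_image)
  then show ?thesis
    using gen_limit_add[OF assms(1,2), of "\<lambda>i. - 1 * g i"] gen_limit_scale[OF assms(1,3), of "- 1"] by simp
qed

lemma gen_limit_cong:
  assumes "gen_limit F L" "bounded (range f)" "bounded (range g)" "eventually (\<lambda>i. f i = g i) F"
  shows "L f = L g"
proof -
  have "bounded (range (\<lambda>i. f i - g i))" using assms(2,3) by (rule bounded_minus_comp)
  then have "\<bar>L (\<lambda>i. f i - g i)\<bar> \<le> 0"
    using assms(4) by (intro gen_limit_bound[OF assms(1)]) simp_all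
  with gen_limit_diff[OF assms(1-3)] show ?thesis by simp
qed

text \<open>Boundedness of the coboundaries is proved alongside, because the inductive step needs it
  to split the limit of a difference.\<close>

lemma gen_limit_cobd:
  assumes "gen_limit F L" "\<And>l. bounded (range (\<lambda>i. f i l))"
  shows "L (\<lambda>i. cobd (f i) xs) = cobd (\<lambda>l. L (\<lambda>i. f i l)) xs \<and> bounded (range (\<lambda>i. cobd (f i) xs))"
  using assms(2)
proof (induction xs arbitrary: f)
  case Nil
  then show ?case using gen_limit_const[OF assms(1), of 0] by (simp add: image_constant_conv)
next
  case (Cons x xs)
  from Cons.IH[of "\<lambda>i l. f i (x # l)"] Cons.prems show ?case
    by (auto simp: gen_limit_diff[OF assms(1)] intro!: bounded_minus_comp)
qed

section \<open>Bounded cochains and generic actions\<close>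

text \<open>
  Cochains are indexed by the length N of their tuples, so N is the degree plus one.
\<close>

definition cochain :: "('a, 'm) monoid_scheme \<Rightarrow> nat \<Rightarrow> real \<Rightarrow> ('a list \<Rightarrow> real) \<Rightarrow> bool" where
  "cochain \<Gamma> N c f \<longleftrightarrow>
     (\<forall>xs\<in>tuples \<Gamma> N. \<bar>f xs\<bar> \<le> c \<and> (\<forall>a\<in>carrier \<Gamma>. f (map (\<lambda>x. a \<otimes>\<^bsub>\<Gamma>\<^esub> x) xs) = f xs))"

definition cocycle :: "('a, 'm) monoid_scheme \<Rightarrow> nat \<Rightarrow> real \<Rightarrow> ('a list \<Rightarrow> real) \<Rightarrow> bool" where
  "cocycle \<Gamma> N c f \<longleftrightarrow> cochain \<Gamma> N c f \<and> (\<forall>xs\<in>tuples \<Gamma> (Suc N). cobd f xs = 0)"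

definition primitive :: "('a, 'm) monoid_scheme \<Rightarrow> nat \<Rightarrow> real \<Rightarrow> ('a list \<Rightarrow> real) \<Rightarrow> bool" where
  "primitive \<Gamma> N c f \<longleftrightarrow> (\<exists>u. cochain \<Gamma> (N - 1) c u \<and> (\<forall>xs\<in>tuples \<Gamma> N. cobd u xs = f xs))"

text \<open>Quantitative vanishing: \<open>K\<close> bounds an inverse of the coboundary uniformly
  over all cocycles. The constants of the descent are computed from it.\<close>

definition bounded_vanishing :: "('a, 'm) monoid_scheme \<Rightarrow> nat \<Rightarrow> real \<Rightarrow> bool" where
  "bounded_vanishing \<Gamma> N K \<longleftrightarrow> (\<forall>c f. cocycle \<Gamma> N c f \<longrightarrow> primitive \<Gamma> N (K * c) f)"

section \<open>Functoriality of bounded cochains, cocycles and primitives\<close>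

lemma tuples_delete:
  "xs \<in> tuples \<Gamma> (Suc n) \<Longrightarrow> i < length xs \<Longrightarrow> take i xs @ drop (Suc i) xs \<in> tuples \<Gamma> n"
  by (auto simp: tuples_def dest: in_set_takeD in_set_dropD)

lemma tuples_map:
  "xs \<in> tuples \<Gamma> n \<Longrightarrow> \<sigma> ` carrier \<Gamma> \<subseteq> carrier \<Gamma>' \<Longrightarrow> map \<sigma> xs \<in> tuples \<Gamma>' n"
  by (auto simp: tuples_def)

lemma (in group) tuples_nonempty: "replicate n \<one> \<in> tuples G n"
  by (auto simp: tuples_def)

lemma (in group) tuples_translate: "xs \<in> tuples G n \<Longrightarrow> a \<in> carrier G \<Longrightarrow> map (\<lambda>x. a \<otimes> x) xs \<in> tuples G n"
  by (auto simp: tuples_def)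

lemma cobd_tuples_cong:
  assumes "xs \<in> tuples \<Gamma> (Suc n)" "\<And>ys. ys \<in> tuples \<Gamma> n \<Longrightarrow> f ys = g ys"
  shows "cobd f xs = cobd g xs"
  by (rule cobd_cong) (use assms tuples_delete in blast)

lemma (in group) cochain_nonneg:
  assumes "cochain G N c f" shows "0 \<le> c"
  using assms tuples_nonempty[of N] abs_ge_zero order_trans unfolding cochain_def by blast

lemma cochain_mono: "cochain \<Gamma> N c f \<Longrightarrow> c \<le> c' \<Longrightarrow> cochain \<Gamma> N c' f"
  unfolding cochain_def by fastforce

lemma primitive_mono: "primitive \<Gamma> N c f \<Longrightarrow> c \<le> c' \<Longrightarrow> primitive \<Gamma> N c' f"
  unfolding primitive_def using cochain_mono by blast

lemma primitive_cong:
  "primitive \<Gamma> N c f \<Longrightarrow> (\<And>xs. xs \<in> tuples \<Gamma> N \<Longrightarrow> f xs = g xs) \<Longrightarrow> primitive \<Gamma> N c g"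
  unfolding primitive_def by fastforce

lemma cochain_add:
  "cochain \<Gamma> N c f \<Longrightarrow> cochain \<Gamma> N c' f' \<Longrightarrow> cochain \<Gamma> N (c + c') (\<lambda>xs. f xs + f' xs)"
  unfolding cochain_def by (fastforce intro: order_trans[OF abs_triangle_ineq] add_mono)

lemma cochain_scale: "cochain \<Gamma> N c f \<Longrightarrow> cochain \<Gamma> N (\<bar>a\<bar> * c) (\<lambda>xs. a * f xs)"
  unfolding cochain_def by (auto simp: abs_mult mult_left_mono)

lemma primitive_add:
  assumes "primitive \<Gamma> N c f" "primitive \<Gamma> N c' f'"
  shows "primitive \<Gamma> N (c + c') (\<lambda>xs. f xs + f' xs)"
proof -
  from assms obtain u u' where u: "cochain \<Gamma> (N - 1) c u" "\<And>xs. xs \<in> tuples \<Gamma> N \<Longrightarrow> cobd u xs = f xs"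
    and u': "cochain \<Gamma> (N - 1) c' u'" "\<And>xs. xs \<in> tuples \<Gamma> N \<Longrightarrow> cobd u' xs = f' xs"
    unfolding primitive_def by blast
  then show ?thesis
    unfolding primitive_def
    by (intro exI[of _ "\<lambda>xs. u xs + u' xs"]) (auto simp: cochain_add cobd_add)
qed

lemma primitive_scale:
  assumes "primitive \<Gamma> N c f"
  shows "primitive \<Gamma> N (\<bar>a\<bar> * c) (\<lambda>xs. a * f xs)"
proof -
  from assms obtain u where u: "cochain \<Gamma> (N - 1) c u" "\<And>xs. xs \<in> tuples \<Gamma> N \<Longrightarrow> cobd u xs = f xs"
    unfolding primitive_def by blast
  then show ?thesis
    unfolding primitive_def
    by (intro exI[of _ "\<lambda>xs. a * u xs"]) (auto simp: cochain_scale cobd_scale)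
qed

lemma cocycle_add:
  "cocycle \<Gamma> N c f \<Longrightarrow> cocycle \<Gamma> N c' f' \<Longrightarrow> cocycle \<Gamma> N (c + c') (\<lambda>xs. f xs + f' xs)"
  unfolding cocycle_def by (auto simp: cochain_add cobd_add)

lemma cocycle_scale: "cocycle \<Gamma> N c f \<Longrightarrow> cocycle \<Gamma> N (\<bar>a\<bar> * c) (\<lambda>xs. a * f xs)"
  unfolding cocycle_def by (auto simp: cochain_scale cobd_scale)

lemma cochain_pullback:
  assumes "\<sigma> \<in> hom \<Gamma> \<Gamma>'" "cochain \<Gamma>' N c f"
  shows "cochain \<Gamma> N c (\<lambda>xs. f (map \<sigma> xs))"
  unfolding cochain_def
proof (intro ballI conjI)
  fix xs assume xs: "xs \<in> tuples \<Gamma> N"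
  have c: "\<sigma> ` carrier \<Gamma> \<subseteq> carrier \<Gamma>'" using assms(1) by (auto simp: hom_def)
  note m = tuples_map[OF xs c]
  show "\<bar>f (map \<sigma> xs)\<bar> \<le> c" using assms(2) m by (auto simp: cochain_def)
  fix a assume a: "a \<in> carrier \<Gamma>"
  have "map \<sigma> (map (\<lambda>x. a \<otimes>\<^bsub>\<Gamma>\<^esub> x) xs) = map (\<lambda>x. \<sigma> a \<otimes>\<^bsub>\<Gamma>'\<^esub> x) (map \<sigma> xs)"
    using xs a assms(1) by (auto simp: tuples_def hom_def)
  then show "f (map \<sigma> (map (\<lambda>x. a \<otimes>\<^bsub>\<Gamma>\<^esub> x) xs)) = f (map \<sigma> xs)"
    by (simp only:) (use assms(2) m a c in \<open>auto simp: cochain_def simp del: map_map\<close>)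
qed

lemma cocycle_pullback:
  assumes "\<sigma> \<in> hom \<Gamma> \<Gamma>'" "cocycle \<Gamma>' N c f"
  shows "cocycle \<Gamma> N c (\<lambda>xs. f (map \<sigma> xs))"
proof -
  have "\<sigma> ` carrier \<Gamma> \<subseteq> carrier \<Gamma>'" using assms(1) by (auto simp: hom_def)
  then show ?thesis
    using assms cochain_pullback[OF assms(1)] tuples_map unfolding cocycle_def by (fastforce simp: cobd_map)
qed

lemma primitive_pullback:
  assumes "\<sigma> \<in> hom \<Gamma> \<Gamma>'" "primitive \<Gamma>' N c f"
  shows "primitive \<Gamma> N c (\<lambda>xs. f (map \<sigma> xs))"
proof -
  from assms obtain u where u: "cochain \<Gamma>' (N - 1) c u" "\<forall>xs\<in>tuples \<Gamma>' N. cobd u xs = f xs"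
    unfolding primitive_def by blast
  have "\<sigma> ` carrier \<Gamma> \<subseteq> carrier \<Gamma>'" using assms(1) by (auto simp: hom_def)
  then show ?thesis
    unfolding primitive_def using u cochain_pullback[OF assms(1) u(1)] tuples_map
    by (intro exI[of _ "\<lambda>xs. u (map \<sigma> xs)"]) (fastforce simp: cobd_map)
qed

lemma (in group) bounded_vanishing_mono: "bounded_vanishing G N K \<Longrightarrow> K \<le> K' \<Longrightarrow> bounded_vanishing G N K'"
  unfolding bounded_vanishing_def cocycle_def using primitive_mono mult_right_mono cochain_nonneg by metis

lemma bounded_vanishing_iso:
  assumes "group \<Gamma>" "group \<Gamma>'" "\<sigma> \<in> iso \<Gamma> \<Gamma>'" "bounded_vanishing \<Gamma> N K"
  shows "bounded_vanishing \<Gamma>' N K"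
  unfolding bounded_vanishing_def
proof (intro allI impI)
  fix c f assume f: "cocycle \<Gamma>' N c f"
  define \<tau> where "\<tau> = inv_into (carrier \<Gamma>) \<sigma>"
  have \<tau>: "\<tau> \<in> hom \<Gamma>' \<Gamma>" using group.iso_set_sym[OF assms(1,3)] by (auto simp: \<tau>_def iso_def)
  have \<sigma>: "\<sigma> \<in> hom \<Gamma> \<Gamma>'" using assms(3) by (simp add: iso_def)
  have "primitive \<Gamma> N (K * c) (\<lambda>xs. f (map \<sigma> xs))"
    using assms(4) cocycle_pullback[OF \<sigma> f] by (simp add: bounded_vanishing_def)
  from primitive_pullback[OF \<tau> this] show "primitive \<Gamma>' N (K * c) f"
  proof (rule primitive_cong)
    fix xs assume xs: "xs \<in> tuples \<Gamma>' N"
    have "\<sigma> (\<tau> x) = x" if "x \<in> carrier \<Gamma>'" for x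
      using that assms(3) by (simp add: \<tau>_def iso_def bij_betw_def f_inv_into_f)
    then show "f (map \<sigma> (map \<tau> xs)) = f xs"
      using xs by (auto simp: tuples_def map_idI subset_iff)
  qed
qed

text \<open>Bounded functions of tuples in G that are invariant only under H still compute the
  bounded cohomology of H. The H-equivariant map \<open>r\<close> from G to H pulls a primitive on H
  back to G, and the prism from \<open>r\<close> to the identity corrects the difference; it has p
  terms, whence the summand \<open>real p * c\<close>.\<close>

lemma (in group) shapiro:
  assumes H: "subgroup H G"
    and F: "\<And>gs. gs \<in> tuples G (Suc p) \<Longrightarrow> \<bar>F gs\<bar> \<le> c"
    and F_inv: "\<And>gs a. gs \<in> tuples G (Suc p) \<Longrightarrow> a \<in> H \<Longrightarrow> F (map (\<lambda>x. a \<otimes> x) gs) = F gs"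
    and F_cocycle: "\<And>gs. gs \<in> tuples G (Suc (Suc p)) \<Longrightarrow> cobd F gs = 0"
    and prim: "primitive (G\<lparr>carrier := H\<rparr>) (Suc p) C F"
  obtains u where "\<And>gs. gs \<in> tuples G p \<Longrightarrow> \<bar>u gs\<bar> \<le> C + real p * c"
    and "\<And>gs a. gs \<in> tuples G p \<Longrightarrow> a \<in> H \<Longrightarrow> u (map (\<lambda>x. a \<otimes> x) gs) = u gs"
    and "\<And>gs. gs \<in> tuples G (Suc p) \<Longrightarrow> cobd u gs = F gs"
proof -
  interpret H: subgroup H G by fact
  \<comment> \<open>\<open>rep\<close> is a function of the coset, so it takes the same value at g
    and at h g for h in H. This gives \<open>r\<close> its equivariance.\<close>
  define rep where "rep g = (SOME a. a \<in> H #> g)" for g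
  define r where "r g = g \<otimes> inv (rep g)" for g
  have rep: "rep g \<in> H #> g" if "g \<in> carrier G" for g
    unfolding rep_def by (rule someI) (rule rcos_self[OF that H])
  have r: "r g \<in> H" if "g \<in> carrier G" for g
  proof -
    from rep[OF that] obtain h where h: "h \<in> H" "rep g = h \<otimes> g" by (auto simp: r_coset_def)
    then have "r g = inv h"
      using that by (simp add: r_def inv_mult_group m_assoc[symmetric])
    then show ?thesis using h by simp
  qed
  have r_mult: "r (h \<otimes> g) = h \<otimes> r g" if "h \<in> H" "g \<in> carrier G" for h g
  proof -
    have "H #> (h \<otimes> g) = H #> g"
      using that H by (simp add: coset_mult_assoc[symmetric] H.subset coset_join2)
    then have "rep (h \<otimes> g) = rep g" by (simp add: rep_def)
    moreover have "rep g \<in> carrier G"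
      using rep[OF that(2)] r_coset_subset_G[OF H.subset that(2)] by blast
    ultimately show ?thesis using that by (simp add: r_def m_assoc)
  qed
  from prim obtain u0 where u0: "cochain (G\<lparr>carrier := H\<rparr>) p C u0"
    "\<And>xs. xs \<in> tuples (G\<lparr>carrier := H\<rparr>) (Suc p) \<Longrightarrow> cobd u0 xs = F xs"
    by (auto simp: primitive_def)
  have rt: "map r gs \<in> tuples (G\<lparr>carrier := H\<rparr>) n" if "gs \<in> tuples G n" for gs n
    using that r by (auto simp: tuples_def)
  define u where "u gs = u0 (map r gs) + prism r id F gs" for gs
  show ?thesis
  proof
    fix gs assume gs: "gs \<in> tuples G p"
    have "\<bar>u0 (map r gs)\<bar> \<le> C" using u0(1) rt[OF gs] by (auto simp: cochain_def)
    moreover have "\<bar>prism r id F gs\<bar> \<le> real (length gs) * c"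
      by (rule prism_bound[where Y = "carrier G"]) (use gs r F in \<open>auto simp: tuples_def subset_iff\<close>)
    ultimately show "\<bar>u gs\<bar> \<le> C + real p * c" using gs by (simp add: u_def tuples_def)
  next
    fix gs a assume gs: "gs \<in> tuples G p" and a: "a \<in> H"
    have "map r (map (\<lambda>x. a \<otimes> x) gs) = map (\<lambda>x. a \<otimes> x) (map r gs)"
      using gs a r_mult by (auto simp: tuples_def subset_iff)
    then have "u0 (map r (map (\<lambda>x. a \<otimes> x) gs)) = u0 (map r gs)"
      by (simp only:) (use u0(1) rt[OF gs] a in \<open>auto simp: cochain_def\<close>)
    moreover have "prism r id F (map (\<lambda>x. a \<otimes> x) gs) = prism r id F gs"
      by (rule prism_equivariant[where Y = "carrier G" and \<tau> = "\<lambda>x. a \<otimes> x"])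
        (use gs r r_mult a F_inv in \<open>auto simp: tuples_def subset_iff\<close>)
    ultimately show "u (map (\<lambda>x. a \<otimes> x) gs) = u gs" by (simp add: u_def)
  next
    fix gs assume gs: "gs \<in> tuples G (Suc p)"
    have "prism r id (cobd F) gs = 0"
      by (rule prism_zero[where Y = "carrier G"]) (use gs r F_cocycle in \<open>auto simp: tuples_def subset_iff\<close>)
    then have "cobd (prism r id F) gs = F gs - F (map r gs)"
      using prism_homotopy[of r id F gs] by simp
    moreover have "cobd (\<lambda>gs. u0 (map r gs)) gs = F (map r gs)"
      using u0(2)[OF rt[OF gs]] by (simp add: cobd_map)
    moreover have "cobd u gs = cobd (\<lambda>gs. u0 (map r gs)) gs + cobd (prism r id F) gs"
      unfolding u_def[abs_def] by (rule cobd_add)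
    ultimately show "cobd u gs = F gs" by simp
  qed
qed

text \<open>
  The double complex of bounded invariant functions on (p-tuples of group elements) times
  (generic q-tuples of points).  Its rows are contracted by inserting a generic point
  \<open>act g (y k)\<close> and letting k tend to infinity along a generalised limit.
\<close>

locale generic_action = group G for G (structure) +
  fixes act :: "'a \<Rightarrow> 'x \<Rightarrow> 'x" and Pts :: "'x set" and gen :: "'x list set" and y :: "nat \<Rightarrow> 'x"
  assumes act_one: "x \<in> Pts \<Longrightarrow> act \<one> x = x"
    and act_mult: "a \<in> carrier G \<Longrightarrow> b \<in> carrier G \<Longrightarrow> x \<in> Pts \<Longrightarrow> act (a \<otimes> b) x = act a (act b x)"
    and gen_sub: "xs \<in> gen \<Longrightarrow> set xs \<subseteq> Pts"
    and gen_Nil: "[] \<in> gen"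
    and gen_act: "xs \<in> gen \<Longrightarrow> a \<in> carrier G \<Longrightarrow> map (act a) xs \<in> gen"
    and gen_delete: "xs \<in> gen \<Longrightarrow> i < length xs \<Longrightarrow> take i xs @ drop (Suc i) xs \<in> gen"
    and gen_y: "xs \<in> gen \<Longrightarrow> eventually (\<lambda>k. y k # xs \<in> gen) sequentially"
begin

definition gtup :: "nat \<Rightarrow> 'x list set" where
  "gtup q = {xs \<in> gen. length xs = q}"

definition stab :: "'x list \<Rightarrow> 'a set" where
  "stab xs = {a \<in> carrier G. map (act a) xs = xs}"

definition Inv :: "nat \<Rightarrow> nat \<Rightarrow> real \<Rightarrow> ('a list \<Rightarrow> 'x list \<Rightarrow> real) \<Rightarrow> bool" where
  "Inv p q c F \<longleftrightarrow> (\<forall>gs\<in>tuples G p. \<forall>xs\<in>gtup q. \<bar>F gs xs\<bar> \<le> c \<and>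
     (\<forall>a\<in>carrier G. F (map (\<lambda>x. a \<otimes> x) gs) (map (act a) xs) = F gs xs))"

lemma InvD:
  assumes "Inv p q c F" "gs \<in> tuples G p" "xs \<in> gtup q"
  shows "\<bar>F gs xs\<bar> \<le> c"
    and "a \<in> carrier G \<Longrightarrow> F (map (\<lambda>x. a \<otimes> x) gs) (map (act a) xs) = F gs xs"
  using assms unfolding Inv_def by blast+

lemma Inv_mono: "Inv p q c F \<Longrightarrow> c \<le> c' \<Longrightarrow> Inv p q c' F"
  unfolding Inv_def by fastforce

lemma Inv_diff:
  "Inv p q c F \<Longrightarrow> Inv p q c' F' \<Longrightarrow> Inv p q (c + c') (\<lambda>gs xs. F gs xs - F' gs xs)"
  unfolding Inv_def by (fastforce intro: order_trans[OF abs_triangle_ineq4] add_mono)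

lemma gtup_delete: "xs \<in> gtup (Suc n) \<Longrightarrow> i < length xs \<Longrightarrow> take i xs @ drop (Suc i) xs \<in> gtup n"
  using gen_delete by (auto simp: gtup_def)

lemma gtup_act: "xs \<in> gtup n \<Longrightarrow> a \<in> carrier G \<Longrightarrow> map (act a) xs \<in> gtup n"
  using gen_act by (auto simp: gtup_def)

lemma cobd_gtup_cong:
  assumes "xs \<in> gtup (Suc n)" "\<And>ys. ys \<in> gtup n \<Longrightarrow> f ys = g ys"
  shows "cobd f xs = cobd g xs"
  by (rule cobd_cong) (use assms gtup_delete in blast)

lemma Inv_rows:
  assumes F: "Inv p q c F"
  shows "Inv p (Suc q) (real (Suc q) * c) (\<lambda>gs xs. cobd (F gs) xs)"
  unfolding Inv_def
proof (intro ballI conjI)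
  fix gs xs assume gs: "gs \<in> tuples G p" and xs: "xs \<in> gtup (Suc q)"
  have len: "length xs = Suc q" using xs by (simp add: gtup_def)
  have "\<bar>cobd (F gs) xs\<bar> \<le> real (length xs) * c"
    by (rule abs_cobd_le) (use InvD(1)[OF F gs] gtup_delete[OF xs] in auto)
  then show "\<bar>cobd (F gs) xs\<bar> \<le> real (Suc q) * c" by (simp add: len)
  fix a assume a: "a \<in> carrier G"
  have "cobd (F (map (\<lambda>x. a \<otimes> x) gs)) (map (act a) xs)
      = cobd (\<lambda>l. F (map (\<lambda>x. a \<otimes> x) gs) (map (act a) l)) xs"
    by (rule cobd_map[symmetric])
  also have "\<dots> = cobd (F gs) xs"
    by (rule cobd_gtup_cong[OF xs]) (use InvD(2)[OF F gs _ a] in auto)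
  finally show "cobd (F (map (\<lambda>x. a \<otimes> x) gs)) (map (act a) xs) = cobd (F gs) xs" .
qed

lemma Inv_cols:
  assumes F: "Inv p q c F"
  shows "Inv (Suc p) q (real (Suc p) * c) (\<lambda>gs xs. cobd (\<lambda>l. F l xs) gs)"
  unfolding Inv_def
proof (intro ballI conjI)
  fix gs xs assume gs: "gs \<in> tuples G (Suc p)" and xs: "xs \<in> gtup q"
  have len: "length gs = Suc p" using gs by (simp add: tuples_def)
  have "\<bar>cobd (\<lambda>l. F l xs) gs\<bar> \<le> real (length gs) * c"
    by (rule abs_cobd_le) (use InvD(1)[OF F _ xs] tuples_delete[OF gs] in auto)
  then show "\<bar>cobd (\<lambda>l. F l xs) gs\<bar> \<le> real (Suc p) * c" by (simp add: len)
  fix a assume a: "a \<in> carrier G"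
  have "cobd (\<lambda>l. F l (map (act a) xs)) (map (\<lambda>x. a \<otimes> x) gs)
      = cobd (\<lambda>l. F (map (\<lambda>x. a \<otimes> x) l) (map (act a) xs)) gs"
    by (rule cobd_map[symmetric])
  also have "\<dots> = cobd (\<lambda>l. F l xs) gs"
    by (rule cobd_tuples_cong[OF gs]) (use InvD(2)[OF F _ xs a] in auto)
  finally show "cobd (\<lambda>l. F l (map (act a) xs)) (map (\<lambda>x. a \<otimes> x) gs) = cobd (\<lambda>l. F l xs) gs" .
qed

text \<open>Injectivity of the augmentation of a row: one generic point is enough to detect the
  value at the empty tuple.\<close>

lemma row_exact_zero:
  assumes "\<And>xs. xs \<in> gtup 1 \<Longrightarrow> cobd f xs = 0"
  shows "f [] = 0"
proof -
  from gen_y[OF gen_Nil] obtain k where "[y k] \<in> gen"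
    using eventually_happens trivial_limit_sequentially by blast
  then show ?thesis using assms[of "[y k]"] by (simp add: gtup_def)
qed

text \<open>If y # xs is generic, closedness at y # xs says that F at xs is the coboundary of
  "insert y, then apply F", so inserting y contracts the row. A single y need not be generic for all
  xs, whence the limit over k. Translating y by the head of \<open>gs\<close> makes the insertion
  equivariant, which takes at least one group entry.\<close>

lemma row_exact:
  assumes F: "Inv (Suc p) (Suc q) c F"
    and closed: "\<And>gs xs. gs \<in> tuples G (Suc p) \<Longrightarrow> xs \<in> gtup (Suc (Suc q)) \<Longrightarrow> cobd (F gs) xs = 0"
  obtains v where "Inv (Suc p) q c v"
    and "\<And>gs xs. gs \<in> tuples G (Suc p) \<Longrightarrow> xs \<in> gtup (Suc q) \<Longrightarrow> cobd (v gs) xs = F gs xs"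
proof -
  obtain L where L: "gen_limit sequentially L"
    using gen_limit_exists[OF sequentially_bot] .
  \<comment> \<open>Cut off by 0 outside the domain: the laws of generalised limits ask for a bound
    at every k, not only at the large ones.\<close>
  define F1 where "F1 gs xs = (if gs \<in> tuples G (Suc p) \<and> xs \<in> gtup (Suc q) then F gs xs else 0)" for gs xs
  have F1: "F1 gs xs = F gs xs" if "gs \<in> tuples G (Suc p)" "xs \<in> gtup (Suc q)" for gs xs
    using that by (simp add: F1_def)
  have F1_le: "\<bar>F1 gs xs\<bar> \<le> \<bar>c\<bar>" for gs xs
    using InvD(1)[OF F, of gs xs] by (auto simp: F1_def)
  have bdd: "bounded (range (\<lambda>k. F1 (gs k) (xs k)))" for gs :: "nat \<Rightarrow> _" and xs
    using F1_le by (auto simp: bounded_iff)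
  define v where "v gs xs = L (\<lambda>k. F1 gs (act (hd gs) (y k) # xs))" for gs xs
  \<comment> \<open>Apply \<open>gen_y\<close> to the translate of xs by the inverse of g, then
    translate the result back by g.\<close>
  have ev: "eventually (\<lambda>k. act g (y k) # xs \<in> gtup (Suc n) \<and> y k \<in> Pts) sequentially"
    if "g \<in> carrier G" "xs \<in> gtup n" for g xs n
  proof -
    have "map (act (inv g)) xs \<in> gen" using gtup_act[OF that(2)] that(1) by (simp add: gtup_def)
    from gen_y[OF this] show ?thesis
    proof eventually_elim
      case (elim k)
      have "x \<in> Pts" if "x \<in> set xs" for x
        using that \<open>xs \<in> gtup n\<close> gen_sub by (auto simp: gtup_def)
      then have "map (act g) (map (act (inv g)) xs) = xs"
        using that(1) by (auto simp: act_mult[symmetric] act_one intro!: map_idI)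
      then show ?case
        using gen_act[OF elim that(1)] gen_sub[OF elim] that(2) by (simp add: gtup_def)
    qed
  qed
  have hd_in: "hd gs \<in> carrier G" if "gs \<in> tuples G (Suc p)" for gs
    using that by (cases gs) (auto simp: tuples_def)
  show ?thesis
  proof
    show "Inv (Suc p) q c v"
      unfolding Inv_def
    proof (intro ballI conjI)
      fix gs xs assume gs: "gs \<in> tuples G (Suc p)" and xs: "xs \<in> gtup q"
      have "eventually (\<lambda>k. \<bar>F1 gs (act (hd gs) (y k) # xs)\<bar> \<le> c) sequentially"
        using ev[OF hd_in[OF gs] xs] by eventually_elim (use InvD(1)[OF F gs] F1[OF gs] in auto)
      then show "\<bar>v gs xs\<bar> \<le> c"
        unfolding v_def by (intro gen_limit_bound[OF L] bdd)
      fix a assume a: "a \<in> carrier G"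
      have hd: "hd (map (\<lambda>x. a \<otimes> x) gs) = a \<otimes> hd gs"
        using gs by (cases gs) (auto simp: tuples_def)
      note gs' = tuples_translate[OF gs a]
      show "v (map (\<lambda>x. a \<otimes> x) gs) (map (act a) xs) = v gs xs"
        unfolding v_def hd
      proof (intro gen_limit_cong[OF L] bdd)
        show "eventually (\<lambda>k. F1 (map (\<lambda>x. a \<otimes> x) gs) (act (a \<otimes> hd gs) (y k) # map (act a) xs)
            = F1 gs (act (hd gs) (y k) # xs)) sequentially"
          using ev[OF hd_in[OF gs] xs]
        proof eventually_elim
          case (elim k)
          then have "act (a \<otimes> hd gs) (y k) # map (act a) xs = map (act a) (act (hd gs) (y k) # xs)"
            using a hd_in[OF gs] by (simp add: act_mult)
          then show ?case
            using elim gtup_act[of "act (hd gs) (y k) # xs" "Suc q" a] a F1[OF gs] F1[OF gs']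
              InvD(2)[OF F gs _ a, of "act (hd gs) (y k) # xs"]
            by simp
        qed
      qed
    qed
    fix gs xs assume gs: "gs \<in> tuples G (Suc p)" and xs: "xs \<in> gtup (Suc q)"
    define f where "f k l = F1 gs (act (hd gs) (y k) # l)" for k l
    have lim: "L (\<lambda>k. cobd (f k) xs) = cobd (\<lambda>l. L (\<lambda>k. f k l)) xs \<and> bounded (range (\<lambda>k. cobd (f k) xs))"
      by (rule gen_limit_cobd[OF L]) (simp add: f_def bdd)
    have "L (\<lambda>k. cobd (f k) xs) = L (\<lambda>k. F gs xs)"
    proof (rule gen_limit_cong[OF L])
      show "bounded (range (\<lambda>k. cobd (f k) xs))" using lim by blast
      show "bounded (range (\<lambda>k::nat. F gs xs))" by (simp add: image_constant_conv)
      show "eventually (\<lambda>k. cobd (f k) xs = F gs xs) sequentially"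
        using ev[OF hd_in[OF gs] xs]
      proof eventually_elim
        case (elim k)
        have "cobd (F1 gs) (act (hd gs) (y k) # xs) = cobd (F gs) (act (hd gs) (y k) # xs)"
          by (rule cobd_gtup_cong) (use elim F1[OF gs] in auto)
        also have "\<dots> = 0" using closed gs elim by blast
        finally show ?case using F1[OF gs xs] by (simp add: f_def[abs_def])
      qed
    qed
    then show "cobd (v gs) xs = F gs xs"
      using lim gen_limit_const[OF L, of "F gs xs"] by (simp add: v_def[abs_def] f_def)
  qed
qed

lemma stab_subgroup:
  assumes "set xs \<subseteq> Pts"
  shows "subgroup (stab xs) G"
proof
  show "stab xs \<subseteq> carrier G" by (auto simp: stab_def)
  show "\<one> \<in> stab xs" using assms act_one by (auto simp: stab_def intro!: map_idI)
next
  fix a b assume "a \<in> stab xs" "b \<in> stab xs"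
  then have ab: "a \<in> carrier G" "b \<in> carrier G" "\<And>x. x \<in> set xs \<Longrightarrow> act a x = x" "\<And>x. x \<in> set xs \<Longrightarrow> act b x = x"
    by (auto simp: stab_def map_eq_conv[where g = id, simplified])
  then show "a \<otimes> b \<in> stab xs"
    using assms by (auto simp: stab_def act_mult subset_iff intro!: map_idI)
next
  fix a assume "a \<in> stab xs"
  then have a: "a \<in> carrier G" "\<And>x. x \<in> set xs \<Longrightarrow> act a x = x"
    by (auto simp: stab_def map_eq_conv[where g = id, simplified])
  have "act (inv a) x = x" if "x \<in> set xs" for x
    using a that assms act_mult[of "inv a" a x] act_one[of x] by auto
  then show "inv a \<in> stab xs"
    using a(1) by (auto simp: stab_def intro!: map_idI)
qed

text \<open>An invariant function is determined by its values on one representative of each orbit of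
  point tuples, where invariance under the stabiliser remains. A column thus splits into complexes
  of the kind treated in \<open>shapiro\<close>, one per orbit, and the solutions are transported
  along the orbits.\<close>

lemma col_exact:
  assumes F: "Inv (Suc p) q c F"
    and closed: "\<And>gs xs. gs \<in> tuples G (Suc (Suc p)) \<Longrightarrow> xs \<in> gtup q \<Longrightarrow> cobd (\<lambda>l. F l xs) gs = 0"
    and prim: "\<And>xs. xs \<in> gtup q \<Longrightarrow> primitive (G\<lparr>carrier := stab xs\<rparr>) (Suc p) C (\<lambda>gs. F gs xs)"
  obtains v where "Inv p q (C + real p * c) v"
    and "\<And>gs xs. gs \<in> tuples G (Suc p) \<Longrightarrow> xs \<in> gtup q \<Longrightarrow> cobd (\<lambda>l. v l xs) gs = F gs xs"
proof -
  have Pts: "set xs \<subseteq> Pts" if "xs \<in> gtup q" for xs using that gen_sub by (auto simp: gtup_def)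
  have "\<forall>xs\<in>gtup q. \<exists>u. (\<forall>gs\<in>tuples G p. \<bar>u gs\<bar> \<le> C + real p * c) \<and>
     (\<forall>gs\<in>tuples G p. \<forall>a\<in>stab xs. u (map (\<lambda>x. a \<otimes> x) gs) = u gs) \<and>
     (\<forall>gs\<in>tuples G (Suc p). cobd u gs = F gs xs)"
  proof
    fix xs assume xs: "xs \<in> gtup q"
    obtain u where "\<And>gs. gs \<in> tuples G p \<Longrightarrow> \<bar>u gs\<bar> \<le> C + real p * c"
      "\<And>gs a. gs \<in> tuples G p \<Longrightarrow> a \<in> stab xs \<Longrightarrow> u (map (\<lambda>x. a \<otimes> x) gs) = u gs"
      "\<And>gs. gs \<in> tuples G (Suc p) \<Longrightarrow> cobd u gs = F gs xs"
    proof (rule shapiro[OF stab_subgroup[OF Pts[OF xs]], of p "\<lambda>gs. F gs xs" c C])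
      fix gs assume gs: "gs \<in> tuples G (Suc p)"
      show "\<bar>F gs xs\<bar> \<le> c" using InvD(1)[OF F gs xs] .
      fix a assume "a \<in> stab xs"
      then show "F (map (\<lambda>x. a \<otimes> x) gs) xs = F gs xs"
        using InvD(2)[OF F gs xs, of a] by (simp add: stab_def)
    qed (use closed prim xs in auto)
    then show "\<exists>u. (\<forall>gs\<in>tuples G p. \<bar>u gs\<bar> \<le> C + real p * c) \<and>
       (\<forall>gs\<in>tuples G p. \<forall>a\<in>stab xs. u (map (\<lambda>x. a \<otimes> x) gs) = u gs) \<and>
       (\<forall>gs\<in>tuples G (Suc p). cobd u gs = F gs xs)" by blast
  qed
  then obtain U where U_le: "\<And>xs gs. xs \<in> gtup q \<Longrightarrow> gs \<in> tuples G p \<Longrightarrow> \<bar>U xs gs\<bar> \<le> C + real p * c"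
    and U_inv: "\<And>xs gs a. xs \<in> gtup q \<Longrightarrow> gs \<in> tuples G p \<Longrightarrow> a \<in> stab xs \<Longrightarrow>
      U xs (map (\<lambda>x. a \<otimes> x) gs) = U xs gs"
    and U_cobd: "\<And>xs gs. xs \<in> gtup q \<Longrightarrow> gs \<in> tuples G (Suc p) \<Longrightarrow> cobd (U xs) gs = F gs xs"
    unfolding bchoice_iff by blast
  \<comment> \<open>The predicate under SOME is the same for all tuples of an orbit, so
    \<open>R\<close> picks one representative per orbit; \<open>k xs\<close> is a chosen element
    moving \<open>xs\<close> to it.\<close>
  define R where "R xs = (SOME ys. \<exists>a\<in>carrier G. ys = map (act a) xs)" for xs
  define k where "k xs = (SOME a. a \<in> carrier G \<and> R xs = map (act a) xs)" for xs
  have k: "k xs \<in> carrier G \<and> R xs = map (act (k xs)) xs" if "xs \<in> gtup q" for xs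
  proof -
    have "\<exists>a\<in>carrier G. R xs = map (act a) xs"
      unfolding R_def by (rule someI_ex) (use one_closed in blast)
    then have "\<exists>a. a \<in> carrier G \<and> R xs = map (act a) xs" by blast
    then show ?thesis unfolding k_def by (rule someI_ex)
  qed
  have R_in: "R xs \<in> gtup q" if "xs \<in> gtup q" for xs
    using k[OF that] gtup_act[OF that] by simp
  have map_mult: "map (act (a \<otimes> b)) xs = map (act a) (map (act b) xs)"
    if "xs \<in> gtup q" "a \<in> carrier G" "b \<in> carrier G" for a b xs
    using Pts[OF that(1)] that by (auto simp: act_mult)
  have map_inv: "map (act (inv a)) (map (act a) xs) = xs" if "xs \<in> gtup q" "a \<in> carrier G" for a xs
    using Pts[OF that(1)] that by (auto simp: act_mult[symmetric] act_one subset_iff intro!: map_idI)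
  have R_act: "R (map (act a) xs) = R xs" if xs: "xs \<in> gtup q" and a: "a \<in> carrier G" for a xs
  proof -
    have "(\<exists>b\<in>carrier G. ys = map (act b) (map (act a) xs)) \<longleftrightarrow> (\<exists>b\<in>carrier G. ys = map (act b) xs)" for ys
    proof
      assume "\<exists>b\<in>carrier G. ys = map (act b) (map (act a) xs)"
      then show "\<exists>b\<in>carrier G. ys = map (act b) xs" using map_mult[OF xs _ a] a by (metis m_closed)
    next
      assume "\<exists>b\<in>carrier G. ys = map (act b) xs"
      then obtain b where b: "b \<in> carrier G" "ys = map (act b) xs" by blast
      then have "ys = map (act (b \<otimes> inv a)) (map (act a) xs)"
        using map_mult[OF gtup_act[OF xs a], of b "inv a"] map_inv[OF xs a] a by (simp del: map_map)
      then show "\<exists>b\<in>carrier G. ys = map (act b) (map (act a) xs)" using a b by blast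
    qed
    then show ?thesis unfolding R_def by presburger
  qed
  define v where "v gs xs = U (R xs) (map (\<lambda>x. k xs \<otimes> x) gs)" for gs xs
  show ?thesis
  proof
    show "Inv p q (C + real p * c) v"
      unfolding Inv_def
    proof (intro ballI conjI)
      fix gs xs assume gs: "gs \<in> tuples G p" and xs: "xs \<in> gtup q"
      show "\<bar>v gs xs\<bar> \<le> C + real p * c"
        unfolding v_def using U_le R_in[OF xs] tuples_translate[OF gs] k[OF xs] by blast
      fix a assume a: "a \<in> carrier G"
      \<comment> \<open>\<open>s\<close> measures how far the choices of \<open>k\<close> fail to be
        compatible. It fixes the representative, and \<open>U\<close> is invariant under such
        elements, so \<open>v\<close> is invariant under all of G.\<close>
      define s where "s = k (map (act a) xs) \<otimes> a \<otimes> inv (k xs)"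
      note k1 = k[OF xs] and k2 = k[OF gtup_act[OF xs a]]
      have "map (act s) (R xs) = map (act (k (map (act a) xs) \<otimes> a)) (map (act (inv (k xs))) (R xs))"
        unfolding s_def using k1 k2 a by (intro map_mult[OF R_in[OF xs]]) auto
      also have "map (act (inv (k xs))) (R xs) = xs"
        using k1 map_inv[OF xs, of "k xs"] by metis
      also have "map (act (k (map (act a) xs) \<otimes> a)) xs = R xs"
        using map_mult[OF xs _ a] k2 R_act[OF xs a] by metis
      finally have s: "s \<in> stab (R xs)" using k1 k2 a by (simp add: stab_def s_def)
      have "k (map (act a) xs) \<otimes> a = s \<otimes> k xs"
        using k1 k2 a by (simp add: s_def m_assoc)
      then have "map (\<lambda>x. k (map (act a) xs) \<otimes> x) (map (\<lambda>x. a \<otimes> x) gs) = map (\<lambda>x. s \<otimes> x) (map (\<lambda>x. k xs \<otimes> x) gs)"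
        using gs k1 k2 a s by (auto simp: tuples_def stab_def m_assoc[symmetric] subset_iff)
      then show "v (map (\<lambda>x. a \<otimes> x) gs) (map (act a) xs) = v gs xs"
        unfolding v_def R_act[OF xs a] using U_inv[OF R_in[OF xs] tuples_translate[OF gs] s] k1 by metis
    qed
    fix gs xs assume gs: "gs \<in> tuples G (Suc p)" and xs: "xs \<in> gtup q"
    note k1 = k[OF xs]
    have "cobd (\<lambda>l. v l xs) gs = cobd (U (R xs)) (map (\<lambda>x. k xs \<otimes> x) gs)"
      unfolding v_def by (rule cobd_map)
    also have "\<dots> = F (map (\<lambda>x. k xs \<otimes> x) gs) (R xs)"
      using U_cobd[OF R_in[OF xs] tuples_translate[OF gs]] k1 by blast
    also have "\<dots> = F gs xs" using InvD(2)[OF F gs xs] k1 by simp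
    finally show "cobd (\<lambda>l. v l xs) gs = F gs xs" .
  qed
qed

lemma Inv_cocycle_stab:
  assumes "Inv (Suc p) q c F" "xs \<in> gtup q"
    and "\<And>gs. gs \<in> tuples G (Suc (Suc p)) \<Longrightarrow> cobd (\<lambda>l. F l xs) gs = 0"
  shows "cocycle (G\<lparr>carrier := stab xs\<rparr>) (Suc p) c (\<lambda>gs. F gs xs)"
  unfolding cocycle_def cochain_def
proof (intro conjI ballI)
  have sub: "gs \<in> tuples G n" if "gs \<in> tuples (G\<lparr>carrier := stab xs\<rparr>) n" for gs n
    using that by (auto simp: tuples_def stab_def)
  fix gs assume gs: "gs \<in> tuples (G\<lparr>carrier := stab xs\<rparr>) (Suc p)"
  show "\<bar>F gs xs\<bar> \<le> c" using InvD(1)[OF assms(1) sub[OF gs] assms(2)] .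
  fix a assume "a \<in> carrier (G\<lparr>carrier := stab xs\<rparr>)"
  then show "F (map (\<lambda>x. a \<otimes>\<^bsub>G\<lparr>carrier := stab xs\<rparr>\<^esub> x) gs) xs = F gs xs"
    using InvD(2)[OF assms(1) sub[OF gs] assms(2), of a] by (simp add: stab_def)
next
  fix gs assume "gs \<in> tuples (G\<lparr>carrier := stab xs\<rparr>) (Suc (Suc p))"
  then show "cobd (\<lambda>gs. F gs xs) gs = 0"
    using assms(3) by (auto simp: tuples_def stab_def)
qed

text \<open>
  A tail continues an invariant function W 0 of points only down to a function W N of group
  elements only, through the antidiagonal of the double complex.
\<close>

definition tail :: "nat \<Rightarrow> real \<Rightarrow> (nat \<Rightarrow> 'a list \<Rightarrow> 'x list \<Rightarrow> real) \<Rightarrow> bool" where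
  "tail N c W \<longleftrightarrow>
     (\<forall>i j. i + j = N \<longrightarrow> Inv i j c (W i)) \<and>
     (\<forall>i j. i + Suc j = N \<longrightarrow> (\<forall>gs\<in>tuples G (Suc i). \<forall>xs\<in>gtup (Suc j).
        cobd (\<lambda>l. W i l xs) gs = cobd (W (Suc i) gs) xs))"

lemma tail_mono: "tail N c W \<Longrightarrow> c \<le> c' \<Longrightarrow> tail N c' W"
  unfolding tail_def using Inv_mono by blast

text \<open>Induction along the antidiagonal i + j = N. The row coboundary of \<open>u\<close> is
  column-closed, so vanishing on stabilisers gives it a column primitive \<open>u'\<close> with one
  group entry less. The induction hypothesis treats \<open>u'\<close>; what is then left of
  \<open>u\<close> is row-closed and has a row primitive. At p = 0 no group entry remains and
  \<open>tails\<close> takes over. \<open>Q\<close> is handed through and records how the tail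
  ends.\<close>

lemma descent_step:
  assumes van: "\<And>p xs. 1 \<le> p \<Longrightarrow> p < N \<Longrightarrow> xs \<in> gtup (Suc N - p) \<Longrightarrow>
      bounded_vanishing (G\<lparr>carrier := stab xs\<rparr>) p K"
    and tails: "\<And>c w. 0 \<le> c \<Longrightarrow> Inv 0 N c w \<Longrightarrow> (\<And>xs. xs \<in> gtup (Suc N) \<Longrightarrow> cobd (w []) xs = 0) \<Longrightarrow>
      \<exists>v W. Inv 0 (N - 1) (E * c) v \<and> tail N (E * c) W \<and> Q W \<and>
        (\<forall>xs\<in>gtup N. w [] xs = cobd (v []) xs + W 0 [] xs)"
    and K: "0 \<le> K" and E: "0 \<le> E"
  shows "\<exists>M\<ge>0. \<forall>q c u. p + Suc q = N \<longrightarrow> 0 \<le> c \<longrightarrow> Inv p (Suc q) c u \<longrightarrow>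
     (\<forall>gs\<in>tuples G (Suc p). \<forall>xs\<in>gtup (Suc (Suc q)). cobd (\<lambda>l. cobd (u l) xs) gs = 0) \<longrightarrow>
     (\<exists>v W. Inv p q (M * c) v \<and> tail N (M * c) W \<and> Q W \<and>
       (\<forall>gs\<in>tuples G (Suc p). \<forall>xs\<in>gtup (Suc q).
          cobd (\<lambda>l. u l xs) gs = cobd (\<lambda>l. cobd (v l) xs) gs + cobd (\<lambda>l. W p l xs) gs))"
proof (induction p)
  case 0
  show ?case
  proof (rule exI[of _ E], intro conjI E allI impI)
    fix q c u assume N: "0 + Suc q = N" and c: "(0::real) \<le> c" and u: "Inv 0 (Suc q) c u"
      and closed: "\<forall>gs\<in>tuples G (Suc 0). \<forall>xs\<in>gtup (Suc (Suc q)). cobd (\<lambda>l. cobd (u l) xs) gs = 0"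
    \<comment> \<open>A coboundary at a one-entry tuple is the value at the empty tuple, so the
      mixed condition turns into row-closedness of \<open>u []\<close>.\<close>
    have one: "[\<one>] \<in> tuples G (Suc 0)" by (simp add: tuples_def)
    have "cobd (u []) xs = 0" if "xs \<in> gtup (Suc N)" for xs
    proof -
      have "cobd (\<lambda>l. cobd (u l) xs) [\<one>] = 0" using closed one that N by auto
      then show ?thesis by simp
    qed
    with tails[of c u] u N c obtain v W where v: "Inv 0 q (E * c) v" "tail N (E * c) W" "Q W"
      and eq: "\<And>xs. xs \<in> gtup (Suc q) \<Longrightarrow> u [] xs = cobd (v []) xs + W 0 [] xs" by auto
    show "\<exists>v W. Inv 0 q (E * c) v \<and> tail N (E * c) W \<and> Q W \<and>
       (\<forall>gs\<in>tuples G (Suc 0). \<forall>xs\<in>gtup (Suc q).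
          cobd (\<lambda>l. u l xs) gs = cobd (\<lambda>l. cobd (v l) xs) gs + cobd (\<lambda>l. W 0 l xs) gs)"
      using v eq by (intro exI[of _ v] exI[of _ W]) (auto simp: tuples_def length_Suc_conv)
  qed
next
  case (Suc p)
  then obtain M where M: "M \<ge> 0" and IH: "\<And>q c u. p + Suc q = N \<Longrightarrow> 0 \<le> c \<Longrightarrow> Inv p (Suc q) c u \<Longrightarrow>
     \<forall>gs\<in>tuples G (Suc p). \<forall>xs\<in>gtup (Suc (Suc q)). cobd (\<lambda>l. cobd (u l) xs) gs = 0 \<Longrightarrow>
     \<exists>v W. Inv p q (M * c) v \<and> tail N (M * c) W \<and> Q W \<and>
       (\<forall>gs\<in>tuples G (Suc p). \<forall>xs\<in>gtup (Suc q).
          cobd (\<lambda>l. u l xs) gs = cobd (\<lambda>l. cobd (v l) xs) gs + cobd (\<lambda>l. W p l xs) gs)"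
    by blast
  \<comment> \<open>Norm of \<open>u'\<close> per unit of c: \<open>K\<close> for solving over the
    stabiliser and \<open>real p\<close> from the prism in \<open>shapiro\<close>, both applied to a
    row coboundary with at most N + 1 faces.\<close>
  define A where "A = (K + real p) * real (Suc N)"
  have A: "A \<ge> 0" using K by (simp add: A_def)
  \<comment> \<open>The summands bound the three terms of \<open>z\<close> below: \<open>u\<close>,
    the column coboundary of \<open>v'\<close>, and the tail.\<close>
  define M' where "M' = 1 + real (Suc p) * (M * A) + M * A"
  have M': "M' \<ge> 0" using M A by (simp add: M'_def)
  have MA: "M * A \<le> M'" using M A by (simp add: M'_def)
  show ?case
  proof (rule exI[of _ M'], intro conjI M' allI impI)
    fix q c u assume N: "Suc p + Suc q = N" and c: "(0::real) \<le> c" and u: "Inv (Suc p) (Suc q) c u"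
      and closed: "\<forall>gs\<in>tuples G (Suc (Suc p)). \<forall>xs\<in>gtup (Suc (Suc q)). cobd (\<lambda>l. cobd (u l) xs) gs = 0"
    have du: "Inv (Suc p) (Suc (Suc q)) (real (Suc N) * c) (\<lambda>gs xs. cobd (u gs) xs)"
      using Inv_mono[OF Inv_rows[OF u], of "real (Suc N) * c"] N c by (simp add: mult_right_mono)
    have prim: "primitive (G\<lparr>carrier := stab xs\<rparr>) (Suc p) (K * (real (Suc N) * c)) (\<lambda>gs. cobd (u gs) xs)"
      if xs: "xs \<in> gtup (Suc (Suc q))" for xs
    proof -
      have "bounded_vanishing (G\<lparr>carrier := stab xs\<rparr>) (Suc p) K"
        by (rule van) (use N xs in \<open>auto simp: Suc_diff_le\<close>)
      moreover have "cocycle (G\<lparr>carrier := stab xs\<rparr>) (Suc p) (real (Suc N) * c) (\<lambda>gs. cobd (u gs) xs)"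
        using Inv_cocycle_stab[OF du xs] closed xs by blast
      ultimately show ?thesis by (simp add: bounded_vanishing_def)
    qed
    obtain u' where u': "Inv p (Suc (Suc q)) (K * (real (Suc N) * c) + real p * (real (Suc N) * c)) u'"
      and du': "\<And>gs xs. gs \<in> tuples G (Suc p) \<Longrightarrow> xs \<in> gtup (Suc (Suc q)) \<Longrightarrow>
        cobd (\<lambda>l. u' l xs) gs = cobd (u gs) xs"
      using col_exact[OF du _ prim] closed by blast
    have A_eq: "K * (real (Suc N) * c) + real p * (real (Suc N) * c) = A * c"
      by (simp add: A_def algebra_simps)
    have "cobd (\<lambda>l. cobd (u' l) xs) gs = 0" if "gs \<in> tuples G (Suc p)" "xs \<in> gtup (Suc (Suc (Suc q)))" for gs xs
    proof -
      have "cobd (\<lambda>l. cobd (u' l) xs) gs = cobd (\<lambda>m. cobd (\<lambda>l. u' l m) gs) xs" by (rule cobd_swap)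
      also have "\<dots> = cobd (cobd (u gs)) xs"
        by (rule cobd_gtup_cong[OF that(2)]) (use du' that(1) in blast)
      finally show ?thesis by simp
    qed
    with IH[of "Suc q" "A * c" u'] u' A c N A_eq
    obtain v' W where v': "Inv p (Suc q) (M * (A * c)) v'" and W: "tail N (M * (A * c)) W" and Q: "Q W"
      and eq: "\<And>gs xs. gs \<in> tuples G (Suc p) \<Longrightarrow> xs \<in> gtup (Suc (Suc q)) \<Longrightarrow>
          cobd (\<lambda>l. u' l xs) gs = cobd (\<lambda>l. cobd (v' l) xs) gs + cobd (\<lambda>l. W p l xs) gs"
      by auto
    \<comment> \<open>This is row-closed: the row coboundary of \<open>u\<close> is the column
      coboundary of \<open>u'\<close>, and the tail relation trades the column coboundary of
      \<open>W p\<close> for the row coboundary of \<open>W (Suc p)\<close>.\<close>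
    define z where "z gs xs = u gs xs - cobd (\<lambda>l. v' l xs) gs - W (Suc p) gs xs" for gs xs
    have "Inv (Suc p) (Suc q) (M * (A * c)) (W (Suc p))"
      using W N unfolding tail_def by blast
    then have z: "Inv (Suc p) (Suc q) (c + real (Suc p) * (M * (A * c)) + M * (A * c)) z"
      unfolding z_def[abs_def] by (intro Inv_diff u Inv_cols v')
    have bound: "c + real (Suc p) * (M * (A * c)) + M * (A * c) = M' * c"
      by (simp add: M'_def algebra_simps)
    have "cobd (z gs) xs = 0" if gs: "gs \<in> tuples G (Suc p)" and xs: "xs \<in> gtup (Suc (Suc q))" for gs xs
    proof -
      have "cobd (\<lambda>m. cobd (\<lambda>l. v' l m) gs) xs = cobd (\<lambda>l. cobd (v' l) xs) gs"
        by (rule cobd_swap[symmetric])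
      moreover have "cobd (\<lambda>l. W p l xs) gs = cobd (W (Suc p) gs) xs"
        using W N gs xs unfolding tail_def by auto
      ultimately show ?thesis
        using du'[OF gs xs] eq[OF gs xs] unfolding z_def[abs_def] by (simp add: cobd_diff)
    qed
    from row_exact[OF z this] obtain v where v: "Inv (Suc p) q (M' * c) v"
      and dv: "\<And>gs xs. gs \<in> tuples G (Suc p) \<Longrightarrow> xs \<in> gtup (Suc q) \<Longrightarrow> cobd (v gs) xs = z gs xs"
      unfolding bound by blast
    have "M * (A * c) \<le> M' * c" using mult_right_mono[OF MA c] by (simp add: mult.assoc)
    with W have W': "tail N (M' * c) W" by (rule tail_mono)
    show "\<exists>v W. Inv (Suc p) q (M' * c) v \<and> tail N (M' * c) W \<and> Q W \<and>
       (\<forall>gs\<in>tuples G (Suc (Suc p)). \<forall>xs\<in>gtup (Suc q).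
          cobd (\<lambda>l. u l xs) gs = cobd (\<lambda>l. cobd (v l) xs) gs + cobd (\<lambda>l. W (Suc p) l xs) gs)"
    proof (intro exI[of _ v] exI[of _ W] conjI v W' Q ballI)
      fix gs xs assume gs: "gs \<in> tuples G (Suc (Suc p))" and xs: "xs \<in> gtup (Suc q)"
      have "cobd (\<lambda>l. cobd (v l) xs) gs = cobd (\<lambda>l. z l xs) gs"
        by (rule cobd_tuples_cong[OF gs]) (use dv xs in blast)
      also have "\<dots> = cobd (\<lambda>l. u l xs) gs - cobd (cobd (\<lambda>l. v' l xs)) gs - cobd (\<lambda>l. W (Suc p) l xs) gs"
        unfolding z_def by (simp add: cobd_diff)
      finally show "cobd (\<lambda>l. u l xs) gs = cobd (\<lambda>l. cobd (v l) xs) gs + cobd (\<lambda>l. W (Suc p) l xs) gs"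
        by simp
    qed
  qed
qed

text \<open>The cocycle \<open>f\<close> enters as a function of one point that does not depend on
  it. In the length of \<open>f\<close> itself a primitive over stabilisers is asked for this one
  cocycle, hence the separate hypothesis on single points; \<open>van\<close> speaks of shorter
  lengths only. In the outcome \<open>f\<close> agrees with the end of a tail up to a coboundary,
  with control of norms.\<close>

theorem descent:
  assumes van: "\<And>p xs. 1 \<le> p \<Longrightarrow> p \<le> n \<Longrightarrow> xs \<in> gtup (Suc (Suc n) - p) \<Longrightarrow>
      bounded_vanishing (G\<lparr>carrier := stab xs\<rparr>) p K"
    and tails: "\<And>c w. 0 \<le> c \<Longrightarrow> Inv 0 (Suc n) c w \<Longrightarrow> (\<And>xs. xs \<in> gtup (Suc (Suc n)) \<Longrightarrow> cobd (w []) xs = 0) \<Longrightarrow>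
      \<exists>v W. Inv 0 n (E * c) v \<and> tail (Suc n) (E * c) W \<and> Q W \<and>
        (\<forall>xs\<in>gtup (Suc n). w [] xs = cobd (v []) xs + W 0 [] xs)"
    and K: "0 \<le> K" and E: "0 \<le> E"
  shows "\<exists>M\<ge>0. \<forall>c C f. cocycle G (Suc n) c f \<longrightarrow> 0 \<le> C \<longrightarrow>
    (\<forall>xs\<in>gtup 1. primitive (G\<lparr>carrier := stab xs\<rparr>) (Suc n) C f) \<longrightarrow>
    (\<exists>v W. cochain G n (M * (C + c)) v \<and> tail (Suc n) (M * (C + c)) W \<and> Q W \<and>
      (\<forall>gs\<in>tuples G (Suc n). f gs = cobd v gs + W (Suc n) gs []))"
proof -
  obtain M where M: "M \<ge> 0" and step: "\<And>c u. 0 \<le> c \<Longrightarrow> Inv n (Suc 0) c u \<Longrightarrow>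
     \<forall>gs\<in>tuples G (Suc n). \<forall>xs\<in>gtup (Suc (Suc 0)). cobd (\<lambda>l. cobd (u l) xs) gs = 0 \<Longrightarrow>
     \<exists>v W. Inv n 0 (M * c) v \<and> tail (Suc n) (M * c) W \<and> Q W \<and>
       (\<forall>gs\<in>tuples G (Suc n). \<forall>xs\<in>gtup (Suc 0).
          cobd (\<lambda>l. u l xs) gs = cobd (\<lambda>l. cobd (v l) xs) gs + cobd (\<lambda>l. W n l xs) gs)"
    using descent_step[of "Suc n" K E Q n] van tails K E by auto
  show ?thesis
  proof (rule exI[of _ "M * real (Suc n)"], intro conjI allI impI)
    show "0 \<le> M * real (Suc n)" using M by simp
    fix c C f assume f: "cocycle G (Suc n) c f" and C: "0 \<le> C"
      and prim: "\<forall>xs\<in>gtup 1. primitive (G\<lparr>carrier := stab xs\<rparr>) (Suc n) C f"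
    have c: "0 \<le> c" using f cochain_nonneg by (auto simp: cocycle_def)
    have df: "Inv (Suc n) 1 c (\<lambda>gs xs. f gs)"
      using f by (auto simp: Inv_def cocycle_def cochain_def)
    obtain u where u: "Inv n 1 (C + real n * c) u"
      and du: "\<And>gs xs. gs \<in> tuples G (Suc n) \<Longrightarrow> xs \<in> gtup 1 \<Longrightarrow> cobd (\<lambda>l. u l xs) gs = f gs"
      using col_exact[OF df, of C] prim f by (auto simp: cocycle_def)
    have c': "0 \<le> C + real n * c" using c C by simp
    have "cobd (\<lambda>l. cobd (u l) xs) gs = 0" if "gs \<in> tuples G (Suc n)" "xs \<in> gtup (Suc (Suc 0))" for gs xs
    proof -
      have "cobd (\<lambda>l. cobd (u l) xs) gs = cobd (\<lambda>m. cobd (\<lambda>l. u l m) gs) xs" by (rule cobd_swap)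
      also have "\<dots> = cobd (\<lambda>_. f gs) xs"
        by (rule cobd_gtup_cong[OF that(2)]) (use du that(1) in auto)
      \<comment> \<open>The alternating sum over two points has two equal terms of opposite
        sign.\<close>
      finally show ?thesis using that(2) by (simp add: cobd_const gtup_def)
    qed
    with step[OF c', of u] u obtain v W where v: "Inv n 0 (M * (C + real n * c)) v"
      and W: "tail (Suc n) (M * (C + real n * c)) W" and Q: "Q W"
      and eq: "\<And>gs xs. gs \<in> tuples G (Suc n) \<Longrightarrow> xs \<in> gtup 1 \<Longrightarrow>
          cobd (\<lambda>l. u l xs) gs = cobd (\<lambda>l. cobd (v l) xs) gs + cobd (\<lambda>l. W n l xs) gs"
      by auto
    have "C \<le> C * real (Suc n)" "real n * c \<le> real (Suc n) * c"
      using C c by (auto simp: mult_right_mono algebra_simps)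
    then have "C + real n * c \<le> real (Suc n) * (C + c)" by (simp add: algebra_simps)
    then have le: "M * (C + real n * c) \<le> M * real (Suc n) * (C + c)"
      using M by (simp add: mult_left_mono mult.assoc)
    have nil: "[] \<in> gtup 0" by (simp add: gtup_def gen_Nil)
    show "\<exists>v W. cochain G n (M * real (Suc n) * (C + c)) v \<and> tail (Suc n) (M * real (Suc n) * (C + c)) W \<and> Q W \<and>
      (\<forall>gs\<in>tuples G (Suc n). f gs = cobd v gs + W (Suc n) gs [])"
    proof (intro exI[of _ "\<lambda>l. v l []"] exI[of _ W] conjI tail_mono[OF W le] Q ballI)
      show "cochain G n (M * real (Suc n) * (C + c)) (\<lambda>l. v l [])"
        using InvD[OF Inv_mono[OF v le] _ nil] by (auto simp: cochain_def)
      fix gs assume gs: "gs \<in> tuples G (Suc n)"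
      \<comment> \<open>The coboundary of \<open>z\<close> at a single point is \<open>z []\<close>,
        and it can be computed from the equations for \<open>u\<close> at that point.\<close>
      define z where "z xs = f gs - cobd (\<lambda>l. v l xs) gs - W (Suc n) gs xs" for xs
      have "z [] = 0"
      proof (rule row_exact_zero)
        fix xs assume xs: "xs \<in> gtup 1"
        have "cobd (\<lambda>m. cobd (\<lambda>l. v l m) gs) xs = cobd (\<lambda>l. cobd (v l) xs) gs"
          by (rule cobd_swap[symmetric])
        moreover have "cobd (\<lambda>l. W n l xs) gs = cobd (W (Suc n) gs) xs"
          using W gs xs unfolding tail_def by auto
        moreover have "cobd (\<lambda>_. f gs) xs = f gs" using xs by (simp add: cobd_const gtup_def)
        ultimately show "cobd z xs = 0"
          using du[OF gs xs] eq[OF gs xs] unfolding z_def[abs_def] by (simp add: cobd_diff)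
      qed
      then show "f gs = cobd (\<lambda>l. v l []) gs + W (Suc n) gs []" by (simp add: z_def)
    qed
  qed
qed

end

section \<open>Products and halving\<close>

lemma primitive_diff:
  assumes "primitive \<Gamma> N c f" "primitive \<Gamma> N c' f'"
  shows "primitive \<Gamma> N (c + c') (\<lambda>xs. f xs - f' xs)"
  using primitive_add[OF assms(1) primitive_scale[OF assms(2), of "-1"]] by simp

lemma primitive_zero: "0 \<le> c \<Longrightarrow> primitive \<Gamma> N c (\<lambda>_. 0)"
  unfolding primitive_def by (intro exI[of _ "\<lambda>_. 0"]) (simp add: cochain_def)

lemma primitive_cobd:
  assumes "cochain \<Gamma> n c u" shows "primitive \<Gamma> (Suc n) c (cobd u)"
  unfolding primitive_def using assms by (intro exI[of _ u]) simp

text \<open>A parity argument: on tuples of odd length a constant is the coboundary of itself, and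
  for even length the cocycle identity at a constant tuple forces the constant to be 0.\<close>

lemma (in group) primitive_const:
  assumes f: "cocycle G (Suc n) c f"
  shows "primitive \<Gamma> (Suc n) c (\<lambda>_. f (replicate (Suc n) \<one>))"
proof -
  define k where "k = f (replicate (Suc n) \<one>)"
  have "cobd f (replicate (Suc (Suc n)) \<one>) = 0"
    using f tuples_nonempty unfolding cocycle_def by blast
  then have 0: "odd n \<Longrightarrow> k = 0" by (auto simp: cobd_replicate k_def simp del: replicate.simps)
  have "\<bar>k\<bar> \<le> c" using f tuples_nonempty unfolding cocycle_def cochain_def k_def by blast
  then have "primitive \<Gamma> (Suc n) c (\<lambda>_. k)"
    unfolding primitive_def using 0
    by (intro exI[of _ "\<lambda>_. k"]) (auto simp: cochain_def cobd_const tuples_def)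
  then show ?thesis by (simp add: k_def)
qed

text \<open>The translation invariance of f reduces conjugation by t to right translation by t.\<close>

lemma (in group) primitive_conjugate:
  assumes "group \<Gamma>" and \<rho>: "\<rho> \<in> hom \<Gamma> G" and t: "t \<in> carrier G" and f: "cocycle G (Suc n) c f"
  shows "primitive \<Gamma> (Suc n) (real n * c) (\<lambda>l. f (map (\<lambda>a. t \<otimes> \<rho> a \<otimes> inv t) l) - f (map \<rho> l))"
proof -
  interpret \<Gamma>: group \<Gamma> by fact
  have \<rho>_in: "\<And>a. a \<in> carrier \<Gamma> \<Longrightarrow> \<rho> a \<in> carrier G"
    and \<rho>_mult: "\<And>a b. a \<in> carrier \<Gamma> \<Longrightarrow> b \<in> carrier \<Gamma> \<Longrightarrow> \<rho> (a \<otimes>\<^bsub>\<Gamma>\<^esub> b) = \<rho> a \<otimes> \<rho> b"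
    using \<rho> by (auto simp: hom_def)
  \<comment> \<open>Right translation commutes with left translation, so \<open>b\<close> transforms
    under left multiplication as \<open>\<rho>\<close> does, and the prism between them is
    invariant.\<close>
  define b where "b a = \<rho> a \<otimes> inv t" for a
  have f_le: "\<bar>f ys\<bar> \<le> c" if "ys \<in> tuples G (Suc n)" for ys
    using f that by (auto simp: cocycle_def cochain_def)
  have f_inv: "f (map (\<lambda>x. a \<otimes> x) ys) = f ys" if "ys \<in> tuples G (Suc n)" "a \<in> carrier G" for ys a
    using f that by (auto simp: cocycle_def cochain_def)
  show ?thesis
    unfolding primitive_def
  proof (intro exI[of _ "prism \<rho> b f"] conjI ballI)
    show "cochain \<Gamma> (Suc n - 1) (real n * c) (prism \<rho> b f)"
      unfolding cochain_def
    proof (intro ballI conjI)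
      fix l assume l: "l \<in> tuples \<Gamma> (Suc n - 1)"
      then have len: "length l = n" by (simp add: tuples_def)
      have "\<bar>prism \<rho> b f l\<bar> \<le> real (length l) * c"
        by (rule prism_bound[where Y = "carrier G"])
          (use l t \<rho>_in f_le in \<open>auto simp: tuples_def b_def subset_iff\<close>)
      then show "\<bar>prism \<rho> b f l\<bar> \<le> real n * c" by (simp add: len)
      fix a assume a: "a \<in> carrier \<Gamma>"
      show "prism \<rho> b f (map (\<lambda>x. a \<otimes>\<^bsub>\<Gamma>\<^esub> x) l) = prism \<rho> b f l"
      proof (rule prism_equivariant[where Y = "carrier G" and \<tau> = "\<lambda>x. \<rho> a \<otimes> x"])
        fix ys assume "length ys = Suc (length l)" "set ys \<subseteq> carrier G"
        then show "f (map (\<lambda>x. \<rho> a \<otimes> x) ys) = f ys"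
          using f_inv[of ys "\<rho> a"] \<rho>_in[OF a] len by (simp add: tuples_def)
      qed (use l t a \<rho>_in \<rho>_mult in \<open>auto simp: tuples_def b_def subset_iff m_assoc\<close>)
    qed
    fix l assume l: "l \<in> tuples \<Gamma> (Suc n)"
    have b_in: "map b l \<in> tuples G (Suc n)"
      using l t \<rho>_in by (auto simp: tuples_def b_def)
    have "map (\<lambda>a. t \<otimes> \<rho> a \<otimes> inv t) l = map (\<lambda>x. t \<otimes> x) (map b l)"
      using l t \<rho>_in by (auto simp: tuples_def b_def m_assoc subset_iff)
    then have "f (map (\<lambda>a. t \<otimes> \<rho> a \<otimes> inv t) l) = f (map b l)"
      using f_inv[OF b_in t] by metis
    moreover have "prism \<rho> b (cobd f) l = 0"
      by (rule prism_zero[where Y = "carrier G"])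
        (use l t \<rho>_in f in \<open>auto simp: tuples_def b_def subset_iff cocycle_def\<close>)
    ultimately show "cobd (prism \<rho> b f) l = f (map (\<lambda>a. t \<otimes> \<rho> a \<otimes> inv t) l) - f (map \<rho> l)"
      using prism_homotopy[of \<rho> b f l] by simp
  qed
qed

text \<open>A weak limit of primitives over the finite subsets of G. The primitives on the subgroups
  \<open>H F\<close> are chosen independently of each other and share only the bound
  \<open>C\<close>; each identity to be checked involves finitely many elements, hence holds for all
  large F.\<close>

lemma (in group) primitive_limit:
  assumes loc: "\<And>F. finite F \<Longrightarrow> F \<subseteq> carrier G \<Longrightarrow>
      \<exists>H. F \<subseteq> H \<and> subgroup H G \<and> primitive (G\<lparr>carrier := H\<rparr>) (Suc n) C f"
  shows "primitive G (Suc n) C f"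
proof -
  define H where "H F = (SOME H. F \<subseteq> H \<and> subgroup H G \<and> primitive (G\<lparr>carrier := H\<rparr>) (Suc n) C f)" for F
  have H: "F \<subseteq> H F \<and> subgroup (H F) G \<and> primitive (G\<lparr>carrier := H F\<rparr>) (Suc n) C f"
    if "finite F" "F \<subseteq> carrier G" for F
    unfolding H_def by (rule someI_ex) (rule loc[OF that])
  have "\<forall>F\<in>{F. finite F \<and> F \<subseteq> carrier G}. \<exists>u. cochain (G\<lparr>carrier := H F\<rparr>) n C u \<and>
      (\<forall>xs\<in>tuples (G\<lparr>carrier := H F\<rparr>) (Suc n). cobd u xs = f xs)"
    using H by (auto simp: primitive_def)
  then obtain u where u: "\<And>F. finite F \<Longrightarrow> F \<subseteq> carrier G \<Longrightarrow> cochain (G\<lparr>carrier := H F\<rparr>) n C (u F)"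
    and du: "\<And>F xs. finite F \<Longrightarrow> F \<subseteq> carrier G \<Longrightarrow> xs \<in> tuples (G\<lparr>carrier := H F\<rparr>) (Suc n) \<Longrightarrow>
      cobd (u F) xs = f xs"
    unfolding bchoice_iff by auto
  define w where "w F l = (if finite F \<and> F \<subseteq> carrier G \<and> l \<in> tuples (G\<lparr>carrier := H F\<rparr>) n then u F l else 0)" for F l
  have w_le: "\<bar>w F l\<bar> \<le> \<bar>C\<bar>" for F l
  proof (cases "finite F \<and> F \<subseteq> carrier G \<and> l \<in> tuples (G\<lparr>carrier := H F\<rparr>) n")
    case True
    then have "\<bar>u F l\<bar> \<le> C" using u[of F] by (simp add: cochain_def)
    with True show ?thesis by (simp add: w_def)
  qed (auto simp: w_def)
  have bdd: "bounded (range (\<lambda>F. w F l))" for l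
    using w_le by (auto simp: bounded_iff)
  obtain L where L: "gen_limit (finite_subsets_at_top (carrier G)) L"
    using gen_limit_exists[OF finite_subsets_at_top_neq_bot] .
  have ev: "eventually (\<lambda>F. finite F \<and> F \<subseteq> carrier G \<and> A \<subseteq> H F) (finite_subsets_at_top (carrier G))"
    if "finite A" "A \<subseteq> carrier G" for A
    unfolding eventually_finite_subsets_at_top
  proof (intro exI[of _ A] conjI allI impI)
    fix Y assume Y: "finite Y \<and> A \<subseteq> Y \<and> Y \<subseteq> carrier G"
    then show "finite Y" "Y \<subseteq> carrier G" "A \<subseteq> H Y" using H[of Y] by auto
  qed (use that in auto)
  show ?thesis
    unfolding primitive_def
  proof (intro exI[of _ "\<lambda>l. L (\<lambda>F. w F l)"] conjI ballI)
    show "cochain G (Suc n - 1) C (\<lambda>l. L (\<lambda>F. w F l))"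
      unfolding cochain_def
    proof (intro ballI conjI)
      fix l assume "l \<in> tuples G (Suc n - 1)"
      then have l: "length l = n" "set l \<subseteq> carrier G" by (auto simp: tuples_def)
      have "eventually (\<lambda>F. \<bar>w F l\<bar> \<le> C) (finite_subsets_at_top (carrier G))"
        using ev[OF finite_set l(2)]
      proof eventually_elim
        case (elim F)
        then show ?case using u[of F] l by (simp add: w_def cochain_def tuples_def)
      qed
      then show "\<bar>L (\<lambda>F. w F l)\<bar> \<le> C" by (rule gen_limit_bound[OF L bdd])
      fix a assume a: "a \<in> carrier G"
      show "L (\<lambda>F. w F (map (\<lambda>x. a \<otimes> x) l)) = L (\<lambda>F. w F l)"
      proof (intro gen_limit_cong[OF L] bdd)
        have "finite (insert a (set l))" "insert a (set l) \<subseteq> carrier G" using l a by auto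
        from ev[OF this]
        show "eventually (\<lambda>F. w F (map (\<lambda>x. a \<otimes> x) l) = w F l) (finite_subsets_at_top (carrier G))"
        proof eventually_elim
          case (elim F)
          then interpret H: subgroup "H F" G using H by blast
          have "l \<in> tuples (G\<lparr>carrier := H F\<rparr>) n" "map (\<lambda>x. a \<otimes> x) l \<in> tuples (G\<lparr>carrier := H F\<rparr>) n"
            using elim l by (auto simp: tuples_def subset_iff)
          then show ?case using elim u[of F] by (simp add: w_def cochain_def)
        qed
      qed
    qed
    fix xs assume "xs \<in> tuples G (Suc n)"
    then have xs: "length xs = Suc n" "set xs \<subseteq> carrier G" by (auto simp: tuples_def)
    have lim: "L (\<lambda>F. cobd (w F) xs) = cobd (\<lambda>l. L (\<lambda>F. w F l)) xs \<and> bounded (range (\<lambda>F. cobd (w F) xs))"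
      by (rule gen_limit_cobd[OF L bdd])
    have "L (\<lambda>F. cobd (w F) xs) = L (\<lambda>F. f xs)"
    proof (rule gen_limit_cong[OF L])
      show "bounded (range (\<lambda>F. cobd (w F) xs))" using lim by blast
      show "bounded (range (\<lambda>F::'a set. f xs))" by (simp add: image_constant_conv)
      show "eventually (\<lambda>F. cobd (w F) xs = f xs) (finite_subsets_at_top (carrier G))"
        using ev[OF finite_set xs(2)]
      proof eventually_elim
        case (elim F)
        then have t: "xs \<in> tuples (G\<lparr>carrier := H F\<rparr>) (Suc n)" using xs by (simp add: tuples_def)
        have "cobd (w F) xs = cobd (u F) xs"
          by (rule cobd_tuples_cong[OF t]) (use elim in \<open>simp add: w_def\<close>)
        then show ?case using du[OF _ _ t] elim by simp
      qed
    qed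
    then show "cobd (\<lambda>l. L (\<lambda>F. w F l)) xs = f xs"
      using lim gen_limit_const[OF L, of "f xs"] by simp
  qed
qed

text \<open>
  The Kuenneth argument for A \<times> A: a cocycle that vanishes on the first factor is pulled back
  from the second one, because the first factor stabilises all tuples in A when A \<times> A acts on A
  through its second factor.
\<close>

lemma (in group) kunneth_diagonal:
  assumes van: "\<And>p. 1 \<le> p \<Longrightarrow> p \<le> n \<Longrightarrow> bounded_vanishing G p K" and K: "0 \<le> K"
  shows "\<exists>M\<ge>0. \<forall>c F. cocycle (G \<times>\<times> G) (Suc n) c F \<longrightarrow> primitive G (Suc n) (M * c)
    (\<lambda>l. F (map (\<lambda>a. (a, a)) l) - F (map (\<lambda>a. (a, \<one>)) l) - F (map (\<lambda>a. (\<one>, a)) l))"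
proof -
  let ?P = "G \<times>\<times> G"
  interpret P: group ?P by (rule DirProd_group) (rule is_group)+
  \<comment> \<open>All tuples count as generic, so a constant sequence of points will do.\<close>
  interpret A: generic_action ?P "\<lambda>a x. snd a \<otimes> x" "carrier G" "lists (carrier G)" "\<lambda>_. \<one>"
  proof
    fix xs i assume "xs \<in> lists (carrier G)" "i < length xs"
    then show "take i xs @ drop (Suc i) xs \<in> lists (carrier G)"
      by (auto dest: in_set_takeD in_set_dropD)
  qed (auto simp: m_assoc)
  \<comment> \<open>These signs solve s (i+1) = (-1)^i s i, which absorbs the sign produced by
    \<open>cobd_append\<close> when i + 1 group entries stand before the points.\<close>
  define s where "s = rec_nat (1::real) (\<lambda>i r. (-1)^i * r)"
  have s: "s 0 = 1" "\<And>i. s (Suc i) = (-1)^i * s i" by (simp_all add: s_def)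
  have abs_s: "\<bar>s i\<bar> = 1" for i by (induction i) (simp_all add: s abs_mult power_abs)
  \<comment> \<open>The tail may end in any function of the second coordinates, that is, in
    something pulled back from the second factor.\<close>
  define Q where "Q W \<longleftrightarrow> (\<exists>h. \<forall>gs. W (Suc n) gs [] = (h (map snd gs) :: real))"
    for W :: "nat \<Rightarrow> ('a \<times> 'a) list \<Rightarrow> 'a list \<Rightarrow> real"
  have stab: "A.stab xs = carrier G \<times> {\<one>}" if "xs \<in> lists (carrier G)" "xs \<noteq> []" for xs
  proof -
    have "b = \<one>" if "b \<in> carrier G" "map (\<lambda>x. b \<otimes> x) xs = xs" for b
      using that \<open>xs \<in> lists (carrier G)\<close> \<open>xs \<noteq> []\<close> by (cases xs) (auto intro: l_cancel_one[THEN iffD1])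
    moreover have "map (\<lambda>x. \<one> \<otimes> x) xs = xs" using that(1) by (auto intro!: map_idI)
    ultimately show ?thesis by (auto simp: A.stab_def)
  qed
  have stab_bounded_vanishing: "bounded_vanishing (?P\<lparr>carrier := A.stab xs\<rparr>) p K"
    if p: "1 \<le> p" "p \<le> n" and xs: "xs \<in> A.gtup (Suc (Suc n) - p)" for p xs
  proof (rule bounded_vanishing_iso[OF is_group _ _ van[OF p]])
    have xs': "xs \<in> lists (carrier G)" "xs \<noteq> []" using xs p by (auto simp: A.gtup_def)
    show "group (?P\<lparr>carrier := A.stab xs\<rparr>)"
      using P.subgroup_imp_group[OF A.stab_subgroup] xs' by auto
    show "(\<lambda>a. (a, \<one>)) \<in> iso G (?P\<lparr>carrier := A.stab xs\<rparr>)"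
      unfolding stab[OF xs'] by (auto simp: iso_def hom_def bij_betw_def inj_on_def)
  qed
  have tails: "\<exists>v W. A.Inv 0 n (1 * c) v \<and> A.tail (Suc n) (1 * c) W \<and> Q W \<and>
        (\<forall>xs\<in>A.gtup (Suc n). w [] xs = cobd (v []) xs + W 0 [] xs)"
    if c: "0 \<le> c" and w: "A.Inv 0 (Suc n) c w" and dw: "\<And>xs. xs \<in> A.gtup (Suc (Suc n)) \<Longrightarrow> cobd (w []) xs = 0"
    for c w
  proof -
    \<comment> \<open>The points are themselves group elements with the regular action, so second
      coordinates of group entries can be written in front of the points. One function
      \<open>w []\<close> thus yields the whole tail.\<close>
    define W where "W i gs xs = s i * w [] (map snd gs @ xs)" for i and gs :: "('a \<times> 'a) list" and xs
    have nil: "[] \<in> tuples ?P 0" by (simp add: tuples_def)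
    have in_gtup: "map snd gs @ xs \<in> A.gtup (i + j)" if "gs \<in> tuples ?P i" "xs \<in> A.gtup j" for gs xs i j
      using that by (fastforce simp: A.gtup_def tuples_def)
    have "A.tail (Suc n) c W"
      unfolding A.tail_def
    proof (intro conjI allI impI ballI)
      fix i j assume N: "i + j = Suc n"
      show "A.Inv i j c (W i)"
        unfolding A.Inv_def
      proof (intro ballI conjI)
        fix gs xs assume gs: "gs \<in> tuples ?P i" and xs: "xs \<in> A.gtup j"
        note m = in_gtup[OF gs xs, unfolded N]
        show "\<bar>W i gs xs\<bar> \<le> c" using A.InvD(1)[OF w nil m] by (simp add: W_def abs_mult abs_s)
        fix a assume a: "a \<in> carrier ?P"
        have "map snd (map (\<lambda>x. a \<otimes>\<^bsub>?P\<^esub> x) gs) = map (\<lambda>x. snd a \<otimes> x) (map snd gs)"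
          by (auto simp: DirProd_def split_beta)
        then have "map snd (map (\<lambda>x. a \<otimes>\<^bsub>?P\<^esub> x) gs) @ map (\<lambda>x. snd a \<otimes> x) xs
            = map (\<lambda>x. snd a \<otimes> x) (map snd gs @ xs)" by simp
        then show "W i (map (\<lambda>x. a \<otimes>\<^bsub>?P\<^esub> x) gs) (map (\<lambda>x. snd a \<otimes> x) xs) = W i gs xs"
          using A.InvD(2)[OF w nil m a] unfolding W_def by (metis list.map(1))
      qed
    next
      fix i j gs xs assume N: "i + Suc j = Suc n" and gs: "gs \<in> tuples ?P (Suc i)" and xs: "xs \<in> A.gtup (Suc j)"
      have len: "length gs = Suc i" using gs by (simp add: tuples_def)
      have "map snd gs @ xs \<in> A.gtup (Suc (Suc n))"
        using in_gtup[OF gs xs] N by simp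
      from dw[OF this] have "cobd (\<lambda>l. w [] (l @ xs)) (map snd gs)
          = (-1)^i * cobd (\<lambda>l. w [] (map snd gs @ l)) xs"
        by (simp add: cobd_append len)
      moreover have "cobd (\<lambda>l. w [] (map snd l @ xs)) gs = cobd (\<lambda>l. w [] (l @ xs)) (map snd gs)"
        by (rule cobd_map)
      ultimately show "cobd (\<lambda>l. W i l xs) gs = cobd (W (Suc i) gs) xs"
        by (simp add: W_def[abs_def] cobd_scale s)
    qed
    moreover have "Q W" unfolding Q_def by (intro exI[of _ "\<lambda>l. s (Suc n) * w [] l"]) (simp add: W_def)
    ultimately show ?thesis
      using c by (intro exI[of _ "\<lambda>_ _. 0"] exI[of _ W]) (simp add: A.Inv_def W_def s)
  qed
  have "\<exists>M\<ge>0. \<forall>c C f. cocycle ?P (Suc n) c f \<longrightarrow> 0 \<le> C \<longrightarrow>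
    (\<forall>xs\<in>A.gtup 1. primitive (?P\<lparr>carrier := A.stab xs\<rparr>) (Suc n) C f) \<longrightarrow>
    (\<exists>v W. cochain ?P n (M * (C + c)) v \<and> A.tail (Suc n) (M * (C + c)) W \<and> Q W \<and>
      (\<forall>gs\<in>tuples ?P (Suc n). f gs = cobd v gs + W (Suc n) gs []))"
  proof (rule A.descent[where K = K and E = 1 and Q = Q])
    fix p xs assume "1 \<le> p" "p \<le> n" "xs \<in> A.gtup (Suc (Suc n) - p)"
    then show "bounded_vanishing (?P\<lparr>carrier := A.stab xs\<rparr>) p K" by (rule stab_bounded_vanishing)
  next
    fix c w assume "0 \<le> c" "A.Inv 0 (Suc n) c w" "\<And>xs. xs \<in> A.gtup (Suc (Suc n)) \<Longrightarrow> cobd (w []) xs = 0"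
    then show "\<exists>v W. A.Inv 0 n (1 * c) v \<and> A.tail (Suc n) (1 * c) W \<and> Q W \<and>
        (\<forall>xs\<in>A.gtup (Suc n). w [] xs = cobd (v []) xs + W 0 [] xs)" by (rule tails)
  qed (use K in auto)
  then obtain M where M: "M \<ge> 0"
    and desc: "\<And>c C f. cocycle ?P (Suc n) c f \<Longrightarrow> 0 \<le> C \<Longrightarrow>
      \<forall>xs\<in>A.gtup 1. primitive (?P\<lparr>carrier := A.stab xs\<rparr>) (Suc n) C f \<Longrightarrow>
      \<exists>v W. cochain ?P n (M * (C + c)) v \<and> A.tail (Suc n) (M * (C + c)) W \<and> Q W \<and>
        (\<forall>gs\<in>tuples ?P (Suc n). f gs = cobd v gs + W (Suc n) gs [])"
    by blast
  show ?thesis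
  proof (intro exI[of _ "M * 2 + M * 2 + 1"] conjI allI impI)
    show "0 \<le> M * 2 + M * 2 + 1" using M by simp
    fix c F assume F: "cocycle ?P (Suc n) c F"
    \<comment> \<open>Subtracting the restriction to the first factor makes the cocycle vanish on G
      \<times> 1, the stabiliser of every non-empty tuple.\<close>
    define pr where "pr a = (fst a, \<one>)" for a :: "'a \<times> 'a"
    have pr: "pr \<in> hom ?P ?P" by (auto simp: hom_def pr_def)
    define f where "f l = F l + (- 1) * F (map pr l)" for l
    have f: "cocycle ?P (Suc n) (c + \<bar>-1\<bar> * c) f"
      unfolding f_def[abs_def] by (intro cocycle_add cocycle_scale F cocycle_pullback[OF pr])
    have "primitive (?P\<lparr>carrier := A.stab xs\<rparr>) (Suc n) 0 f" if xs: "xs \<in> A.gtup 1" for xs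
    proof (rule primitive_cong[OF primitive_zero])
      fix l assume l: "l \<in> tuples (?P\<lparr>carrier := A.stab xs\<rparr>) (Suc n)"
      have "A.stab xs = carrier G \<times> {\<one>}" using xs by (intro stab) (auto simp: A.gtup_def)
      with l have "map pr l = l" by (intro map_idI) (auto simp: tuples_def pr_def)
      then show "0 = f l" by (simp add: f_def)
    qed simp
    with desc[OF f, of 0] obtain v h where v: "cochain ?P n (M * (c + c)) v"
      and eq: "\<And>gs. gs \<in> tuples ?P (Suc n) \<Longrightarrow> f gs = cobd v gs + h (map snd gs)"
      unfolding Q_def by auto
    define D where "D = (\<lambda>a::'a. (a, a))"
    define J where "J = (\<lambda>a::'a. (\<one>, a))"
    have D: "D \<in> hom G ?P" and J: "J \<in> hom G ?P" by (auto simp: D_def J_def hom_def)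
    \<comment> \<open>The unknown \<open>h\<close> takes the same value along the diagonal and along
      the second factor, so it cancels in the difference. The leftover value of \<open>F\<close> is
      taken at a constant tuple, whence \<open>primitive_const\<close>.\<close>
    have "primitive G (Suc n) (M * (c + c) + M * (c + c) + c)
       (\<lambda>l. cobd (\<lambda>l. v (map D l)) l - cobd (\<lambda>l. v (map J l)) l - F (replicate (Suc n) \<one>\<^bsub>?P\<^esub>))"
      by (intro primitive_diff primitive_cobd cochain_pullback[OF D v] cochain_pullback[OF J v]
          P.primitive_const[OF F])
    then have "primitive G (Suc n) (M * (c + c) + M * (c + c) + c)
      (\<lambda>l. F (map D l) - F (map (\<lambda>a. (a, \<one>)) l) - F (map J l))"
    proof (rule primitive_cong)
      fix l assume l: "l \<in> tuples G (Suc n)"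
      have *: "map D l \<in> tuples ?P (Suc n)" "map J l \<in> tuples ?P (Suc n)"
        using l by (auto simp: tuples_def D_def J_def)
      have "map pr (map D l) = map (\<lambda>a. (a, \<one>)) l" "map snd (map D l) = l" "map snd (map J l) = l"
        by (auto simp: pr_def D_def J_def intro: map_idI)
      moreover have "map pr (map J l) = replicate (Suc n) \<one>\<^bsub>?P\<^esub>"
        using l by (intro replicate_eqI) (auto simp: pr_def J_def tuples_def)
      ultimately have "F (map D l) - F (map (\<lambda>a. (a, \<one>)) l) = cobd v (map D l) + h l"
        "F (map J l) - F (replicate (Suc n) \<one>\<^bsub>?P\<^esub>) = cobd v (map J l) + h l"
        using eq[OF *(1)] eq[OF *(2)] unfolding f_def by (simp_all del: map_map map_eq_conv replicate.simps)
      then show "cobd (\<lambda>l. v (map D l)) l - cobd (\<lambda>l. v (map J l)) l - F (replicate (Suc n) \<one>\<^bsub>?P\<^esub>)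
        = F (map D l) - F (map (\<lambda>a. (a, \<one>)) l) - F (map J l)"
        unfolding cobd_map by simp
    qed
    then show "primitive G (Suc n) ((M * 2 + M * 2 + 1) * c)
      (\<lambda>l. F (map (\<lambda>a. (a, a)) l) - F (map (\<lambda>a. (a, \<one>)) l) - F (map (\<lambda>a. (\<one>, a)) l))"
      by (simp add: D_def J_def algebra_simps)
  qed
qed

lemma cobd_sums:
  assumes "\<And>l. (\<lambda>k. g k l) sums (s l :: real)"
  shows "(\<lambda>k. cobd (g k) xs) sums cobd s xs"
  using assms by (induction xs arbitrary: g s) (auto intro: sums_diff)

text \<open>Commutation combines \<open>\<rho>\<close> and its conjugate into one homomorphism on G
  \<times> G. On the diagonal the Kuenneth argument splits the pullback into the two factors, and
  conjugation does not change the class, so the pullback along the product is twice the one along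
  \<open>\<rho>\<close>. \<open>M\<close> is chosen before \<open>\<rho>\<close>, t and f, which
  permits iteration.\<close>

lemma (in group) halving_step:
  assumes van: "\<And>p. 1 \<le> p \<Longrightarrow> p \<le> n \<Longrightarrow> bounded_vanishing G p K" and K: "0 \<le> K"
  shows "\<exists>M\<ge>0. \<forall>\<rho> t c f. \<rho> \<in> hom G G \<longrightarrow> t \<in> carrier G \<longrightarrow>
     (\<forall>a\<in>carrier G. \<forall>b\<in>carrier G. \<rho> a \<otimes> (t \<otimes> \<rho> b \<otimes> inv t) = (t \<otimes> \<rho> b \<otimes> inv t) \<otimes> \<rho> a) \<longrightarrow>
     cocycle G (Suc n) c f \<longrightarrow>
     primitive G (Suc n) (M * c)
       (\<lambda>l. f (map \<rho> l) - (1/2) * f (map (\<lambda>a. \<rho> a \<otimes> (t \<otimes> \<rho> a \<otimes> inv t)) l))"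
proof -
  from kunneth_diagonal[OF van K] obtain M where M: "M \<ge> 0" and kd:
    "\<And>c F. cocycle (G \<times>\<times> G) (Suc n) c F \<Longrightarrow> primitive G (Suc n) (M * c)
      (\<lambda>l. F (map (\<lambda>a. (a, a)) l) - F (map (\<lambda>a. (a, \<one>)) l) - F (map (\<lambda>a. (\<one>, a)) l))"
    by blast
  show ?thesis
  proof (intro exI[of _ "M + real n"] conjI allI impI)
    show "0 \<le> M + real n" using M by simp
    fix \<rho> t c f assume \<rho>: "\<rho> \<in> hom G G" and t: "t \<in> carrier G"
      and comm: "\<forall>a\<in>carrier G. \<forall>b\<in>carrier G. \<rho> a \<otimes> (t \<otimes> \<rho> b \<otimes> inv t) = (t \<otimes> \<rho> b \<otimes> inv t) \<otimes> \<rho> a"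
      and f: "cocycle G (Suc n) c f"
    have c: "0 \<le> c" using f cochain_nonneg by (auto simp: cocycle_def)
    interpret \<rho>: group_hom G G \<rho> by (intro group_hom.intro group_hom_axioms.intro is_group \<rho>)
    define \<tau> where "\<tau> a = t \<otimes> \<rho> a \<otimes> inv t" for a
    have \<tau>_in: "\<tau> a \<in> carrier G" if "a \<in> carrier G" for a using that t by (simp add: \<tau>_def)
    have \<tau>_mult: "\<tau> (a \<otimes> b) = \<tau> a \<otimes> \<tau> b" if "a \<in> carrier G" "b \<in> carrier G" for a b
    proof -
      have "inv t \<otimes> (t \<otimes> x) = x" if "x \<in> carrier G" for x
        using that t by (simp add: m_assoc[symmetric])
      then show ?thesis using that t by (simp add: \<tau>_def m_assoc)
    qed
    define m where "m p = \<rho> (fst p) \<otimes> \<tau> (snd p)" for p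
    have m: "m \<in> hom (G \<times>\<times> G) G"
    proof (rule homI)
      fix p q assume "p \<in> carrier (G \<times>\<times> G)" "q \<in> carrier (G \<times>\<times> G)"
      then obtain a b a' b' where pq: "p = (a, b)" "q = (a', b')" and in_G: "a \<in> carrier G" "b \<in> carrier G"
        "a' \<in> carrier G" "b' \<in> carrier G" by auto
      have "\<rho> a \<otimes> \<rho> a' \<otimes> (\<tau> b \<otimes> \<tau> b') = \<rho> a \<otimes> (\<rho> a' \<otimes> \<tau> b) \<otimes> \<tau> b'"
        using in_G \<tau>_in by (simp add: m_assoc)
      also have "\<rho> a' \<otimes> \<tau> b = \<tau> b \<otimes> \<rho> a'" using comm in_G by (simp add: \<tau>_def)
      finally show "m (p \<otimes>\<^bsub>G \<times>\<times> G\<^esub> q) = m p \<otimes> m q"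
        using in_G \<tau>_in \<tau>_mult by (simp add: pq m_def m_assoc)
    qed (auto simp: m_def \<tau>_in)
    have m1: "map m (map (\<lambda>a. (a, \<one>)) l) = map \<rho> l" and m2: "map m (map (\<lambda>a. (\<one>, a)) l) = map \<tau> l"
      if "l \<in> tuples G (Suc n)" for l
      using that t by (auto simp: tuples_def m_def \<tau>_def subset_iff)
    have m0: "map m (map (\<lambda>a. (a, a)) l) = map (\<lambda>a. \<rho> a \<otimes> \<tau> a) l" for l
      by (simp add: m_def)
    note p1 = kd[OF cocycle_pullback[OF m f]]
    note p2 = primitive_conjugate[OF is_group \<rho> t f, folded \<tau>_def]
    have "primitive G (Suc n) (\<bar>-1/2\<bar> * (M * c + real n * c))
      (\<lambda>l. - 1/2 * (f (map m (map (\<lambda>a. (a, a)) l)) - f (map m (map (\<lambda>a. (a, \<one>)) l))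
         - f (map m (map (\<lambda>a. (\<one>, a)) l)) + (f (map \<tau> l) - f (map \<rho> l))))"
      by (intro primitive_scale primitive_add p1 p2)
    then have "primitive G (Suc n) (\<bar>-1/2\<bar> * (M * c + real n * c))
       (\<lambda>l. f (map \<rho> l) - (1/2) * f (map (\<lambda>a. \<rho> a \<otimes> \<tau> a) l))"
      by (rule primitive_cong) (simp only: m0 m1 m2, simp add: field_simps)
    then have "primitive G (Suc n) ((M + real n) * c)
       (\<lambda>l. f (map \<rho> l) - (1/2) * f (map (\<lambda>a. \<rho> a \<otimes> \<tau> a) l))"
    proof (rule primitive_mono)
      have "0 \<le> (M + real n) * c" using M c by simp
      then show "\<bar>- 1/2\<bar> * (M * c + real n * c) \<le> (M + real n) * c"
        by (simp add: algebra_simps)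
    qed
    then show "primitive G (Suc n) ((M + real n) * c)
       (\<lambda>l. f (map \<rho> l) - (1/2) * f (map (\<lambda>a. \<rho> a \<otimes> (t \<otimes> \<rho> a \<otimes> inv t)) l))"
      by (simp add: \<tau>_def)
  qed
qed

text \<open>Telescoping: with r_k the k-th doubled homomorphism, f after r_0 is the sum over k of
  2^-k times the difference of f after r_k and one half of f after r_(k+1), because f is bounded.
  Each difference has a primitive of norm at most \<open>M * c\<close>, so the weighted primitives
  add up to one of norm at most \<open>2 * M * c\<close>.\<close>

lemma (in group) halving:
  assumes van: "\<And>p. 1 \<le> p \<Longrightarrow> p \<le> n \<Longrightarrow> bounded_vanishing G p K" and K: "0 \<le> K"
    and P_hom: "P \<subseteq> hom G G"
    and P_double: "\<And>\<rho>. \<rho> \<in> P \<Longrightarrow> \<exists>t\<in>carrier G.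
      (\<forall>a\<in>carrier G. \<forall>b\<in>carrier G. \<rho> a \<otimes> (t \<otimes> \<rho> b \<otimes> inv t) = (t \<otimes> \<rho> b \<otimes> inv t) \<otimes> \<rho> a) \<and>
      (\<lambda>a. \<rho> a \<otimes> (t \<otimes> \<rho> a \<otimes> inv t)) \<in> P"
  shows "\<exists>M\<ge>0. \<forall>\<rho>\<in>P. \<forall>c f. cocycle G (Suc n) c f \<longrightarrow> primitive G (Suc n) (M * c) (\<lambda>l. f (map \<rho> l))"
proof -
  from halving_step[OF van K] obtain M where M: "M \<ge> 0" and step: "\<And>\<rho> t c f.
     \<rho> \<in> hom G G \<Longrightarrow> t \<in> carrier G \<Longrightarrow>
     \<forall>a\<in>carrier G. \<forall>b\<in>carrier G. \<rho> a \<otimes> (t \<otimes> \<rho> b \<otimes> inv t) = (t \<otimes> \<rho> b \<otimes> inv t) \<otimes> \<rho> a \<Longrightarrow>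
     cocycle G (Suc n) c f \<Longrightarrow>
     primitive G (Suc n) (M * c)
       (\<lambda>l. f (map \<rho> l) - (1/2) * f (map (\<lambda>a. \<rho> a \<otimes> (t \<otimes> \<rho> a \<otimes> inv t)) l))"
    by blast
  have "\<forall>\<rho>\<in>P. \<exists>\<rho>'. \<rho>' \<in> P \<and> (\<forall>c f. cocycle G (Suc n) c f \<longrightarrow>
      primitive G (Suc n) (M * c) (\<lambda>l. f (map \<rho> l) - (1/2) * f (map \<rho>' l)))"
  proof
    fix \<rho> assume \<rho>: "\<rho> \<in> P"
    from P_double[OF \<rho>] obtain t where "t \<in> carrier G"
      "\<forall>a\<in>carrier G. \<forall>b\<in>carrier G. \<rho> a \<otimes> (t \<otimes> \<rho> b \<otimes> inv t) = (t \<otimes> \<rho> b \<otimes> inv t) \<otimes> \<rho> a"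
      "(\<lambda>a. \<rho> a \<otimes> (t \<otimes> \<rho> a \<otimes> inv t)) \<in> P" by blast
    then show "\<exists>\<rho>'. \<rho>' \<in> P \<and> (\<forall>c f. cocycle G (Suc n) c f \<longrightarrow>
      primitive G (Suc n) (M * c) (\<lambda>l. f (map \<rho> l) - (1/2) * f (map \<rho>' l)))"
      using step \<rho> P_hom by blast
  qed
  then obtain nx where nx: "\<And>\<rho>. \<rho> \<in> P \<Longrightarrow> nx \<rho> \<in> P"
    and nx_prim: "\<And>\<rho> c f. \<rho> \<in> P \<Longrightarrow> cocycle G (Suc n) c f \<Longrightarrow>
      primitive G (Suc n) (M * c) (\<lambda>l. f (map \<rho> l) - (1/2) * f (map (nx \<rho>) l))"
    unfolding bchoice_iff by blast
  show ?thesis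
  proof (intro exI[of _ "2 * M"] conjI ballI allI impI)
    show "0 \<le> 2 * M" using M by simp
    fix \<rho> c f assume \<rho>: "\<rho> \<in> P" and f: "cocycle G (Suc n) c f"
    have c: "0 \<le> c" using f cochain_nonneg by (auto simp: cocycle_def)
    define r where "r k = (nx ^^ k) \<rho>" for k
    have r: "r k \<in> P" for k by (induction k) (auto simp: r_def \<rho> nx)
    have r0: "r 0 = \<rho>" and r_Suc: "r (Suc k) = nx (r k)" for k by (auto simp: r_def)
    have "\<forall>k. \<exists>u. cochain G n (M * c) u \<and>
      (\<forall>l\<in>tuples G (Suc n). cobd u l = f (map (r k) l) - (1/2) * f (map (r (Suc k)) l))"
      using nx_prim[OF r f] by (simp add: r_Suc primitive_def)
    then obtain u where u: "\<And>k. cochain G n (M * c) (u k)"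
      and du: "\<And>k l. l \<in> tuples G (Suc n) \<Longrightarrow> cobd (u k) l = f (map (r k) l) - (1/2) * f (map (r (Suc k)) l)"
      by metis
    \<comment> \<open>Set to 0 off the tuples so that the series converges at every list, as
      \<open>cobd_sums\<close> requires.\<close>
    define w where "w k l = (if l \<in> tuples G n then (1/2)^k * u k l else 0)" for k l
    have w_le: "\<bar>w k l\<bar> \<le> (1/2)^k * (M * c)" for k l
      using u[of k] M c by (auto simp: w_def cochain_def abs_mult intro!: mult_left_mono)
    have geo: "(\<lambda>k. (1/2)^k * (M * c)) sums (2 * M * c)"
      using sums_mult2[OF geometric_sums[of "1/2::real"], of "M * c"] by (simp add: mult.assoc)
    have summ: "summable (\<lambda>k. w k l)" for l
      by (rule summable_comparison_test'[OF sums_summable[OF geo], of 0]) (use w_le in auto)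
    define s where "s l = suminf (\<lambda>k. w k l)" for l
    have s: "(\<lambda>k. w k l) sums s l" for l unfolding s_def using summ by (rule summable_sums)
    show "primitive G (Suc n) (2 * M * c) (\<lambda>l. f (map \<rho> l))"
      unfolding primitive_def
    proof (intro exI[of _ s] conjI ballI)
      show "cochain G (Suc n - 1) (2 * M * c) s"
        unfolding cochain_def
      proof (intro ballI conjI)
        fix l assume l: "l \<in> tuples G (Suc n - 1)"
        have "summable (\<lambda>k. \<bar>w k l\<bar>)"
          by (rule summable_comparison_test'[OF sums_summable[OF geo], of 0]) (use w_le in auto)
        then have "\<bar>s l\<bar> \<le> suminf (\<lambda>k. \<bar>w k l\<bar>)" unfolding s_def by (rule summable_rabs)
        also have "\<dots> \<le> suminf (\<lambda>k. (1/2)^k * (M * c))"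
          by (rule suminf_le[OF w_le \<open>summable (\<lambda>k. \<bar>w k l\<bar>)\<close> sums_summable[OF geo]])
        finally show "\<bar>s l\<bar> \<le> 2 * M * c" using sums_unique[OF geo] by simp
        fix a assume a: "a \<in> carrier G"
        have "w k (map (\<lambda>x. a \<otimes> x) l) = w k l" for k
          using u[of k] l a tuples_translate[of l n a] by (simp add: w_def cochain_def)
        then show "s (map (\<lambda>x. a \<otimes> x) l) = s l" by (simp add: s_def)
      qed
      fix l assume l: "l \<in> tuples G (Suc n)"
      define a where "a k = (1/2)^k * f (map (r k) l)" for k
      have "cobd (w k) l = a k - a (Suc k)" for k
      proof -
        have "cobd (w k) l = cobd (\<lambda>l. (1/2)^k * u k l) l"
          by (rule cobd_tuples_cong[OF l]) (simp add: w_def)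
        also have "\<dots> = (1/2)^k * (f (map (r k) l) - (1/2) * f (map (r (Suc k)) l))"
          by (simp add: cobd_scale du[OF l])
        finally show ?thesis by (simp add: a_def algebra_simps)
      qed
      then have "(\<lambda>k. a k - a (Suc k)) sums cobd s l"
        using cobd_sums[of w s l] s by simp
      moreover have "(\<lambda>k. a k - a (Suc k)) sums (a 0 - 0)"
      proof (rule telescope_sums')
        have "norm (a k) \<le> (1/2)^k * c" for k
        proof -
          have "r k \<in> hom G G" using r P_hom by blast
          then have "map (r k) l \<in> tuples G (Suc n)"
            using l by (auto simp: tuples_def hom_def)
          then have "\<bar>f (map (r k) l)\<bar> \<le> c" using f by (auto simp: cocycle_def cochain_def)
          then show ?thesis by (simp add: a_def abs_mult mult_left_mono)
        qed
        moreover have "(\<lambda>k. (1/2)^k * c) \<longlonglongrightarrow> 0"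
          using tendsto_mult_right[OF LIMSEQ_power_zero[of "1/2::real"], of c] by simp
        ultimately show "a \<longlonglongrightarrow> 0" 
          by (intro Lim_null_comparison[of a "\<lambda>k. (1/2)^k * c"] always_eventually allI)
      qed
      ultimately have "cobd s l = a 0" using sums_unique2[of "\<lambda>k. a k - a (Suc k)" "cobd s l" "a 0 - 0"] by simp
      then show "cobd s l = f (map \<rho> l)" by (simp add: a_def r0)
    qed
  qed
qed

text \<open>\<open>P\<close> is a class of homomorphisms closed under doubling whose injective
  members exhaust the stabilisers. In the strong induction, their images are copies of G, so
  stabilisers inherit vanishing in shorter lengths. In the top length the descent needs only
  restrictions of cocycles of G, and these come from pullbacks along members of \<open>P\<close>,
  treated by \<open>halving\<close>. Transitivity makes the tail trivial.\<close>

theorem (in generic_action) vanishing_criterion: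
  assumes P_hom: "P \<subseteq> hom G G"
    and P_double: "\<And>\<rho>. \<rho> \<in> P \<Longrightarrow> \<exists>t\<in>carrier G.
      (\<forall>a\<in>carrier G. \<forall>b\<in>carrier G. \<rho> a \<otimes> (t \<otimes> \<rho> b \<otimes> inv t) = (t \<otimes> \<rho> b \<otimes> inv t) \<otimes> \<rho> a) \<and>
      (\<lambda>a. \<rho> a \<otimes> (t \<otimes> \<rho> a \<otimes> inv t)) \<in> P"
    and P_stab: "\<And>xs F. xs \<in> gen \<Longrightarrow> xs \<noteq> [] \<Longrightarrow> finite F \<Longrightarrow> F \<subseteq> stab xs \<Longrightarrow>
      \<exists>\<rho>\<in>P. inj_on \<rho> (carrier G) \<and> F \<subseteq> \<rho> ` carrier G \<and> \<rho> ` carrier G \<subseteq> stab xs"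
    and trans: "\<And>n xs ys. xs \<in> gtup n \<Longrightarrow> ys \<in> gtup n \<Longrightarrow> \<exists>a\<in>carrier G. ys = map (act a) xs"
  shows "1 \<le> N \<Longrightarrow> \<exists>K\<ge>0. bounded_vanishing G N K"
proof (induction N rule: less_induct)
  case (less N)
  then obtain n where N: "N = Suc n" by (cases N) auto
  have "\<forall>p\<in>{1..n}. \<exists>K\<ge>0. bounded_vanishing G p K" using less.IH N by auto
  then obtain k where k: "\<And>p. p \<in> {1..n} \<Longrightarrow> 0 \<le> k p \<and> bounded_vanishing G p (k p)" by metis
  \<comment> \<open>A single constant valid for all lengths up to n.\<close>
  define K where "K = sum k {1..n}"
  have K: "0 \<le> K" unfolding K_def using k by (intro sum_nonneg) auto
  have van: "bounded_vanishing G p K" if "1 \<le> p" "p \<le> n" for p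
    by (rule bounded_vanishing_mono[where K = "k p"]) (use k that in \<open>auto simp: K_def intro!: member_le_sum\<close>)
  have "\<exists>M\<ge>0. \<forall>\<rho>\<in>P. \<forall>c f. cocycle G (Suc n) c f \<longrightarrow> primitive G (Suc n) (M * c) (\<lambda>l. f (map \<rho> l))"
    by (rule halving[OF _ K P_hom]) (rule van, assumption+, rule P_double, assumption)
  then obtain M1 where M1: "M1 \<ge> 0"
    and half_all: "\<forall>\<rho>\<in>P. \<forall>c f. cocycle G (Suc n) c f \<longrightarrow> primitive G (Suc n) (M1 * c) (\<lambda>l. f (map \<rho> l))"
    by (elim exE conjE) simp
  have half: "primitive G (Suc n) (M1 * c) (\<lambda>l. f (map \<rho> l))" if "\<rho> \<in> P" "cocycle G (Suc n) c f" for \<rho> c f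
    using half_all that by simp
  have st: "group (G\<lparr>carrier := stab xs\<rparr>)" "subgroup (stab xs) G" if "xs \<in> gen" for xs
    using stab_subgroup gen_sub that subgroup_imp_group by blast+
  have image_iso: "\<rho> \<in> iso G (G\<lparr>carrier := \<rho> ` carrier G\<rparr>)" "subgroup (\<rho> ` carrier G) G"
    if "\<rho> \<in> P" "inj_on \<rho> (carrier G)" for \<rho>
  proof -
    have h: "\<rho> \<in> hom G G" using that(1) P_hom by blast
    then show "\<rho> \<in> iso G (G\<lparr>carrier := \<rho> ` carrier G\<rparr>)"
      using that(2) by (auto simp: iso_def hom_def bij_betw_def)
    interpret group_hom G G \<rho> by (intro group_hom.intro group_hom_axioms.intro is_group h)
    show "subgroup (\<rho> ` carrier G) G" by (rule img_is_subgroup)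
  qed
  have local: "\<exists>H. F \<subseteq> H \<and> subgroup H (G\<lparr>carrier := stab xs\<rparr>) \<and>
      primitive (G\<lparr>carrier := stab xs\<rparr>\<lparr>carrier := H\<rparr>) m C f"
    if xs: "xs \<in> gen" "xs \<noteq> []" and F: "finite F" "F \<subseteq> stab xs"
      and prim: "\<And>\<rho>. \<rho> \<in> P \<Longrightarrow> inj_on \<rho> (carrier G) \<Longrightarrow> \<rho> ` carrier G \<subseteq> stab xs \<Longrightarrow>
         primitive (G\<lparr>carrier := \<rho> ` carrier G\<rparr>) m C f" for xs F m C f
  proof -
    from P_stab[OF xs F] obtain \<rho> where \<rho>: "\<rho> \<in> P" "inj_on \<rho> (carrier G)" "F \<subseteq> \<rho> ` carrier G"
      "\<rho> ` carrier G \<subseteq> stab xs" by blast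
    have "subgroup (\<rho> ` carrier G) (G\<lparr>carrier := stab xs\<rparr>)"
      using subgroup_incl[OF image_iso(2)[OF \<rho>(1,2)] st(2)[OF xs(1)] \<rho>(4)] .
    then show ?thesis using \<rho> prim by auto
  qed
  have stab_bounded_vanishing: "bounded_vanishing (G\<lparr>carrier := stab xs\<rparr>) p K" if p: "1 \<le> p" "p \<le> n" and xs: "xs \<in> gtup (Suc (Suc n) - p)"
    for p xs
    unfolding bounded_vanishing_def
  proof (intro allI impI)
    fix c f assume f: "cocycle (G\<lparr>carrier := stab xs\<rparr>) p c f"
    have xs': "xs \<in> gen" "xs \<noteq> []" using xs p by (auto simp: gtup_def)
    obtain p' where p': "p = Suc p'" using p by (cases p) auto
    interpret S: group "G\<lparr>carrier := stab xs\<rparr>" by (rule st[OF xs'(1)])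
    show "primitive (G\<lparr>carrier := stab xs\<rparr>) p (K * c) f"
      unfolding p'
    proof (rule S.primitive_limit)
      fix F assume "finite F" "F \<subseteq> carrier (G\<lparr>carrier := stab xs\<rparr>)"
      then show "\<exists>H. F \<subseteq> H \<and> subgroup H (G\<lparr>carrier := stab xs\<rparr>) \<and>
         primitive (G\<lparr>carrier := stab xs\<rparr>\<lparr>carrier := H\<rparr>) (Suc p') (K * c) f"
      proof (intro local[OF xs'])
        fix \<rho> assume \<rho>: "\<rho> \<in> P" "inj_on \<rho> (carrier G)" "\<rho> ` carrier G \<subseteq> stab xs"
        have "bounded_vanishing (G\<lparr>carrier := \<rho> ` carrier G\<rparr>) p K"
          by (rule bounded_vanishing_iso[OF is_group subgroup_imp_group[OF image_iso(2)[OF \<rho>(1,2)]] image_iso(1)[OF \<rho>(1,2)] van[OF p]])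
        moreover have "cocycle (G\<lparr>carrier := \<rho> ` carrier G\<rparr>) p c f"
          using cocycle_pullback[OF _ f, of id "G\<lparr>carrier := \<rho> ` carrier G\<rparr>"] \<rho>(3)
          by (simp add: hom_def image_subset_iff_funcset[symmetric])
        ultimately show "primitive (G\<lparr>carrier := \<rho> ` carrier G\<rparr>) (Suc p') (K * c) f"
          using p' by (simp add: bounded_vanishing_def)
      qed auto
    qed
  qed
  have stab_prim: "primitive (G\<lparr>carrier := stab xs\<rparr>) (Suc n) (M1 * c) f"
    if f: "cocycle G (Suc n) c f" and xs: "xs \<in> gtup 1" for c f xs
  proof -
    have xs': "xs \<in> gen" "xs \<noteq> []" using xs by (auto simp: gtup_def)
    interpret S: group "G\<lparr>carrier := stab xs\<rparr>" by (rule st[OF xs'(1)])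
    show ?thesis
    proof (rule S.primitive_limit)
      fix F assume "finite F" "F \<subseteq> carrier (G\<lparr>carrier := stab xs\<rparr>)"
      then show "\<exists>H. F \<subseteq> H \<and> subgroup H (G\<lparr>carrier := stab xs\<rparr>) \<and>
         primitive (G\<lparr>carrier := stab xs\<rparr>\<lparr>carrier := H\<rparr>) (Suc n) (M1 * c) f"
      proof (intro local[OF xs'])
        fix \<rho> assume \<rho>: "\<rho> \<in> P" "inj_on \<rho> (carrier G)" "\<rho> ` carrier G \<subseteq> stab xs"
        \<comment> \<open>On the image of \<open>\<rho>\<close>, f is the pullback along the inverse
          \<open>\<sigma>\<close> of f after \<open>\<rho>\<close>, and \<open>half\<close> gives
          the latter a primitive.\<close>
        define \<sigma> where "\<sigma> = inv_into (carrier G) \<rho>"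
        have \<sigma>: "\<sigma> \<in> hom (G\<lparr>carrier := \<rho> ` carrier G\<rparr>) G"
          using iso_set_sym[OF image_iso(1)[OF \<rho>(1,2)]] by (auto simp: \<sigma>_def iso_def)
        show "primitive (G\<lparr>carrier := \<rho> ` carrier G\<rparr>) (Suc n) (M1 * c) f"
        proof (rule primitive_cong[OF primitive_pullback[OF \<sigma> half[OF \<rho>(1) f]]])
          fix l assume "l \<in> tuples (G\<lparr>carrier := \<rho> ` carrier G\<rparr>) (Suc n)"
          then have "map \<rho> (map \<sigma> l) = l"
            by (auto simp: tuples_def \<sigma>_def f_inv_into_f subset_iff intro!: map_idI)
          then show "f (map \<rho> (map \<sigma> l)) = f l" by simp
        qed
      qed auto
    qed
  qed
  \<comment> \<open>Here the tail must end in 0, which leaves f a coboundary.\<close>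
  define Q where "Q W \<longleftrightarrow> (\<forall>gs. W (Suc n) gs [] = 0)" for W :: "nat \<Rightarrow> 'a list \<Rightarrow> 'x list \<Rightarrow> real"
  have gtup_nonempty: "\<exists>xs. xs \<in> gtup m" for m
  proof (induction m)
    case 0
    show ?case using gen_Nil by (auto simp: gtup_def)
  next
    case (Suc m)
    then obtain xs where xs: "xs \<in> gtup m" by blast
    then have "eventually (\<lambda>k. y k # xs \<in> gen) sequentially" using gen_y by (auto simp: gtup_def)
    then obtain k where "y k # xs \<in> gen"
      using eventually_happens trivial_limit_sequentially by blast
    then show ?case using xs by (auto simp: gtup_def intro!: exI[of _ "y k # xs"])
  qed
  have tails: "\<exists>v W. Inv 0 n (1 * c) v \<and> tail (Suc n) (1 * c) W \<and> Q W \<and>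
        (\<forall>xs\<in>gtup (Suc n). w [] xs = cobd (v []) xs + W 0 [] xs)"
    if c: "0 \<le> c" and w: "Inv 0 (Suc n) c w" and dw: "\<And>xs. xs \<in> gtup (Suc (Suc n)) \<Longrightarrow> cobd (w []) xs = 0"
    for c w
  proof -
    have nil: "[] \<in> tuples G 0" by (simp add: tuples_def)
    obtain xs0 xs1 where xs0: "xs0 \<in> gtup (Suc n)" and xs1: "xs1 \<in> gtup (Suc (Suc n))"
      using gtup_nonempty by blast
    \<comment> \<open>By transitivity an invariant function of generic tuples is constant. A closed
      constant is 0 or its own coboundary, according to parity.\<close>
    define k where "k = w [] xs0"
    have w_k: "w [] xs = k" if "xs \<in> gtup (Suc n)" for xs
    proof -
      from trans[OF xs0 that] obtain a where a: "a \<in> carrier G" "xs = map (act a) xs0" by blast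
      then show ?thesis using InvD(2)[OF w nil xs0 a(1)] by (simp add: k_def)
    qed
    have "0 = cobd (\<lambda>_. k) xs1"
      using dw[OF xs1] cobd_gtup_cong[OF xs1, of "w []" "\<lambda>_. k"] w_k by simp
    then have k0: "odd n \<Longrightarrow> k = 0" using xs1 by (simp add: cobd_const gtup_def split: if_splits)
    have k_le: "\<bar>k\<bar> \<le> c" unfolding k_def using InvD(1)[OF w nil xs0] .
    show ?thesis
    proof (intro exI[of _ "\<lambda>_ _. k"] exI[of _ "\<lambda>_ _ _. 0"] conjI ballI)
      fix xs assume xs: "xs \<in> gtup (Suc n)"
      then show "w [] xs = cobd (\<lambda>_. k) xs + 0"
        using w_k k0 by (auto simp: cobd_const gtup_def)
    qed (use c k_le in \<open>auto simp: Inv_def tail_def Q_def\<close>)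
  qed
  have "\<exists>M\<ge>0. \<forall>c C f. cocycle G (Suc n) c f \<longrightarrow> 0 \<le> C \<longrightarrow>
    (\<forall>xs\<in>gtup 1. primitive (G\<lparr>carrier := stab xs\<rparr>) (Suc n) C f) \<longrightarrow>
    (\<exists>v W. cochain G n (M * (C + c)) v \<and> tail (Suc n) (M * (C + c)) W \<and> Q W \<and>
      (\<forall>gs\<in>tuples G (Suc n). f gs = cobd v gs + W (Suc n) gs []))"
  proof (rule descent[where K = K and E = 1 and Q = Q])
    fix p xs assume "1 \<le> p" "p \<le> n" "xs \<in> gtup (Suc (Suc n) - p)"
    then show "bounded_vanishing (G\<lparr>carrier := stab xs\<rparr>) p K" by (rule stab_bounded_vanishing)
  next
    fix c w assume "0 \<le> c" "Inv 0 (Suc n) c w" "\<And>xs. xs \<in> gtup (Suc (Suc n)) \<Longrightarrow> cobd (w []) xs = 0"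
    then show "\<exists>v W. Inv 0 n (1 * c) v \<and> tail (Suc n) (1 * c) W \<and> Q W \<and>
        (\<forall>xs\<in>gtup (Suc n). w [] xs = cobd (v []) xs + W 0 [] xs)" by (rule tails)
  qed (use K in auto)
  then obtain M where M: "M \<ge> 0"
    and desc: "\<And>c C f. cocycle G (Suc n) c f \<Longrightarrow> 0 \<le> C \<Longrightarrow>
      \<forall>xs\<in>gtup 1. primitive (G\<lparr>carrier := stab xs\<rparr>) (Suc n) C f \<Longrightarrow>
      \<exists>v W. cochain G n (M * (C + c)) v \<and> tail (Suc n) (M * (C + c)) W \<and> Q W \<and>
        (\<forall>gs\<in>tuples G (Suc n). f gs = cobd v gs + W (Suc n) gs [])"
    by blast
  have "bounded_vanishing G (Suc n) (M * (M1 + 1))"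
    unfolding bounded_vanishing_def
  proof (intro allI impI)
    fix c f assume f: "cocycle G (Suc n) c f"
    then have "0 \<le> c" using cochain_nonneg by (auto simp: cocycle_def)
    with M1 have "0 \<le> M1 * c" by simp
    with desc[OF f, of "M1 * c"] stab_prim[OF f] obtain v where "cochain G n (M * (M1 * c + c)) v"
      "\<And>gs. gs \<in> tuples G (Suc n) \<Longrightarrow> f gs = cobd v gs"
      unfolding Q_def by auto
    then show "primitive G (Suc n) (M * (M1 + 1) * c) f"
      unfolding primitive_def by (intro exI[of _ v]) (auto simp: algebra_simps)
  qed
  moreover have "0 \<le> M * (M1 + 1)" using M M1 by simp
  ultimately show ?case using N by blast
qed

section \<open>From primitives to bounded cohomology\<close>

lemma (in group) trivial_self_quotient: "trivial_group (G Mod carrier G)"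
proof -
  have N: "carrier G \<lhd> G" by (simp add: normal_inv_iff subgroup_self)
  interpret N: normal "carrier G" G by (rule N)
  have "carrier (G Mod carrier G) = {\<one>\<^bsub>G Mod carrier G\<^esub>}"
    using coset_join2[OF _ subgroup_self] by (auto simp: carrier_FactGroup intro!: image_eqI[of _ _ \<one>])
  then show ?thesis using N.factorgroup_is_group by (simp add: trivial_group_def)
qed

lemma carrier_bounded_cochains:
  "carrier (bounded_cochains \<Gamma> n) = {f \<in> extensional (tuples \<Gamma> (Suc n)). \<exists>c. cochain \<Gamma> (Suc n) c f}"
  by (auto simp: bounded_cochains_def cochain_def)

lemma (in group) group_bounded_cochains: "group (bounded_cochains G n)"
proof -
  note translate = tuples_translate[of _ "Suc n"]
  let ?B = "bounded_cochains G n" and ?T = "tuples G (Suc n)"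
  have restr: "(\<lambda>xs\<in>?T. f xs) \<in> carrier ?B" if "cochain G (Suc n) c f" for c f
    using that translate unfolding carrier_bounded_cochains by (auto simp: cochain_def)
  show ?thesis
  proof (rule groupI)
  fix f f' assume f: "f \<in> carrier ?B" and f': "f' \<in> carrier ?B"
  show "f \<otimes>\<^bsub>?B\<^esub> f' \<in> carrier ?B"
  proof -
    from f f' obtain c c' where "cochain G (Suc n) c f" "cochain G (Suc n) c' f'"
      by (auto simp: carrier_bounded_cochains)
    from restr[OF cochain_add[OF this]] show ?thesis by (simp add: bounded_cochains_def)
  qed
next
  show "\<one>\<^bsub>?B\<^esub> \<in> carrier ?B"
    using restr[of 0 "\<lambda>_. 0"] by (simp add: bounded_cochains_def cochain_def)
next
  fix f assume f: "f \<in> carrier ?B"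
  show "\<one>\<^bsub>?B\<^esub> \<otimes>\<^bsub>?B\<^esub> f = f"
    using f by (auto simp: bounded_cochains_def extensional_def fun_eq_iff)
  show "\<exists>f'\<in>carrier ?B. f' \<otimes>\<^bsub>?B\<^esub> f = \<one>\<^bsub>?B\<^esub>"
  proof -
    from f obtain c where "cochain G (Suc n) c f" by (auto simp: carrier_bounded_cochains)
    from restr[OF cochain_scale[OF this, of "-1"]]
    show ?thesis by (intro bexI[of _ "\<lambda>xs\<in>?T. - 1 * f xs"]) (auto simp: bounded_cochains_def fun_eq_iff)
  qed
  qed (auto simp: bounded_cochains_def fun_eq_iff)
qed

lemma coboundary_eq: "xs \<in> tuples \<Gamma> (Suc (Suc n)) \<Longrightarrow> coboundary \<Gamma> n f xs = cobd f xs"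
  by (simp add: coboundary_def cobd_eq_sum tuples_def lessThan_Suc_atMost)

lemma (in group) cochain_cobd:
  assumes f: "cochain G N c f"
  shows "cochain G (Suc N) (real (Suc N) * c) (cobd f)"
  unfolding cochain_def
proof (intro ballI conjI)
  fix xs assume xs: "xs \<in> tuples G (Suc N)"
  have "\<bar>cobd f xs\<bar> \<le> real (length xs) * c"
    by (rule abs_cobd_le) (use f tuples_delete[OF xs] in \<open>auto simp: cochain_def\<close>)
  then show "\<bar>cobd f xs\<bar> \<le> real (Suc N) * c" using xs by (simp add: tuples_def)
  fix a assume a: "a \<in> carrier G"
  have "cobd f (map (\<lambda>x. a \<otimes> x) xs) = cobd (\<lambda>l. f (map (\<lambda>x. a \<otimes> x) l)) xs"
    by (rule cobd_map[symmetric])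
  also have "\<dots> = cobd f xs"
    by (rule cobd_tuples_cong[OF xs]) (use f a in \<open>auto simp: cochain_def\<close>)
  finally show "cobd f (map (\<lambda>x. a \<otimes> x) xs) = cobd f xs" .
qed

lemma (in group) coboundary_hom: "coboundary G n \<in> hom (bounded_cochains G n) (bounded_cochains G (Suc n))"
proof (rule homI)
  fix f assume "f \<in> carrier (bounded_cochains G n)"
  then obtain c where f: "cochain G (Suc n) c f" by (auto simp: carrier_bounded_cochains)
  show "coboundary G n f \<in> carrier (bounded_cochains G (Suc n))"
    using cochain_cobd[OF f] tuples_translate[of _ "Suc (Suc n)"]
    unfolding carrier_bounded_cochains cochain_def
    by (auto simp: coboundary_eq) (simp add: coboundary_def)
next
  fix f f'
  have "coboundary G n (f \<otimes>\<^bsub>bounded_cochains G n\<^esub> f') xs = coboundary G n f xs + coboundary G n f' xs"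
    if xs: "xs \<in> tuples G (Suc (Suc n))" for xs
  proof -
    have "cobd (f \<otimes>\<^bsub>bounded_cochains G n\<^esub> f') xs = cobd (\<lambda>l. f l + f' l) xs"
      by (rule cobd_tuples_cong[OF xs]) (simp add: bounded_cochains_def)
    then show ?thesis using xs by (simp add: coboundary_eq cobd_add)
  qed
  then show "coboundary G n (f \<otimes>\<^bsub>bounded_cochains G n\<^esub> f')
      = coboundary G n f \<otimes>\<^bsub>bounded_cochains G (Suc n)\<^esub> coboundary G n f'"
    by (auto simp: bounded_cochains_def fun_eq_iff coboundary_def)
qed

lemma (in group) mem_bounded_cocycles:
  "f \<in> bounded_cocycles G n \<longleftrightarrow> f \<in> carrier (bounded_cochains G n) \<and> (\<exists>c. cocycle G (Suc n) c f)"
proof -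
  have "coboundary G n f = \<one>\<^bsub>bounded_cochains G (Suc n)\<^esub> \<longleftrightarrow> (\<forall>xs\<in>tuples G (Suc (Suc n)). cobd f xs = 0)"
    by (auto simp: bounded_cochains_def coboundary_eq fun_eq_iff) (auto simp: coboundary_def dest: coboundary_eq)
  then show ?thesis
    by (auto simp: bounded_cocycles_def kernel_def cocycle_def carrier_bounded_cochains)
qed

text \<open>Degree i means tuples of length i + 1, so vanishing is used at \<open>Suc i\<close>. It
  identifies coboundaries with cocycles, and the cohomology becomes the quotient of a group by
  itself.\<close>

theorem (in group) boundedly_acyclicI:
  assumes van: "\<And>N. 1 \<le> N \<Longrightarrow> \<exists>K. bounded_vanishing G N K"
  shows "boundedly_acyclic G"
  unfolding boundedly_acyclic_def
proof (intro allI impI)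
  fix i :: nat assume "1 \<le> i"
  then obtain k where i: "i = Suc k" by (cases i) auto
  interpret B: group "bounded_cochains G i" by (rule group_bounded_cochains)
  interpret d: group_hom "bounded_cochains G i" "bounded_cochains G (Suc i)" "coboundary G i"
    by (intro group_hom.intro group_hom_axioms.intro group_bounded_cochains coboundary_hom)
  have Z: "subgroup (bounded_cocycles G i) (bounded_cochains G i)"
    unfolding bounded_cocycles_def by (rule d.subgroup_kernel)
  have "bounded_coboundaries G i = bounded_cocycles G i"
  proof (intro equalityI subsetI)
    fix f assume "f \<in> bounded_coboundaries G i"
    then obtain u where u: "u \<in> carrier (bounded_cochains G k)" and f: "f = coboundary G k u"
      by (auto simp: bounded_coboundaries_def i)
    have f_in: "f \<in> carrier (bounded_cochains G i)" using coboundary_hom u by (auto simp: f i hom_def)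
    then obtain c where "cochain G (Suc i) c f" by (auto simp: carrier_bounded_cochains)
    moreover have "cobd f xs = 0" if "xs \<in> tuples G (Suc (Suc i))" for xs
    proof -
      have "cobd f xs = cobd (cobd u) xs"
        by (rule cobd_tuples_cong[OF that]) (simp add: f i coboundary_eq)
      then show ?thesis by simp
    qed
    ultimately show "f \<in> bounded_cocycles G i"
      using f_in by (auto simp: mem_bounded_cocycles cocycle_def)
  next
    fix f assume "f \<in> bounded_cocycles G i"
    then obtain c where f_in: "f \<in> carrier (bounded_cochains G i)" and f: "cocycle G (Suc i) c f"
      by (auto simp: mem_bounded_cocycles)
    obtain K where "bounded_vanishing G (Suc i) K" using van[of "Suc i"] by auto
    then have "primitive G (Suc i) (K * c) f" using f by (simp add: bounded_vanishing_def)
    then obtain u where u: "cochain G i (K * c) u" and du: "\<And>xs. xs \<in> tuples G (Suc i) \<Longrightarrow> cobd u xs = f xs"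
      by (auto simp: primitive_def)
    define u' where "u' = restrict u (tuples G (Suc k))"
    have "u' \<in> carrier (bounded_cochains G k)"
      using u tuples_translate[of _ "Suc k"] unfolding carrier_bounded_cochains
      by (auto simp: u'_def i cochain_def)
    moreover have "coboundary G k u' = f"
    proof
      fix xs
      show "coboundary G k u' xs = f xs"
      proof (cases "xs \<in> tuples G (Suc (Suc k))")
        case True
        have "cobd u' xs = cobd u xs" by (rule cobd_tuples_cong[OF True]) (simp add: u'_def)
        then show ?thesis using True du by (simp add: coboundary_eq i)
      next
        case False
        show ?thesis
        proof -
          have "f \<in> extensional (tuples G (Suc (Suc k)))" using f_in by (simp add: carrier_bounded_cochains i)
          from extensional_arb[OF this False] show ?thesis using False by (simp add: coboundary_def)
        qed
      qed
    qed
    ultimately show "f \<in> bounded_coboundaries G i"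
      by (auto simp: bounded_coboundaries_def i)
  qed
  then have "bounded_cohomology G i = bounded_cochains G i\<lparr>carrier := bounded_cocycles G i\<rparr>
      Mod carrier (bounded_cochains G i\<lparr>carrier := bounded_cocycles G i\<rparr>)"
    by (simp add: bounded_cohomology_def)
  then show "trivial_group (bounded_cohomology G i)"
    using group.trivial_self_quotient[OF B.subgroup_imp_group[OF Z]] by (simp only:)
qed

section \<open>Brick maps\<close>

locale twisted_bt =
  fixes G :: "('g, 'm) monoid_scheme" (structure) and S :: "'s set" and \<phi> :: "'g \<Rightarrow> 's \<Rightarrow> 's"
  assumes action: "group_action G S \<phi>" and S_nonempty: "S \<noteq> {}"
begin

sublocale A: group_action G S \<phi> by (rule action)
sublocale group G using A.group_hom group_hom_def by blast

abbreviation "C \<equiv> cantor_power S"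
abbreviation "bm \<equiv> brick_map S"
abbreviation "br \<equiv> brick S"
abbreviation "lab \<equiv> brick_label S"
abbreviation "sh \<equiv> shift_action G S \<phi>"

definition label_shift :: "'g \<Rightarrow> ('s \<Rightarrow> bool list) \<Rightarrow> 's \<Rightarrow> bool list" where
  "label_shift g \<psi> = (\<lambda>s. \<psi> (\<phi> (inv g) s))"

definition label_append :: "('s \<Rightarrow> bool list) \<Rightarrow> ('s \<Rightarrow> bool list) \<Rightarrow> 's \<Rightarrow> bool list" where
  "label_append \<alpha> \<nu> = (\<lambda>s. \<alpha> s @ \<nu> s)"

lemma \<phi>_in: "g \<in> carrier G \<Longrightarrow> s \<in> S \<Longrightarrow> \<phi> g s \<in> S"
  using A.element_image by blast

lemma \<phi>_mult: "g \<in> carrier G \<Longrightarrow> h \<in> carrier G \<Longrightarrow> s \<in> S \<Longrightarrow> \<phi> (g \<otimes> h) s = \<phi> g (\<phi> h s)"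
  using A.composition_rule by blast

lemma \<phi>_one: "s \<in> S \<Longrightarrow> \<phi> \<one> s = s"
  using A.id_eq_one by (metis restrict_apply')

lemma restrict_in_C [simp]: "restrict f S \<in> C"
  by (simp add: cantor_power_def)

lemma bm_in [simp]: "bm \<alpha> \<kappa> \<in> C"
  by (simp add: brick_map_def cantor_power_def)

lemma sh_in [simp]: "sh g \<kappa> \<in> C"
  by (simp add: shift_action_def cantor_power_def)

lemma C_eqI: "\<kappa> \<in> C \<Longrightarrow> \<kappa>' \<in> C \<Longrightarrow> (\<And>s. s \<in> S \<Longrightarrow> \<kappa> s = \<kappa>' s) \<Longrightarrow> \<kappa> = \<kappa>'"
  unfolding cantor_power_def by (rule PiE_ext)

lemma bm_inj: "\<kappa> \<in> C \<Longrightarrow> \<kappa>' \<in> C \<Longrightarrow> bm \<alpha> \<kappa> = bm \<alpha> \<kappa>' \<Longrightarrow> \<kappa> = \<kappa>'"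
  using brick_map_bij[of S \<alpha>] by (auto simp: bij_betw_def inj_on_def)

lemma br_eq: "br \<alpha> = bm \<alpha> ` C"
  using brick_map_bij[of S \<alpha>] by (auto simp: bij_betw_def)

lemma br_sub: "br \<alpha> \<subseteq> C"
  by (auto simp: brick_def)

lemma bm_label_append: "bm (label_append \<alpha> \<nu>) \<kappa> = bm \<alpha> (bm \<nu> \<kappa>)"
  by (rule C_eqI) (auto simp: brick_map_def label_append_def)

lemma bm_cong: "(\<And>s. s \<in> S \<Longrightarrow> \<alpha> s = \<beta> s) \<Longrightarrow> bm \<alpha> = bm \<beta>"
  by (rule ext, rule C_eqI) (auto simp: brick_map_def)

lemma bm_Nil: "\<kappa> \<in> C \<Longrightarrow> bm (\<lambda>_. []) \<kappa> = \<kappa>"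
  by (rule C_eqI) (auto simp: brick_map_def)

text \<open>The brick form of the defining relation x_(g.s) g = (g \<oplus> g) x_s: an element of G
  passes a prefix by permuting the coordinates at which its letters stand.\<close>

lemma sh_bm: "g \<in> carrier G \<Longrightarrow> sh g (bm \<nu> \<kappa>) = bm (label_shift g \<nu>) (sh g \<kappa>)"
  by (rule C_eqI) (auto simp: brick_map_def shift_action_def label_shift_def \<phi>_in)

lemma sh_sh: "g \<in> carrier G \<Longrightarrow> h \<in> carrier G \<Longrightarrow> sh g (sh h \<kappa>) = sh (g \<otimes> h) \<kappa>"
  by (rule C_eqI) (auto simp: shift_action_def \<phi>_in \<phi>_mult inv_mult_group)

lemma sh_one: "\<kappa> \<in> C \<Longrightarrow> sh \<one> \<kappa> = \<kappa>"
  by (rule C_eqI) (auto simp: shift_action_def \<phi>_one)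

lemma label_shift_label_shift: "g \<in> carrier G \<Longrightarrow> bm (label_shift g (label_shift (inv g) \<nu>)) = bm \<nu>"
  by (rule bm_cong) (simp add: label_shift_def \<phi>_mult[symmetric] \<phi>_one)

lemma lab_label_append: "lab \<alpha> \<Longrightarrow> lab \<nu> \<Longrightarrow> lab (label_append \<alpha> \<nu>)"
  unfolding brick_label_def label_append_def by (rule finite_subset[of _ "{s \<in> S. \<alpha> s \<noteq> []} \<union> {s \<in> S. \<nu> s \<noteq> []}"]) auto

lemma lab_Nil: "lab (\<lambda>_. [])"
  by (simp add: brick_label_def)

lemma lab_label_shift: assumes "lab \<nu>" "g \<in> carrier G" shows "lab (label_shift g \<nu>)"
proof -
  have "{s \<in> S. label_shift g \<nu> s \<noteq> []} \<subseteq> \<phi> g ` {s \<in> S. \<nu> s \<noteq> []}"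
  proof
    fix s assume s: "s \<in> {s \<in> S. label_shift g \<nu> s \<noteq> []}"
    then have "s = \<phi> g (\<phi> (inv g) s)" using assms(2) by (simp add: \<phi>_mult[symmetric] \<phi>_one)
    moreover have "\<phi> (inv g) s \<in> {s \<in> S. \<nu> s \<noteq> []}" using s assms(2) by (simp add: label_shift_def \<phi>_in)
    ultimately show "s \<in> \<phi> g ` {s \<in> S. \<nu> s \<noteq> []}" by blast
  qed
  then show ?thesis using assms(1) unfolding brick_label_def by (meson finite_imageI finite_subset)
qed

lemma br_label_append: "br (label_append \<alpha> \<nu>) \<subseteq> br \<alpha>"
  unfolding br_eq by (auto simp: bm_label_append)

text \<open>In each coordinate the longer of the two prefixes of \<kappa> labels a brick contained
  in both. The result is an equation of brick maps because the labels are compared on S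
  only.\<close>

lemma common_refinement:
  assumes "lab \<alpha>" "lab \<beta>" "\<kappa> \<in> br \<alpha>" "\<kappa> \<in> br \<beta>"
  obtains \<nu> \<nu>' where "lab \<nu>" "lab \<nu>'" "\<kappa> \<in> br (label_append \<alpha> \<nu>)" "bm (label_append \<alpha> \<nu>) = bm (label_append \<beta> \<nu>')"
proof
  define m where "m s = max (length (\<alpha> s)) (length (\<beta> s))" for s
  define \<nu> where "\<nu> s = drop (length (\<alpha> s)) (prefix (m s) (\<kappa> s))" for s
  define \<nu>' where "\<nu>' s = drop (length (\<beta> s)) (prefix (m s) (\<kappa> s))" for s
  have a: "label_append \<alpha> \<nu> s = prefix (m s) (\<kappa> s)" if "s \<in> S" for s
  proof -
    have "\<alpha> s = take (length (\<alpha> s)) (prefix (m s) (\<kappa> s))"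
      using assms(3) that by (simp add: brick_def m_def min_absorb2)
    then show ?thesis unfolding label_append_def \<nu>_def by (metis append_take_drop_id)
  qed
  have b: "label_append \<beta> \<nu>' s = prefix (m s) (\<kappa> s)" if "s \<in> S" for s
  proof -
    have "\<beta> s = take (length (\<beta> s)) (prefix (m s) (\<kappa> s))"
      using assms(4) that by (simp add: brick_def m_def min_absorb2)
    then show ?thesis unfolding label_append_def \<nu>'_def by (metis append_take_drop_id)
  qed
  show "lab \<nu>" using assms(2) unfolding brick_label_def
    by (rule rev_finite_subset) (auto simp: \<nu>_def m_def)
  show "lab \<nu>'" using assms(1) unfolding brick_label_def
    by (rule rev_finite_subset) (auto simp: \<nu>'_def m_def)
  show "\<kappa> \<in> br (label_append \<alpha> \<nu>)" using assms(3) by (auto simp: brick_def a)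
  show "bm (label_append \<alpha> \<nu>) = bm (label_append \<beta> \<nu>')" by (rule bm_cong) (simp add: a b)
qed

section \<open>The groupoid of local brick morphisms\<close>

definition loc :: "(('s \<Rightarrow> nat \<Rightarrow> bool) \<Rightarrow> ('s \<Rightarrow> nat \<Rightarrow> bool)) \<Rightarrow> (('s \<Rightarrow> nat \<Rightarrow> bool) \<Rightarrow> 'g) \<Rightarrow>
    ('s \<Rightarrow> bool list) \<Rightarrow> ('s \<Rightarrow> bool list) \<Rightarrow> 'g \<Rightarrow> bool" where
  "loc h \<gamma> \<alpha> \<beta> g \<longleftrightarrow> lab \<alpha> \<and> lab \<beta> \<and> g \<in> carrier G \<and>
     (\<forall>\<kappa>\<in>C. h (bm \<alpha> \<kappa>) = bm \<beta> (sh g \<kappa>) \<and> \<gamma> (bm \<alpha> \<kappa>) = g)"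

text \<open>
  The morphisms of the groupoid SV_G, with subsets of C^S in place of the sums C^S(m).  The
  condition is local; finite brick partitions are recovered from it by compactness.
\<close>

definition mor :: "('s \<Rightarrow> nat \<Rightarrow> bool) set \<Rightarrow> ('s \<Rightarrow> nat \<Rightarrow> bool) set \<Rightarrow>
    (('s \<Rightarrow> nat \<Rightarrow> bool) \<Rightarrow> ('s \<Rightarrow> nat \<Rightarrow> bool)) \<Rightarrow> (('s \<Rightarrow> nat \<Rightarrow> bool) \<Rightarrow> 'g) \<Rightarrow> bool" where
  "mor U V h \<gamma> \<longleftrightarrow> U \<subseteq> C \<and> bij_betw h U V \<and>
     (\<forall>\<kappa>\<in>U. \<exists>\<alpha> \<beta> g. loc h \<gamma> \<alpha> \<beta> g \<and> \<kappa> \<in> br \<alpha> \<and> br \<alpha> \<subseteq> U)"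

lemma loc_refine: "loc h \<gamma> \<alpha> \<beta> g \<Longrightarrow> lab \<nu> \<Longrightarrow> loc h \<gamma> (label_append \<alpha> \<nu>) (label_append \<beta> (label_shift g \<nu>)) g"
  unfolding loc_def by (auto simp: lab_label_append lab_label_shift bm_label_append sh_bm)

lemma loc_relabel:
  "loc h \<gamma> \<alpha> \<beta> g \<Longrightarrow> lab \<alpha>' \<Longrightarrow> lab \<beta>' \<Longrightarrow> bm \<alpha> = bm \<alpha>' \<Longrightarrow> bm \<beta> = bm \<beta>' \<Longrightarrow> loc h \<gamma> \<alpha>' \<beta>' g"
  unfolding loc_def by auto

lemma loc_comp:
  "loc h' \<gamma>' \<alpha> \<beta> g' \<Longrightarrow> loc h \<gamma> \<beta> \<beta>' g \<Longrightarrow> loc (\<lambda>\<kappa>. h (h' \<kappa>)) (\<lambda>\<kappa>. \<gamma> (h' \<kappa>) \<otimes> \<gamma>' \<kappa>) \<alpha> \<beta>' (g \<otimes> g')"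
  unfolding loc_def by (auto simp: sh_sh)

lemma loc_image: assumes "loc h \<gamma> \<alpha> \<beta> g" shows "h ` br \<alpha> = br \<beta>"
proof -
  have "sh g ` C = C"
  proof (intro equalityI subsetI)
    fix \<kappa> assume "\<kappa> \<in> C"
    then have "\<kappa> = sh g (sh (inv g) \<kappa>)" using assms by (simp add: sh_sh sh_one loc_def)
    then show "\<kappa> \<in> sh g ` C" by (metis imageI sh_in)
  qed auto
  then have "bm \<beta> ` C = bm \<beta> ` sh g ` C" by simp
  then show ?thesis using assms unfolding br_eq loc_def by (force simp: image_image)
qed

lemma mor_cong:
  assumes "mor U V h \<gamma>" "\<And>\<kappa>. \<kappa> \<in> U \<Longrightarrow> h \<kappa> = h' \<kappa>" "\<And>\<kappa>. \<kappa> \<in> U \<Longrightarrow> \<gamma> \<kappa> = \<gamma>' \<kappa>"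
  shows "mor U V h' \<gamma>'"
proof -
  have "loc h' \<gamma>' \<alpha> \<beta> g" if "loc h \<gamma> \<alpha> \<beta> g" "br \<alpha> \<subseteq> U" for \<alpha> \<beta> g
    using that assms(2,3) unfolding loc_def br_eq by (metis imageI subsetD)
  moreover have "bij_betw h' U V" using assms bij_betw_cong[of U h h' V] unfolding mor_def by blast
  ultimately show ?thesis using assms(1) unfolding mor_def by meson
qed

text \<open>Openness in terms of bricks, the form in which it interacts with morphisms;
  \<open>openin_iff_brick_open\<close> identifies it with the product topology on subsets of
  C^S.\<close>

definition brick_open :: "('s \<Rightarrow> nat \<Rightarrow> bool) set \<Rightarrow> bool" where
  "brick_open U \<longleftrightarrow> (\<forall>\<kappa>\<in>U. \<exists>\<alpha>. lab \<alpha> \<and> \<kappa> \<in> br \<alpha> \<and> br \<alpha> \<subseteq> U)"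

definition clopen :: "('s \<Rightarrow> nat \<Rightarrow> bool) set \<Rightarrow> bool" where
  "clopen U \<longleftrightarrow> U \<subseteq> C \<and> brick_open U \<and> brick_open (C - U)"

lemma brick_open_union: "brick_open U \<Longrightarrow> brick_open V \<Longrightarrow> brick_open (U \<union> V)"
  unfolding brick_open_def by blast

lemma brick_open_inter: assumes "brick_open U" "brick_open V" shows "brick_open (U \<inter> V)"
  unfolding brick_open_def
proof
  fix \<kappa> assume "\<kappa> \<in> U \<inter> V"
  then obtain \<alpha> \<beta> where 1: "lab \<alpha>" "\<kappa> \<in> br \<alpha>" "br \<alpha> \<subseteq> U" and 2: "lab \<beta>" "\<kappa> \<in> br \<beta>" "br \<beta> \<subseteq> V"
    using assms unfolding brick_open_def by blast
  obtain \<nu> \<nu>' where \<nu>: "lab \<nu>" "lab \<nu>'" "\<kappa> \<in> br (label_append \<alpha> \<nu>)" and eq: "bm (label_append \<alpha> \<nu>) = bm (label_append \<beta> \<nu>')"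
    using common_refinement[OF 1(1) 2(1) 1(2) 2(2)] .
  have "br (label_append \<alpha> \<nu>) = br (label_append \<beta> \<nu>')" by (simp add: br_eq eq)
  then have "br (label_append \<alpha> \<nu>) \<subseteq> U \<inter> V" using br_label_append[of \<alpha> \<nu>] br_label_append[of \<beta> \<nu>'] 1(3) 2(3) by auto
  then show "\<exists>\<alpha>. lab \<alpha> \<and> \<kappa> \<in> br \<alpha> \<and> br \<alpha> \<subseteq> U \<inter> V" using lab_label_append[OF 1(1) \<nu>(1)] \<nu>(3) by blast
qed

lemma brick_open_br: "lab \<alpha> \<Longrightarrow> brick_open (br \<alpha>)"
  unfolding brick_open_def by blast

lemma brick_open_compl_br: assumes "lab \<alpha>" shows "brick_open (C - br \<alpha>)"
  unfolding brick_open_def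
proof
  fix \<kappa> assume "\<kappa> \<in> C - br \<alpha>"
  then obtain s where s: "s \<in> S" "prefix (length (\<alpha> s)) (\<kappa> s) \<noteq> \<alpha> s" and \<kappa>: "\<kappa> \<in> C" by (auto simp: brick_def)
  \<comment> \<open>A mismatch in the coordinate s alone excludes membership, so a label supported
    at s suffices.\<close>
  define \<nu> where "\<nu> = (\<lambda>t. if t = s then prefix (length (\<alpha> s)) (\<kappa> s) else [])"
  have "lab \<nu>" unfolding brick_label_def by (rule finite_subset[of _ "{s}"]) (auto simp: \<nu>_def)
  moreover have "\<kappa> \<in> br \<nu>" using \<kappa> by (auto simp: brick_def \<nu>_def)
  moreover have "br \<nu> \<subseteq> C - br \<alpha>"
    using s by (auto simp: brick_def \<nu>_def dest!: bspec[OF _ s(1)])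
  ultimately show "\<exists>\<alpha>'. lab \<alpha>' \<and> \<kappa> \<in> br \<alpha>' \<and> br \<alpha>' \<subseteq> C - br \<alpha>" by blast
qed

lemma brick_open_C: "brick_open C"
  unfolding brick_open_def using lab_Nil by (auto simp: brick_def)

lemma brick_open_empty: "brick_open {}"
  by (simp add: brick_open_def)

lemma clopen_br: "lab \<alpha> \<Longrightarrow> clopen (br \<alpha>)"
  by (simp add: clopen_def br_sub brick_open_br brick_open_compl_br)

lemma clopen_C: "clopen C"
  by (simp add: clopen_def brick_open_C brick_open_empty)

lemma clopen_compl: "clopen U \<Longrightarrow> clopen (C - U)"
  by (auto simp: clopen_def double_diff)

lemma clopen_inter: "clopen U \<Longrightarrow> clopen V \<Longrightarrow> clopen (U \<inter> V)"
  by (auto simp: clopen_def brick_open_inter brick_open_union Diff_Int)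

lemma clopen_union: "clopen U \<Longrightarrow> clopen V \<Longrightarrow> clopen (U \<union> V)"
  by (auto simp: clopen_def brick_open_inter brick_open_union Diff_Un)

lemma clopen_Inter: "finite I \<Longrightarrow> (\<And>i. i \<in> I \<Longrightarrow> clopen (U i)) \<Longrightarrow> clopen (C \<inter> (\<Inter>i\<in>I. U i))"
proof (induction I rule: finite_induct)
  case (insert i I)
  then have "clopen (U i \<inter> (C \<inter> (\<Inter>i\<in>I. U i)))" using clopen_inter by blast
  then show ?case by (simp add: Int_left_commute)
qed (simp add: clopen_C)

lemma clopen_Union: "finite I \<Longrightarrow> (\<And>i. i \<in> I \<Longrightarrow> clopen (U i)) \<Longrightarrow> clopen (\<Union>i\<in>I. U i)"
proof (induction I rule: finite_induct)
  case empty
  then show ?case using clopen_compl[OF clopen_C] by simp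
qed (simp add: clopen_union)

lemma mor_id: assumes "U \<subseteq> C" "brick_open U" shows "mor U U (\<lambda>\<kappa>. \<kappa>) (\<lambda>_. \<one>)"
  unfolding mor_def
proof (intro conjI ballI assms)
  show "bij_betw (\<lambda>\<kappa>. \<kappa>) U U" by (simp add: bij_betw_def)
  fix \<kappa> assume "\<kappa> \<in> U"
  then obtain \<alpha> where \<alpha>: "lab \<alpha>" "\<kappa> \<in> br \<alpha>" "br \<alpha> \<subseteq> U" using assms(2) unfolding brick_open_def by blast
  then have "loc (\<lambda>\<kappa>. \<kappa>) (\<lambda>_. \<one>) \<alpha> \<alpha> \<one>" by (simp add: loc_def sh_one)
  with \<alpha> show "\<exists>\<alpha> \<beta> g. loc (\<lambda>\<kappa>. \<kappa>) (\<lambda>_. \<one>) \<alpha> \<beta> g \<and> \<kappa> \<in> br \<alpha> \<and> br \<alpha> \<subseteq> U" by blast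
qed

lemma mor_brick: assumes "lab \<alpha>" shows "mor C (br \<alpha>) (bm \<alpha>) (\<lambda>_. \<one>)"
  unfolding mor_def
proof (intro conjI ballI brick_map_bij)
  fix \<kappa> assume \<kappa>: "\<kappa> \<in> C"
  have "loc (bm \<alpha>) (\<lambda>_. \<one>) (\<lambda>_. []) \<alpha> \<one>" using assms by (simp add: loc_def bm_Nil sh_one lab_Nil)
  moreover have "\<kappa> \<in> br (\<lambda>_. [])" using \<kappa> by (simp add: brick_def)
  ultimately show "\<exists>\<alpha>' \<beta> g. loc (bm \<alpha>) (\<lambda>_. \<one>) \<alpha>' \<beta> g \<and> \<kappa> \<in> br \<alpha>' \<and> br \<alpha>' \<subseteq> C"
    using br_sub by blast
qed simp

text \<open>The target brick of the inner piece at \<kappa> and the source brick of an outer piece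
  both contain \<open>h' \<kappa>\<close>. After passing to a common refinement there, the pieces
  compose by \<open>loc_comp\<close>.\<close>

lemma mor_comp:
  assumes "mor U V h' \<gamma>'" "mor V W h \<gamma>"
  shows "mor U W (\<lambda>\<kappa>. h (h' \<kappa>)) (\<lambda>\<kappa>. \<gamma> (h' \<kappa>) \<otimes> \<gamma>' \<kappa>)"
  unfolding mor_def
proof (intro conjI ballI)
  show "U \<subseteq> C" using assms by (simp add: mor_def)
  show "bij_betw (\<lambda>\<kappa>. h (h' \<kappa>)) U W"
    using assms bij_betw_trans[of h' U V h W] by (simp add: mor_def comp_def)
  fix \<kappa> assume "\<kappa> \<in> U"
  then obtain \<alpha> \<beta> g' where l1: "loc h' \<gamma>' \<alpha> \<beta> g'" and \<kappa>: "\<kappa> \<in> br \<alpha>" "br \<alpha> \<subseteq> U"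
    using assms(1) unfolding mor_def by blast
  have h'\<kappa>: "h' \<kappa> \<in> br \<beta>" using loc_image[OF l1] \<kappa>(1) by blast
  have "h' \<kappa> \<in> V" using assms(1) \<open>\<kappa> \<in> U\<close> by (auto simp: mor_def bij_betw_def)
  then obtain \<alpha>1 \<beta>1 g where l2: "loc h \<gamma> \<alpha>1 \<beta>1 g" "h' \<kappa> \<in> br \<alpha>1"
    using assms(2) unfolding mor_def by blast
  obtain \<nu> \<nu>' where \<nu>: "lab \<nu>" "lab \<nu>'" "h' \<kappa> \<in> br (label_append \<beta> \<nu>)" and eq: "bm (label_append \<beta> \<nu>) = bm (label_append \<alpha>1 \<nu>')"
    using common_refinement[of \<beta> \<alpha>1 "h' \<kappa>"] l1 l2 h'\<kappa> by (auto simp: loc_def)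
  have g': "g' \<in> carrier G" "lab \<alpha>" "lab \<beta>" "lab \<alpha>1" using l1 l2 by (auto simp: loc_def)
  \<comment> \<open>Refining the target of the inner piece by \<open>\<nu>\<close> amounts to
    refining its source by this label, as the piece applies \<open>g'\<close> in between.\<close>
  define \<mu> where "\<mu> = label_shift (inv g') \<nu>"
  have \<mu>: "lab \<mu>" using \<nu> g' by (simp add: \<mu>_def lab_label_shift)
  have bm_\<mu>: "bm (label_shift g' \<mu>) = bm \<nu>" using g' by (simp add: \<mu>_def label_shift_label_shift)
  have bm_\<beta>\<mu>: "bm (label_append \<beta> (label_shift g' \<mu>)) = bm (label_append \<beta> \<nu>)" by (rule ext) (simp add: bm_label_append bm_\<mu>)
  have l1': "loc h' \<gamma>' (label_append \<alpha> \<mu>) (label_append \<beta> \<nu>) g'"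
    by (rule loc_relabel[OF loc_refine[OF l1 \<mu>]]) (use g' \<nu> \<mu> in \<open>simp_all add: lab_label_append bm_\<beta>\<mu>\<close>)
  have l2': "loc h \<gamma> (label_append \<beta> \<nu>) (label_append \<beta>1 (label_shift g \<nu>')) g"
    by (rule loc_relabel[OF loc_refine[OF l2(1) \<nu>(2)]])
      (use g' \<nu> l2 eq in \<open>auto simp: lab_label_append lab_label_shift loc_def\<close>)
  have "\<kappa> \<in> br (label_append \<alpha> \<mu>)"
  proof -
    have "h' \<kappa> \<in> h' ` br (label_append \<alpha> \<mu>)" using loc_image[OF l1'] \<nu>(3) by simp
    then obtain \<kappa>' where "\<kappa>' \<in> br (label_append \<alpha> \<mu>)" "h' \<kappa> = h' \<kappa>'" by blast
    moreover have "inj_on h' U" using assms(1) by (simp add: mor_def bij_betw_def)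
    ultimately show ?thesis using \<kappa> br_label_append[of \<alpha> \<mu>] by (metis inj_on_contraD subsetD)
  qed
  then show "\<exists>\<alpha> \<beta> g. loc (\<lambda>\<kappa>. h (h' \<kappa>)) (\<lambda>\<kappa>. \<gamma> (h' \<kappa>) \<otimes> \<gamma>' \<kappa>) \<alpha> \<beta> g \<and> \<kappa> \<in> br \<alpha> \<and> br \<alpha> \<subseteq> U"
    using loc_comp[OF l1' l2'] br_label_append[of \<alpha> \<mu>] \<kappa>(2) by blast
qed

lemma mor_inv:
  assumes "mor U V h \<gamma>"
  shows "mor V U (inv_into U h) (\<lambda>\<kappa>. inv (\<gamma> (inv_into U h \<kappa>)))"
  unfolding mor_def
proof (intro conjI ballI)
  have bij: "bij_betw h U V" and U: "U \<subseteq> C" using assms by (auto simp: mor_def)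
  have V: "\<exists>\<alpha> \<beta> g. loc h \<gamma> \<alpha> \<beta> g \<and> br \<alpha> \<subseteq> U \<and> \<kappa> \<in> br \<beta> \<and> br \<beta> \<subseteq> V" if "\<kappa> \<in> V" for \<kappa>
  proof -
    have "\<kappa> \<in> h ` U" using bij that by (simp add: bij_betw_def)
    then obtain \<kappa>' where "\<kappa>' \<in> U" "\<kappa> = h \<kappa>'" by blast
    then obtain \<alpha> \<beta> g where l: "loc h \<gamma> \<alpha> \<beta> g" "\<kappa>' \<in> br \<alpha>" "br \<alpha> \<subseteq> U"
      using assms unfolding mor_def by blast
    then have "h ` br \<alpha> \<subseteq> V" using bij by (auto simp: bij_betw_def)
    then show ?thesis using l loc_image[OF l(1)] \<open>\<kappa> = h \<kappa>'\<close> by blast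
  qed
  then show "V \<subseteq> C" using br_sub by blast
  show "bij_betw (inv_into U h) V U" by (rule bij_betw_inv_into[OF bij])
  fix \<kappa> assume "\<kappa> \<in> V"
  from V[OF this] obtain \<alpha> \<beta> g where l: "loc h \<gamma> \<alpha> \<beta> g" and *: "br \<alpha> \<subseteq> U" "\<kappa> \<in> br \<beta>" "br \<beta> \<subseteq> V"
    by blast
  have g: "g \<in> carrier G" using l by (simp add: loc_def)
  have "inv_into U h (bm \<beta> \<kappa>') = bm \<alpha> (sh (inv g) \<kappa>')" if "\<kappa>' \<in> C" for \<kappa>'
  proof -
    have "h (bm \<alpha> (sh (inv g) \<kappa>')) = bm \<beta> \<kappa>'"
      using l that g by (simp add: loc_def sh_sh sh_one)
    moreover have "bm \<alpha> (sh (inv g) \<kappa>') \<in> U" using * by (auto simp: br_eq)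
    ultimately show ?thesis using bij by (metis bij_betw_inv_into_left)
  qed
  then have "loc (inv_into U h) (\<lambda>\<kappa>. inv (\<gamma> (inv_into U h \<kappa>))) \<beta> \<alpha> (inv g)"
    using l by (auto simp: loc_def)
  then show "\<exists>\<alpha> \<beta> g. loc (inv_into U h) (\<lambda>\<kappa>. inv (\<gamma> (inv_into U h \<kappa>))) \<alpha> \<beta> g \<and> \<kappa> \<in> br \<alpha> \<and> br \<alpha> \<subseteq> V"
    using * by blast
qed

lemma mor_restrict:
  assumes "mor U V h \<gamma>" "U' \<subseteq> U" "brick_open U'"
  shows "mor U' (h ` U') h \<gamma>"
  unfolding mor_def
proof (intro conjI ballI)
  show "U' \<subseteq> C" using assms by (auto simp: mor_def)
  show "bij_betw h U' (h ` U')"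
    using assms by (auto simp: mor_def bij_betw_def intro: inj_on_subset)
  fix \<kappa> assume \<kappa>: "\<kappa> \<in> U'"
  then obtain \<alpha> \<beta> g where l: "loc h \<gamma> \<alpha> \<beta> g" "\<kappa> \<in> br \<alpha>" using assms unfolding mor_def by blast
  obtain \<alpha>' where \<alpha>': "lab \<alpha>'" "\<kappa> \<in> br \<alpha>'" "br \<alpha>' \<subseteq> U'" using \<kappa> assms(3) unfolding brick_open_def by blast
  obtain \<nu> \<nu>' where \<nu>: "lab \<nu>" "lab \<nu>'" "\<kappa> \<in> br (label_append \<alpha> \<nu>)" and eq: "bm (label_append \<alpha> \<nu>) = bm (label_append \<alpha>' \<nu>')"
    using common_refinement[of \<alpha> \<alpha>' \<kappa>] l \<alpha>' by (auto simp: loc_def)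
  have "br (label_append \<alpha> \<nu>) = br (label_append \<alpha>' \<nu>')" by (simp add: br_eq eq)
  then have "br (label_append \<alpha> \<nu>) \<subseteq> U'" using br_label_append[of \<alpha>' \<nu>'] \<alpha>'(3) by auto
  then show "\<exists>\<alpha> \<beta> g. loc h \<gamma> \<alpha> \<beta> g \<and> \<kappa> \<in> br \<alpha> \<and> br \<alpha> \<subseteq> U'"
    using loc_refine[OF l(1) \<nu>(1)] \<nu>(3) by blast
qed

lemma mor_union:
  assumes "mor U V h \<gamma>" "mor U' V' h \<gamma>" "V \<inter> V' = {}"
  shows "mor (U \<union> U') (V \<union> V') h \<gamma>"
  unfolding mor_def
proof (intro conjI)
  show "bij_betw h (U \<union> U') (V \<union> V')"
    using assms by (intro bij_betw_combine) (auto simp: mor_def)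
  show "U \<union> U' \<subseteq> C" using assms by (auto simp: mor_def)
  show "\<forall>\<kappa>\<in>U \<union> U'. \<exists>\<alpha> \<beta> g. loc h \<gamma> \<alpha> \<beta> g \<and> \<kappa> \<in> br \<alpha> \<and> br \<alpha> \<subseteq> U \<union> U'"
  proof
    fix \<kappa> assume "\<kappa> \<in> U \<union> U'"
    then obtain \<alpha> \<beta> g where "loc h \<gamma> \<alpha> \<beta> g" "\<kappa> \<in> br \<alpha>" "br \<alpha> \<subseteq> U \<or> br \<alpha> \<subseteq> U'"
      using assms(1,2) unfolding mor_def by (meson Un_iff)
    then show "\<exists>\<alpha> \<beta> g. loc h \<gamma> \<alpha> \<beta> g \<and> \<kappa> \<in> br \<alpha> \<and> br \<alpha> \<subseteq> U \<union> U'"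
      by (meson le_supI1 le_supI2)
  qed
qed

lemma mor_glue:
  assumes "mor U V h \<gamma>" "mor U' V' h' \<gamma>'" "U \<inter> U' = {}" "V \<inter> V' = {}"
  shows "mor (U \<union> U') (V \<union> V') (\<lambda>\<kappa>. if \<kappa> \<in> U then h \<kappa> else h' \<kappa>) (\<lambda>\<kappa>. if \<kappa> \<in> U then \<gamma> \<kappa> else \<gamma>' \<kappa>)"
  by (rule mor_union[OF mor_cong[OF assms(1)] mor_cong[OF assms(2)] assms(4)]) (use assms(3) in auto)

text \<open>The target is open because it is the source of the inverse morphism.\<close>

lemma mor_brick_open: assumes "mor U V h \<gamma>" shows "brick_open V" "V \<subseteq> C"
proof -
  have "mor V U (inv_into U h) (\<lambda>\<kappa>. inv (\<gamma> (inv_into U h \<kappa>)))" using mor_inv[OF assms] .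
  then show "brick_open V" "V \<subseteq> C" unfolding mor_def brick_open_def loc_def by blast+
qed

lemma clopen_image: assumes "mor C C h \<gamma>" "clopen U" shows "clopen (h ` U)"
proof -
  have "inj_on h C" "h ` C = C" using assms(1) by (auto simp: mor_def bij_betw_def)
  then have "C - h ` U = h ` (C - U)"
    using assms(2) inj_on_image_set_diff[of h C C U] by (simp add: clopen_def)
  moreover have "brick_open (h ` U)" "brick_open (h ` (C - U))" "h ` U \<subseteq> C"
    using mor_brick_open[OF mor_restrict[OF assms(1)]] assms(2) unfolding clopen_def by auto
  ultimately show ?thesis by (simp add: clopen_def)
qed

lemma morE:
  assumes "mor U V h \<gamma>" "\<kappa> \<in> U"
  obtains \<alpha> \<beta> g where "loc h \<gamma> \<alpha> \<beta> g" "\<kappa> \<in> br \<alpha>" "br \<alpha> \<subseteq> U"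
proof -
  have "\<exists>\<alpha> \<beta> g. loc h \<gamma> \<alpha> \<beta> g \<and> \<kappa> \<in> br \<alpha> \<and> br \<alpha> \<subseteq> U" using assms by (simp add: mor_def)
  then show ?thesis using that by (elim exE conjE)
qed

section \<open>Bricks as a basis of the product topology, and compactness\<close>

lemma prefix_eq_iff: "prefix (length w) x = w \<longleftrightarrow> (\<forall>i<length w. x i = w ! i)"
proof
  assume eq: "prefix (length w) x = w"
  have "prefix (length w) x ! i = x i" if "i < length w" for i using that by simp
  then show "\<forall>i<length w. x i = w ! i" unfolding eq by simp
next
  assume "\<forall>i<length w. x i = w ! i"
  then show "prefix (length w) x = w" by (intro nth_equalityI) simp_all
qed

lemma openin_prefix: "openin cantor_topology {x. prefix (length w) x = w}"
proof -
  have "{x. prefix (length w) x = w} = PiE UNIV (\<lambda>i. if i < length w then {w ! i} else UNIV)"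
  proof (rule Set.set_eqI)
    fix x
    show "x \<in> {x. prefix (length w) x = w} \<longleftrightarrow> x \<in> PiE UNIV (\<lambda>i. if i < length w then {w ! i} else UNIV)"
      by (simp add: PiE_iff prefix_eq_iff)
  qed
  moreover have "finite {i. (if i < length w then {w ! i} else UNIV) \<noteq> UNIV}"
    by (rule finite_subset[of _ "{..<length w}"]) (auto split: if_splits)
  ultimately show ?thesis
    by (simp add: cantor_topology_def openin_PiE_gen)
qed

lemma openin_br: assumes "lab \<alpha>" shows "openin (cantor_power_topology S) (br \<alpha>)"
proof -
  have "br \<alpha> = PiE S (\<lambda>s. {x. prefix (length (\<alpha> s)) x = \<alpha> s})"
    by (auto simp: brick_def cantor_power_def PiE_def)
  moreover have "finite {s \<in> S. {x. prefix (length (\<alpha> s)) x = \<alpha> s} \<noteq> UNIV}"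
    by (rule finite_subset[OF _ assms[unfolded brick_label_def]]) auto
  moreover have "topspace cantor_topology = UNIV" by (simp add: cantor_topology_def)
  ultimately show ?thesis
    by (simp add: cantor_power_topology_def openin_PiE_gen openin_prefix)
qed

lemma open_contains_prefix:
  assumes "openin cantor_topology V" "x \<in> V"
  shows "\<exists>n. {y. prefix n y = prefix n x} \<subseteq> V"
proof -
  obtain W where W: "finite {i::nat. W i \<noteq> UNIV}" "x \<in> PiE UNIV W" "PiE UNIV W \<subseteq> V"
    using assms unfolding cantor_topology_def openin_product_topology_alt by auto
  obtain n where n: "\<And>i. W i \<noteq> UNIV \<Longrightarrow> i < n"
    using W(1) finite_nat_set_iff_bounded by auto
  have "y \<in> V" if "prefix n y = prefix n x" for y
  proof -
    have "y i = x i" if "i < n" for i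
      using arg_cong[OF \<open>prefix n y = prefix n x\<close>, of "\<lambda>w. w ! i"] that by simp
    then have "y \<in> PiE UNIV W" using W(2) n by (fastforce simp: PiE_iff)
    then show ?thesis using W(3) by blast
  qed
  then show ?thesis by blast
qed

lemma openin_iff_brick_open: "openin (cantor_power_topology S) U \<longleftrightarrow> U \<subseteq> C \<and> brick_open U"
proof
  assume U: "openin (cantor_power_topology S) U"
  then have "U \<subseteq> C" using openin_subset by (fastforce simp: topspace_cantor_power_topology)
  moreover have "brick_open U"
    unfolding brick_open_def
  proof
    fix \<kappa> assume \<kappa>: "\<kappa> \<in> U"
    obtain V where V: "finite {s \<in> S. V s \<noteq> UNIV}" "\<And>s. s \<in> S \<Longrightarrow> openin cantor_topology (V s)"
      "\<kappa> \<in> PiE S V" "PiE S V \<subseteq> U"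
      using U \<kappa> unfolding cantor_power_topology_def openin_product_topology_alt
      by (auto simp: cantor_topology_def)
    have "\<exists>n. {y. prefix n y = prefix n (\<kappa> s)} \<subseteq> V s" if "s \<in> S" for s
      using open_contains_prefix V(2,3) that by (auto simp: PiE_iff)
    then obtain n where n: "\<And>s. s \<in> S \<Longrightarrow> {y. prefix (n s) y = prefix (n s) (\<kappa> s)} \<subseteq> V s" by metis
    define \<alpha> where "\<alpha> s = (if V s \<noteq> UNIV then prefix (n s) (\<kappa> s) else [])" for s
    have "lab \<alpha>" unfolding brick_label_def
      by (rule finite_subset[OF _ V(1)]) (auto simp: \<alpha>_def)
    moreover have "\<kappa> \<in> br \<alpha>" using \<kappa> \<open>U \<subseteq> C\<close> by (auto simp: brick_def \<alpha>_def)
    moreover have "br \<alpha> \<subseteq> PiE S V"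
    proof
      fix \<kappa>' assume \<kappa>': "\<kappa>' \<in> br \<alpha>"
      have "\<kappa>' s \<in> V s" if "s \<in> S" for s
      proof (cases "V s = UNIV")
        case False
        have "prefix (length (\<alpha> s)) (\<kappa>' s) = \<alpha> s" using \<kappa>' that by (simp add: brick_def)
        then show ?thesis using n[OF that] False by (auto simp: \<alpha>_def)
      qed simp
      then show "\<kappa>' \<in> PiE S V" using \<kappa>' by (auto simp: brick_def cantor_power_def PiE_iff)
    qed
    ultimately show "\<exists>\<alpha>. lab \<alpha> \<and> \<kappa> \<in> br \<alpha> \<and> br \<alpha> \<subseteq> U" using V(4) by blast
  qed
  ultimately show "U \<subseteq> C \<and> brick_open U" by blast
next
  assume U: "U \<subseteq> C \<and> brick_open U"
  show "openin (cantor_power_topology S) U"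
    unfolding openin_subopen[of _ U] using U openin_br unfolding brick_open_def by meson
qed

lemma compact_cantor_power: "compact_space (cantor_power_topology S)"
  by (simp add: cantor_power_topology_def cantor_topology_def compact_space_product_topology
      compact_space_discrete_topology)

text \<open>
  Finitely many bricks covering C^S are refined by the grid of all bricks that fix N letters in
  each coordinate of a large finite set T.
\<close>

lemma refine:
  assumes cover: "\<And>\<kappa>. \<kappa> \<in> C \<Longrightarrow> \<exists>\<alpha>. lab \<alpha> \<and> \<kappa> \<in> br \<alpha> \<and> Pr \<alpha>"
    and ext: "\<And>\<alpha> \<nu> \<alpha>'. Pr \<alpha> \<Longrightarrow> lab \<nu> \<Longrightarrow> lab \<alpha>' \<Longrightarrow> bm \<alpha>' = bm (label_append \<alpha> \<nu>) \<Longrightarrow> Pr \<alpha>'"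
  obtains n \<psi> where "brick_partition S n \<psi>" "\<And>i. i < n \<Longrightarrow> Pr (\<psi> i)"
proof -
  define \<U> where "\<U> = br ` {\<alpha>. lab \<alpha> \<and> Pr \<alpha>}"
  have "\<forall>U\<in>\<U>. openin (cantor_power_topology S) U" by (auto simp: \<U>_def openin_br)
  moreover have "topspace (cantor_power_topology S) \<subseteq> \<Union>\<U>"
    using cover by (fastforce simp: \<U>_def topspace_cantor_power_topology)
  ultimately obtain \<F> where \<F>: "finite \<F>" "\<F> \<subseteq> \<U>" "C \<subseteq> \<Union>\<F>"
    using compact_cantor_power unfolding compact_space_alt topspace_cantor_power_topology by meson
  then obtain A where A: "A \<subseteq> {\<alpha>. lab \<alpha> \<and> Pr \<alpha>}" "finite A" "\<F> = br ` A"
    unfolding \<U>_def using finite_subset_image by meson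
  define T where "T = (\<Union>\<alpha>\<in>A. {s \<in> S. \<alpha> s \<noteq> []})"
  have T: "finite T" "T \<subseteq> S" using A by (auto simp: T_def brick_label_def)
  define N where "N = Max (insert 0 ((\<lambda>(\<alpha>, s). length (\<alpha> s)) ` (A \<times> T)))"
  have N: "length (\<alpha> s) \<le> N" if "\<alpha> \<in> A" "s \<in> T" for \<alpha> s
    unfolding N_def using A(2) T(1) that by (intro Max_ge) (auto intro!: image_eqI[of _ _ "(\<alpha>, s)"])
  define gr where "gr w = (\<lambda>s. if s \<in> T then w s else [])" for w :: "'s \<Rightarrow> bool list"
  define \<Psi> where "\<Psi> = gr ` (PiE T (\<lambda>_. {l. length l = N}))"
  have "finite {l :: bool list. length l = N}"
    using finite_lists_length_eq[of "UNIV :: bool set" N] by simp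
  then have "finite \<Psi>" unfolding \<Psi>_def using T(1) by (intro finite_imageI finite_PiE) auto
  then obtain \<psi> where \<psi>: "bij_betw \<psi> {0..<card \<Psi>} \<Psi>" using ex_bij_betw_nat_finite by blast
  have \<psi>_in: "\<psi> i \<in> \<Psi>" if "i < card \<Psi>" for i using \<psi> that by (auto simp: bij_betw_def)
  have \<Psi>D: "\<alpha> s = []" if "\<alpha> \<in> \<Psi>" "s \<notin> T" for \<alpha> s using that by (auto simp: \<Psi>_def gr_def)
  have \<Psi>_len: "length (\<alpha> s) = N" if "\<alpha> \<in> \<Psi>" "s \<in> T" for \<alpha> s using that by (auto simp: \<Psi>_def gr_def)
  have \<Psi>_lab: "lab \<alpha>" if "\<alpha> \<in> \<Psi>" for \<alpha>
    unfolding brick_label_def by (rule finite_subset[OF _ T(1)]) (use \<Psi>D[OF that] in auto)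
  have cover_\<Psi>: "\<exists>\<alpha>\<in>\<Psi>. \<kappa> \<in> br \<alpha>" if "\<kappa> \<in> C" for \<kappa>
  proof (rule bexI[of _ "gr (\<lambda>s\<in>T. prefix N (\<kappa> s))"])
    show "gr (\<lambda>s\<in>T. prefix N (\<kappa> s)) \<in> \<Psi>" unfolding \<Psi>_def by (rule imageI) auto
    show "\<kappa> \<in> br (gr (\<lambda>s\<in>T. prefix N (\<kappa> s)))" using that by (auto simp: brick_def gr_def)
  qed
  have "brick_partition S (card \<Psi>) \<psi>"
    unfolding brick_partition_def
  proof (intro conjI allI impI)
    show "lab (\<psi> i)" if "i < card \<Psi>" for i using \<Psi>_lab \<psi>_in that by blast
    show "disjoint_family_on (\<lambda>i. br (\<psi> i)) {..<card \<Psi>}"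
      unfolding disjoint_family_on_def
    proof (intro ballI impI, rule ccontr)
      fix i j assume ij: "i \<in> {..<card \<Psi>}" "j \<in> {..<card \<Psi>}" "i \<noteq> j" and "br (\<psi> i) \<inter> br (\<psi> j) \<noteq> {}"
      then obtain \<kappa> where \<kappa>: "\<kappa> \<in> br (\<psi> i)" "\<kappa> \<in> br (\<psi> j)" by blast
      have "\<psi> i s = \<psi> j s" for s
      proof (cases "s \<in> T")
        case True
        then have "s \<in> S" "length (\<psi> i s) = N" "length (\<psi> j s) = N" using T(2) \<Psi>_len \<psi>_in ij by auto
        then show ?thesis using \<kappa> by (auto simp: brick_def)
      next
        case False
        then show ?thesis using \<Psi>D[OF \<psi>_in] ij by simp
      qed
      then have "\<psi> i = \<psi> j" by blast
      moreover have "inj_on \<psi> {0..<card \<Psi>}" using \<psi> by (simp add: bij_betw_def)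
      ultimately show False using ij by (metis atLeast0LessThan inj_onD)
    qed
    have "\<psi> ` {..<card \<Psi>} = \<Psi>" using \<psi> by (simp add: bij_betw_def lessThan_atLeast0)
    then have "(\<Union>i<card \<Psi>. br (\<psi> i)) = (\<Union>\<alpha>\<in>\<Psi>. br \<alpha>)" by (metis image_image)
    also have "\<dots> = C" using cover_\<Psi> br_sub by blast
    finally show "(\<Union>i<card \<Psi>. br (\<psi> i)) = C" .
  qed
  moreover have "Pr (\<psi> i)" if "i < card \<Psi>" for i
  proof -
    note \<psi>i = \<psi>_in[OF that]
    \<comment> \<open>A sample point of the grid brick. The grid reads N letters at every coordinate
      of T, so the grid label extends the label of any brick of the finite cover through this point,
      and the whole grid brick lies in that brick.\<close>
    define \<kappa> where "\<kappa> = bm (\<psi> i) (\<lambda>s\<in>S. undefined)"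
    have \<kappa>: "\<kappa> \<in> br (\<psi> i)" "\<kappa> \<in> C" unfolding br_eq \<kappa>_def by auto
    then obtain \<alpha> where \<alpha>: "\<alpha> \<in> A" "\<kappa> \<in> br \<alpha>" using \<F>(3) A(3) by blast
    define \<nu> where "\<nu> s = drop (length (\<alpha> s)) (\<psi> i s)" for s
    have "\<psi> i s = label_append \<alpha> \<nu> s" if s: "s \<in> S" for s
    proof (cases "s \<in> T")
      case True
      have "prefix N (\<kappa> s) = \<psi> i s"
        using \<kappa>(1) \<Psi>_len[OF \<psi>i True] s by (auto simp: brick_def)
      then have "take (length (\<alpha> s)) (\<psi> i s) = take (length (\<alpha> s)) (prefix N (\<kappa> s))" by (simp only:)
      also have "\<dots> = prefix (length (\<alpha> s)) (\<kappa> s)"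
        using N[OF \<alpha>(1) True] by (simp add: min_absorb2)
      also have "\<dots> = \<alpha> s" using \<alpha>(2) s by (auto simp: brick_def)
      finally show ?thesis unfolding label_append_def \<nu>_def by (metis append_take_drop_id)
    next
      case False
      then have "\<alpha> s = []" using \<alpha>(1) s by (auto simp: T_def)
      then show ?thesis by (simp add: label_append_def \<nu>_def)
    qed
    then have "bm (\<psi> i) = bm (label_append \<alpha> \<nu>)" by (rule bm_cong)
    moreover have "lab \<nu>" unfolding brick_label_def
    proof (rule finite_subset[OF _ T(1)])
      show "{s \<in> S. \<nu> s \<noteq> []} \<subseteq> T"
        using \<Psi>D[OF \<psi>i] by (metis (mono_tags, lifting) \<nu>_def drop_Nil mem_Collect_eq subsetI)
    qed
    ultimately show ?thesis using ext[of \<alpha> \<nu> "\<psi> i"] \<alpha>(1) A(1) \<Psi>_lab[OF \<psi>i] by blast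
  qed
  ultimately show ?thesis using that by blast
qed

lemma C_nonempty: "C \<noteq> {}"
  using restrict_in_C by blast

section \<open>Isomorphism of non-empty clopen sets\<close>

lemma halves:
  obtains \<alpha> \<beta> where "lab \<alpha>" "lab \<beta>" "br \<alpha> \<inter> br \<beta> = {}" "br \<alpha> \<union> br \<beta> = C"
proof -
  obtain s where s: "s \<in> S" using S_nonempty by blast
  define \<alpha> where "\<alpha> b = (\<lambda>t. if t = s then [b] else [])" for b :: bool
  have in_br: "\<kappa> \<in> br (\<alpha> b) \<longleftrightarrow> \<kappa> \<in> C \<and> \<kappa> s 0 = b" for \<kappa> b
    using s by (auto simp: brick_def \<alpha>_def)
  have lab: "lab (\<alpha> b)" for b
    unfolding brick_label_def by (rule finite_subset[of _ "{s}"]) (auto simp: \<alpha>_def)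
  show ?thesis by (rule that[of "\<alpha> False" "\<alpha> True"]) (use lab in \<open>auto simp: in_br\<close>)
qed

text \<open>Split C^S into two halves, send one to the new brick and the other to the union of the
  rest. As C^S is isomorphic to two copies of itself, the number of bricks is no invariant.\<close>

lemma mor_disjoint_bricks:
  assumes "finite A" "A \<noteq> {}" "\<And>\<alpha>. \<alpha> \<in> A \<Longrightarrow> lab \<alpha>"
    "\<And>\<alpha> \<beta>. \<alpha> \<in> A \<Longrightarrow> \<beta> \<in> A \<Longrightarrow> \<alpha> \<noteq> \<beta> \<Longrightarrow> br \<alpha> \<inter> br \<beta> = {}"
  shows "\<exists>h \<gamma>. mor C (\<Union>\<alpha>\<in>A. br \<alpha>) h \<gamma>"
  using assms
proof (induction A rule: finite_ne_induct)
  case (singleton \<alpha>)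
  then show ?case using mor_brick[of \<alpha>] by auto
next
  case (insert \<alpha> A)
  then obtain h \<gamma> where h: "mor C (\<Union>\<alpha>\<in>A. br \<alpha>) h \<gamma>" by fast
  obtain \<alpha>0 \<alpha>1 where l: "lab \<alpha>0" "lab \<alpha>1" "br \<alpha>0 \<inter> br \<alpha>1 = {}" "br \<alpha>0 \<union> br \<alpha>1 = C" by (rule halves)
  have \<alpha>: "mor C (br \<alpha>) (bm \<alpha>) (\<lambda>_. \<one>)" using insert.prems by (intro mor_brick) simp
  have disj: "br \<alpha> \<inter> (\<Union>\<alpha>\<in>A. br \<alpha>) = {}"
    using insert.prems(2)[of \<alpha>] insert.hyps(3) by blast
  from mor_glue[OF mor_comp[OF mor_inv[OF mor_brick[OF l(1)]] \<alpha>] mor_comp[OF mor_inv[OF mor_brick[OF l(2)]] h] l(3) disj]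
  show ?case unfolding l(4) by auto
qed

text \<open>By compactness C^S is partitioned into finitely many bricks, each inside U or inside its
  complement; those inside U are disjoint with union U.\<close>

lemma mor_C_exists:
  assumes "clopen U" "U \<noteq> {}"
  shows "\<exists>h \<gamma>. mor C U h \<gamma>"
proof -
  obtain n \<psi> where \<psi>: "brick_partition S n \<psi>" "\<And>i. i < n \<Longrightarrow> br (\<psi> i) \<subseteq> U \<or> br (\<psi> i) \<subseteq> C - U"
  proof (rule refine[where Pr = "\<lambda>\<alpha>. br \<alpha> \<subseteq> U \<or> br \<alpha> \<subseteq> C - U"])
    fix \<kappa> assume "\<kappa> \<in> C"
    then show "\<exists>\<alpha>. lab \<alpha> \<and> \<kappa> \<in> br \<alpha> \<and> (br \<alpha> \<subseteq> U \<or> br \<alpha> \<subseteq> C - U)"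
      using assms(1) unfolding clopen_def brick_open_def by (metis Diff_iff)
  next
    fix \<alpha> \<nu> \<alpha>' assume "br \<alpha> \<subseteq> U \<or> br \<alpha> \<subseteq> C - U" "bm \<alpha>' = bm (label_append \<alpha> \<nu>)"
    moreover from this have "br \<alpha>' \<subseteq> br \<alpha>" using br_label_append by (simp add: br_eq)
    ultimately show "br \<alpha>' \<subseteq> U \<or> br \<alpha>' \<subseteq> C - U" by blast
  qed (rule that)
  define A where "A = \<psi> ` {i. i < n \<and> br (\<psi> i) \<subseteq> U}"
  have U: "U \<subseteq> C" using assms(1) by (simp add: clopen_def)
  have "(\<Union>i<n. br (\<psi> i)) = C" using \<psi>(1) by (simp add: brick_partition_def)
  then have A_U: "(\<Union>\<alpha>\<in>A. br \<alpha>) = U"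
    using \<psi>(2) U unfolding A_def by (auto simp: set_eq_iff) blast
  have "br \<alpha> \<inter> br \<beta> = {}" if "\<alpha> \<in> A" "\<beta> \<in> A" "\<alpha> \<noteq> \<beta>" for \<alpha> \<beta>
  proof -
    obtain i j where "i < n" "\<alpha> = \<psi> i" "j < n" "\<beta> = \<psi> j" using \<open>\<alpha> \<in> A\<close> \<open>\<beta> \<in> A\<close> unfolding A_def by blast
    moreover have "i \<noteq> j" using calculation \<open>\<alpha> \<noteq> \<beta>\<close> by blast
    ultimately show ?thesis using \<psi>(1) by (simp add: brick_partition_def disjoint_family_on_def)
  qed
  moreover have "lab \<alpha>" if "\<alpha> \<in> A" for \<alpha>
    using that \<psi>(1) unfolding A_def brick_partition_def by auto
  moreover have "finite A" "A \<noteq> {}" using A_U assms(2) by (auto simp: A_def)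
  ultimately show ?thesis using mor_disjoint_bricks[of A] A_U by auto
qed

lemma mor_exists:
  assumes "clopen U" "U \<noteq> {}" "clopen V" "V \<noteq> {}"
  shows "\<exists>h \<gamma>. mor U V h \<gamma>"
  using mor_C_exists[OF assms(1,2)] mor_C_exists[OF assms(3,4)] mor_comp mor_inv by meson

text \<open>Compactness makes the local and the global description agree: \<open>refine\<close>
  gives a finite source partition, its image is the target partition, and h is a homeomorphism
  because it and its inverse carry brick-open sets to brick-open sets.\<close>

lemma elements_iff:
  "(h, \<gamma>) \<in> twisted_BT_elements G S \<phi> \<longleftrightarrow> h \<in> extensional C \<and> \<gamma> \<in> extensional C \<and> mor C C h \<gamma>"
proof
  assume "(h, \<gamma>) \<in> twisted_BT_elements G S \<phi>"
  then obtain n \<alpha> \<beta> g where *: "h \<in> extensional C"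
    "homeomorphic_map (cantor_power_topology S) (cantor_power_topology S) h" "\<gamma> \<in> C \<rightarrow>\<^sub>E carrier G"
    "brick_partition S n \<alpha>" "brick_partition S n \<beta>"
    "\<And>i. i < n \<Longrightarrow> g i \<in> carrier G"
    "\<And>i \<kappa>. i < n \<Longrightarrow> \<kappa> \<in> C \<Longrightarrow> h (bm (\<alpha> i) \<kappa>) = bm (\<beta> i) (sh (g i) \<kappa>)"
    "\<And>i \<kappa>. i < n \<Longrightarrow> \<kappa> \<in> br (\<alpha> i) \<Longrightarrow> \<gamma> \<kappa> = g i"
    unfolding twisted_BT_elements_def by blast
  have "mor C C h \<gamma>"
    unfolding mor_def
  proof (intro conjI ballI)
    show "bij_betw h C C"
      using *(2) by (simp add: homeomorphic_eq_everything_map topspace_cantor_power_topology bij_betw_def)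
    fix \<kappa> assume "\<kappa> \<in> C"
    then obtain i where i: "i < n" "\<kappa> \<in> br (\<alpha> i)" using *(4) unfolding brick_partition_def by blast
    have "loc h \<gamma> (\<alpha> i) (\<beta> i) (g i)"
      using * i(1) by (auto simp: loc_def brick_partition_def br_eq)
    then show "\<exists>\<alpha> \<beta> g. loc h \<gamma> \<alpha> \<beta> g \<and> \<kappa> \<in> br \<alpha> \<and> br \<alpha> \<subseteq> C" using i(2) br_sub by blast
  qed simp
  then show "h \<in> extensional C \<and> \<gamma> \<in> extensional C \<and> mor C C h \<gamma>" using * by (auto simp: PiE_iff)
next
  assume a: "h \<in> extensional C \<and> \<gamma> \<in> extensional C \<and> mor C C h \<gamma>"
  then have m: "mor C C h \<gamma>" by blast
  then have bij: "bij_betw h C C" by (simp add: mor_def)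
  obtain n \<alpha> where \<alpha>: "brick_partition S n \<alpha>" "\<And>i. i < n \<Longrightarrow> \<exists>\<beta> g. loc h \<gamma> (\<alpha> i) \<beta> g"
  proof (rule refine[where Pr = "\<lambda>\<alpha>. \<exists>\<beta> g. loc h \<gamma> \<alpha> \<beta> g"])
    fix \<kappa> assume "\<kappa> \<in> C"
    then show "\<exists>\<alpha>. lab \<alpha> \<and> \<kappa> \<in> br \<alpha> \<and> (\<exists>\<beta> g. loc h \<gamma> \<alpha> \<beta> g)"
      using m unfolding mor_def loc_def by meson
  next
    fix \<alpha> \<nu> \<alpha>' assume "\<exists>\<beta> g. loc h \<gamma> \<alpha> \<beta> g" and \<nu>: "lab \<nu>" "lab \<alpha>'" "bm \<alpha>' = bm (label_append \<alpha> \<nu>)"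
    then obtain \<beta> g where "loc h \<gamma> \<alpha> \<beta> g" by blast
    from loc_refine[OF this \<nu>(1)] show "\<exists>\<beta> g. loc h \<gamma> \<alpha>' \<beta> g"
      using \<nu> unfolding loc_def by auto
  qed (rule that)
  then obtain \<beta> g where l: "\<And>i. i < n \<Longrightarrow> loc h \<gamma> (\<alpha> i) (\<beta> i) (g i)" by metis
  have im: "h ` br (\<alpha> i) = br (\<beta> i)" if "i < n" for i using loc_image[OF l[OF that]] .
  have \<beta>: "brick_partition S n \<beta>"
    unfolding brick_partition_def
  proof (intro conjI allI impI)
    show "lab (\<beta> i)" if "i < n" for i using l[OF that] by (simp add: loc_def)
    show "disjoint_family_on (\<lambda>i. br (\<beta> i)) {..<n}"
      unfolding disjoint_family_on_def
    proof (intro ballI impI)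
      fix i j assume ij: "i \<in> {..<n}" "j \<in> {..<n}" "i \<noteq> j"
      have "h ` br (\<alpha> i) \<inter> h ` br (\<alpha> j) = h ` (br (\<alpha> i) \<inter> br (\<alpha> j))"
        using bij br_sub by (intro inj_on_image_Int[symmetric]) (auto simp: bij_betw_def)
      also have "br (\<alpha> i) \<inter> br (\<alpha> j) = {}"
        using \<alpha>(1) ij by (auto simp: brick_partition_def disjoint_family_on_def)
      finally show "br (\<beta> i) \<inter> br (\<beta> j) = {}" using im ij by simp
    qed
    have "(\<Union>i<n. br (\<beta> i)) = h ` (\<Union>i<n. br (\<alpha> i))" using im by (auto simp: image_UN)
    also have "\<dots> = C" using \<alpha>(1) bij by (simp add: brick_partition_def bij_betw_def)
    finally show "(\<Union>i<n. br (\<beta> i)) = C" .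
  qed
  have homeo: "homeomorphic_map (cantor_power_topology S) (cantor_power_topology S) h"
  proof (rule bijective_open_imp_homeomorphic_map)
    show "open_map (cantor_power_topology S) (cantor_power_topology S) h"
      unfolding open_map_def openin_iff_brick_open using mor_brick_open[OF mor_restrict[OF m]] by blast
    show "continuous_map (cantor_power_topology S) (cantor_power_topology S) h"
      unfolding continuous_map_def topspace_cantor_power_topology
    proof (intro conjI allI impI)
      show "h \<in> C \<rightarrow> C" using bij by (auto simp: bij_betw_def)
      fix U assume U: "openin (cantor_power_topology S) U"
      then have UC: "U \<subseteq> C" "brick_open U" by (auto simp: openin_iff_brick_open)
      have "{x \<in> C. h x \<in> U} = inv_into C h ` U"
      proof (intro equalityI subsetI)
        fix x assume "x \<in> {x \<in> C. h x \<in> U}"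
        then show "x \<in> inv_into C h ` U" using bij by (auto simp: bij_betw_def intro!: image_eqI[of _ _ "h x"])
      next
        fix x assume "x \<in> inv_into C h ` U"
        then obtain u where u: "u \<in> U" "x = inv_into C h u" by blast
        then have "u \<in> h ` C" using UC bij by (auto simp: bij_betw_def)
        then show "x \<in> {x \<in> C. h x \<in> U}" using u by (simp add: inv_into_into f_inv_into_f)
      qed
      then show "openin (cantor_power_topology S) {x \<in> C. h x \<in> U}"
        unfolding openin_iff_brick_open using mor_brick_open[OF mor_restrict[OF mor_inv[OF m] UC]] by simp
    qed
  qed (use bij in \<open>auto simp: topspace_cantor_power_topology bij_betw_def\<close>)
  have \<gamma>: "\<gamma> \<in> C \<rightarrow>\<^sub>E carrier G"
  proof -
    have "\<gamma> \<kappa> \<in> carrier G" if \<kappa>: "\<kappa> \<in> C" for \<kappa>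
    proof -
      obtain \<alpha> \<beta> g where *: "loc h \<gamma> \<alpha> \<beta> g" "\<kappa> \<in> br \<alpha>" using m \<kappa> by (rule morE)
      then obtain \<kappa>' where "\<kappa>' \<in> C" "\<kappa> = bm \<alpha> \<kappa>'" by (auto simp: br_eq)
      then show ?thesis using *(1) by (simp add: loc_def)
    qed
    then show ?thesis using a by (auto simp: PiE_iff)
  qed
  have forms: "\<forall>i<n. g i \<in> carrier G \<and>
      (\<forall>\<kappa>\<in>C. h (bm (\<alpha> i) \<kappa>) = bm (\<beta> i) (sh (g i) \<kappa>)) \<and> (\<forall>\<kappa>\<in>br (\<alpha> i). \<gamma> \<kappa> = g i)"
    using l by (auto simp: loc_def br_eq)
  show "(h, \<gamma>) \<in> twisted_BT_elements G S \<phi>"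
    unfolding twisted_BT_elements_def mem_Collect_eq case_prod_conv
    using a by (intro conjI homeo \<gamma> exI[of _ n] exI[of _ \<alpha>] exI[of _ \<beta>] exI[of _ g] \<alpha>(1) \<beta> forms) simp
qed

section \<open>The group law on pairs\<close>

abbreviation "\<Gamma> \<equiv> abstract_twisted_BT G S \<phi>"
abbreviation mult_\<Gamma> (infixl "\<odot>" 70) where "x \<odot> y \<equiv> x \<otimes>\<^bsub>\<Gamma>\<^esub> y"

lemma carrier_\<Gamma>: "x \<in> carrier \<Gamma> \<longleftrightarrow> fst x \<in> extensional C \<and> snd x \<in> extensional C \<and> mor C C (fst x) (snd x)"
  using elements_iff[of "fst x" "snd x"] by (simp add: abstract_twisted_BT_def)

lemma carrier_mor: "x \<in> carrier \<Gamma> \<Longrightarrow> mor C C (fst x) (snd x)"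
  by (simp add: carrier_\<Gamma>)

lemma elementE:
  assumes "mor C C h \<gamma>"
  obtains x where "x \<in> carrier \<Gamma>" "\<And>\<kappa>. \<kappa> \<in> C \<Longrightarrow> fst x \<kappa> = h \<kappa>" "\<And>\<kappa>. \<kappa> \<in> C \<Longrightarrow> snd x \<kappa> = \<gamma> \<kappa>"
proof (rule that[of "(restrict h C, restrict \<gamma> C)"])
  show "(restrict h C, restrict \<gamma> C) \<in> carrier \<Gamma>"
    unfolding carrier_\<Gamma> using mor_cong[OF assms] by auto
qed auto

lemma fst_mult: "\<kappa> \<in> C \<Longrightarrow> fst (x \<odot> y) \<kappa> = fst x (fst y \<kappa>)"
  by (simp add: abstract_twisted_BT_def case_prod_unfold compose_def)

lemma snd_mult: "\<kappa> \<in> C \<Longrightarrow> snd (x \<odot> y) \<kappa> = snd x (fst y \<kappa>) \<otimes> snd y \<kappa>"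
  by (simp add: abstract_twisted_BT_def case_prod_unfold)

lemma fst_one: "\<kappa> \<in> C \<Longrightarrow> fst \<one>\<^bsub>\<Gamma>\<^esub> \<kappa> = \<kappa>"
  and snd_one: "\<kappa> \<in> C \<Longrightarrow> snd \<one>\<^bsub>\<Gamma>\<^esub> \<kappa> = \<one>"
  by (simp_all add: abstract_twisted_BT_def)

lemma mor_label: "mor U V h \<gamma> \<Longrightarrow> \<kappa> \<in> U \<Longrightarrow> \<gamma> \<kappa> \<in> carrier G"
  by (erule (1) morE) (auto simp: loc_def br_eq)

lemma fst_in: "x \<in> carrier \<Gamma> \<Longrightarrow> \<kappa> \<in> C \<Longrightarrow> fst x \<kappa> \<in> C"
  and snd_in: "x \<in> carrier \<Gamma> \<Longrightarrow> \<kappa> \<in> C \<Longrightarrow> snd x \<kappa> \<in> carrier G"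
  using carrier_mor[of x] mor_label by (auto simp: mor_def bij_betw_def)

lemma \<Gamma>_eqI:
  assumes "x \<in> carrier \<Gamma>" "y \<in> carrier \<Gamma>"
    "\<And>\<kappa>. \<kappa> \<in> C \<Longrightarrow> fst x \<kappa> = fst y \<kappa>" "\<And>\<kappa>. \<kappa> \<in> C \<Longrightarrow> snd x \<kappa> = snd y \<kappa>"
  shows "x = y"
proof (rule prod_eqI)
  show "fst x = fst y" by (rule extensionalityI[of _ C]) (use assms in \<open>auto simp: carrier_\<Gamma>\<close>)
  show "snd x = snd y" by (rule extensionalityI[of _ C]) (use assms in \<open>auto simp: carrier_\<Gamma>\<close>)
qed

lemma group_\<Gamma>: "group \<Gamma>"
proof -
  have closed: "x \<odot> y \<in> carrier \<Gamma>" if x: "x \<in> carrier \<Gamma>" and y: "y \<in> carrier \<Gamma>" for x y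
    unfolding carrier_\<Gamma>
  proof (intro conjI)
    show "mor C C (fst (x \<odot> y)) (snd (x \<odot> y))"
      by (rule mor_cong[OF mor_comp[OF carrier_mor[OF y] carrier_mor[OF x]]]) (simp_all add: fst_mult snd_mult)
  qed (simp_all add: abstract_twisted_BT_def case_prod_unfold compose_def)
  have one: "\<one>\<^bsub>\<Gamma>\<^esub> \<in> carrier \<Gamma>"
    unfolding carrier_\<Gamma>
  proof (intro conjI)
    show "mor C C (fst \<one>\<^bsub>\<Gamma>\<^esub>) (snd \<one>\<^bsub>\<Gamma>\<^esub>)"
      by (rule mor_cong[OF mor_id[OF _ brick_open_C]]) (simp_all add: fst_one snd_one)
  qed (simp_all add: abstract_twisted_BT_def)
  show ?thesis
  proof (rule groupI)
    fix x y z assume xyz: "x \<in> carrier \<Gamma>" "y \<in> carrier \<Gamma>" "z \<in> carrier \<Gamma>"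
    show "x \<odot> y \<odot> z = x \<odot> (y \<odot> z)"
      by (rule \<Gamma>_eqI) (use xyz closed in \<open>simp_all add: fst_mult snd_mult fst_in snd_in m_assoc\<close>)
  next
    fix x assume x: "x \<in> carrier \<Gamma>"
    show "\<one>\<^bsub>\<Gamma>\<^esub> \<odot> x = x"
      by (rule \<Gamma>_eqI) (use x one closed in \<open>simp_all add: fst_mult snd_mult fst_in snd_in fst_one snd_one\<close>)
    obtain y where y: "y \<in> carrier \<Gamma>" "\<And>\<kappa>. \<kappa> \<in> C \<Longrightarrow> fst y \<kappa> = inv_into C (fst x) \<kappa>"
      "\<And>\<kappa>. \<kappa> \<in> C \<Longrightarrow> snd y \<kappa> = inv (snd x (inv_into C (fst x) \<kappa>))"
      by (rule elementE[OF mor_inv[OF carrier_mor[OF x]]]) (rule that)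
    have "inj_on (fst x) C" using carrier_mor[OF x] by (simp add: mor_def bij_betw_def)
    then have "y \<odot> x = \<one>\<^bsub>\<Gamma>\<^esub>"
      by (intro \<Gamma>_eqI) (use x y one closed in \<open>simp_all add: fst_mult snd_mult fst_in snd_in fst_one snd_one\<close>)
    then show "\<exists>y\<in>carrier \<Gamma>. y \<odot> x = \<one>\<^bsub>\<Gamma>\<^esub>" using y(1) by blast
  qed (use closed one in auto)
qed

sublocale \<Gamma>: group \<Gamma> by (rule group_\<Gamma>)

lemma fst_bij: "x \<in> carrier \<Gamma> \<Longrightarrow> bij_betw (fst x) C C"
  using carrier_mor by (simp add: mor_def)

lemma fst_inj: "x \<in> carrier \<Gamma> \<Longrightarrow> \<kappa> \<in> C \<Longrightarrow> \<kappa>' \<in> C \<Longrightarrow> fst x \<kappa> = fst x \<kappa>' \<longleftrightarrow> \<kappa> = \<kappa>'"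
  using fst_bij[of x] by (auto simp: bij_betw_def inj_on_def)

lemma fst_inv: "x \<in> carrier \<Gamma> \<Longrightarrow> \<kappa> \<in> C \<Longrightarrow> fst (inv\<^bsub>\<Gamma>\<^esub> x) (fst x \<kappa>) = \<kappa>"
  by (metis \<Gamma>.l_inv fst_mult fst_one)

lemma fst_inv': "x \<in> carrier \<Gamma> \<Longrightarrow> \<kappa> \<in> C \<Longrightarrow> fst x (fst (inv\<^bsub>\<Gamma>\<^esub> x) \<kappa>) = \<kappa>"
  by (metis \<Gamma>.r_inv fst_mult fst_one)

lemma clopen_fst_image: "x \<in> carrier \<Gamma> \<Longrightarrow> clopen U \<Longrightarrow> clopen (fst x ` U)"
  using clopen_image carrier_mor by blast

text \<open>Proper clopen sets have non-empty clopen complements, and these are isomorphic. So an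
  isomorphism between two proper clopen sets is always induced by an element of the group.\<close>

lemma extend:
  assumes m: "mor U V h \<gamma>" and UV: "clopen U" "clopen V" "U \<noteq> C" "V \<noteq> C"
  obtains x where "x \<in> carrier \<Gamma>" "\<And>\<kappa>. \<kappa> \<in> U \<Longrightarrow> fst x \<kappa> = h \<kappa>" "\<And>\<kappa>. \<kappa> \<in> U \<Longrightarrow> snd x \<kappa> = \<gamma> \<kappa>"
proof -
  have sub: "U \<subseteq> C" "V \<subseteq> C" using UV by (auto simp: clopen_def)
  obtain h' \<gamma>' where m': "mor (C - U) (C - V) h' \<gamma>'"
    using mor_exists[OF clopen_compl[OF UV(1)] _ clopen_compl[OF UV(2)]] UV(3,4) sub by blast
  have "mor C C (\<lambda>\<kappa>. if \<kappa> \<in> U then h \<kappa> else h' \<kappa>) (\<lambda>\<kappa>. if \<kappa> \<in> U then \<gamma> \<kappa> else \<gamma>' \<kappa>)"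
    using mor_glue[OF m m'] sub by (simp add: Un_absorb1)
  then show ?thesis using sub by (elim elementE) (auto intro!: that)
qed

text \<open>The label must be trivial on N as well. Elements of G acting trivially on S would
  otherwise be invisible, and elements with disjoint supports need not commute.\<close>

definition fixing :: "('s \<Rightarrow> nat \<Rightarrow> bool) set \<Rightarrow> _ set" where
  "fixing N = {x \<in> carrier \<Gamma>. \<forall>\<kappa>\<in>N. fst x \<kappa> = \<kappa> \<and> snd x \<kappa> = \<one>}"

lemma fixingD:
  "x \<in> fixing N \<Longrightarrow> x \<in> carrier \<Gamma>"
  "x \<in> fixing N \<Longrightarrow> \<kappa> \<in> N \<Longrightarrow> fst x \<kappa> = \<kappa>"
  "x \<in> fixing N \<Longrightarrow> \<kappa> \<in> N \<Longrightarrow> snd x \<kappa> = \<one>"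
  by (auto simp: fixing_def)

lemma fixing_mult: "x \<in> fixing N \<Longrightarrow> y \<in> fixing N \<Longrightarrow> N \<subseteq> C \<Longrightarrow> x \<odot> y \<in> fixing N"
  by (auto simp: fixing_def fst_mult snd_mult subset_iff)

lemma fixing_mono: "N' \<subseteq> N \<Longrightarrow> fixing N \<subseteq> fixing N'"
  by (auto simp: fixing_def)

lemma fixing_image:
  assumes "x \<in> fixing (C - U)" "\<kappa> \<in> U" "U \<subseteq> C"
  shows "fst x \<kappa> \<in> U"
proof (rule ccontr)
  assume a: "fst x \<kappa> \<notin> U"
  have \<kappa>: "\<kappa> \<in> C" "x \<in> carrier \<Gamma>" using assms fixingD by auto
  then have "fst x \<kappa> \<in> C - U" using a fst_in by auto
  then have "fst x (fst x \<kappa>) = fst x \<kappa>" using fixingD(2)[OF assms(1)] by blast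
  then have "fst x \<kappa> = \<kappa>" using fst_inj \<kappa> fst_in by metis
  then show False using a assms(2) by simp
qed

lemma fixing_commute:
  assumes x: "x \<in> fixing (C - U)" and y: "y \<in> fixing (C - V)" and UV: "U \<inter> V = {}" "U \<subseteq> C" "V \<subseteq> C"
  shows "x \<odot> y = y \<odot> x"
proof (rule \<Gamma>_eqI)
  have xy: "x \<in> carrier \<Gamma>" "y \<in> carrier \<Gamma>" using x y fixingD by auto
  then show "x \<odot> y \<in> carrier \<Gamma>" "y \<odot> x \<in> carrier \<Gamma>" by auto
  fix \<kappa> assume \<kappa>: "\<kappa> \<in> C"
  have fx: "fst x \<kappa> = \<kappa> \<and> snd x \<kappa> = \<one>" if "\<kappa> \<notin> U" using fixingD[OF x] \<kappa> that by auto
  have fy: "fst y \<kappa> = \<kappa> \<and> snd y \<kappa> = \<one>" if "\<kappa> \<notin> V" using fixingD[OF y] \<kappa> that by auto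
  have "fst (x \<odot> y) \<kappa> = fst (y \<odot> x) \<kappa> \<and> snd (x \<odot> y) \<kappa> = snd (y \<odot> x) \<kappa>"
  proof (cases "\<kappa> \<in> U")
    case True
    then have "fst x \<kappa> \<in> C - V" using fixing_image[OF x True UV(2)] UV by auto
    then have "fst y (fst x \<kappa>) = fst x \<kappa>" "snd y (fst x \<kappa>) = \<one>" using fixingD[OF y] by auto
    moreover have "fst y \<kappa> = \<kappa> \<and> snd y \<kappa> = \<one>" using True UV(1) fy by blast
    ultimately show ?thesis using \<kappa> xy by (simp add: fst_mult snd_mult snd_in)
  next
    case False
    note fx = fx[OF False]
    show ?thesis
    proof (cases "\<kappa> \<in> V")
      case True
      then have "fst y \<kappa> \<in> C - U" using fixing_image[OF y True UV(3)] UV by auto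
      then have "fst x (fst y \<kappa>) = fst y \<kappa>" "snd x (fst y \<kappa>) = \<one>" using fixingD[OF x] by auto
      then show ?thesis using fx \<kappa> xy by (simp add: fst_mult snd_mult snd_in)
    next
      case False
      then show ?thesis using fx fy \<kappa> by (simp add: fst_mult snd_mult)
    qed
  qed
  then show "fst (x \<odot> y) \<kappa> = fst (y \<odot> x) \<kappa>" "snd (x \<odot> y) \<kappa> = snd (y \<odot> x) \<kappa>" by auto
qed

lemma fixing_conjugate:
  assumes x: "x \<in> fixing (C - U)" and t: "t \<in> carrier \<Gamma>" and V: "fst t ` U = V"
  shows "t \<odot> x \<odot> inv\<^bsub>\<Gamma>\<^esub> t \<in> fixing (C - V)"
proof -
  have xc: "x \<in> carrier \<Gamma>" using x by (rule fixingD)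
  define y where "y = t \<odot> x \<odot> inv\<^bsub>\<Gamma>\<^esub> t"
  \<comment> \<open>Comparing labels in this equation avoids computing the label of an
    inverse.\<close>
  have y: "y \<in> carrier \<Gamma>" "y \<odot> t = t \<odot> x" using xc t by (auto simp: y_def \<Gamma>.m_assoc)
  have "fst y \<kappa> = \<kappa> \<and> snd y \<kappa> = \<one>" if \<kappa>: "\<kappa> \<in> C - V" for \<kappa>
  proof -
    define \<kappa>' where "\<kappa>' = fst (inv\<^bsub>\<Gamma>\<^esub> t) \<kappa>"
    have \<kappa>': "\<kappa>' \<in> C" "\<kappa> = fst t \<kappa>'" using \<kappa> t by (auto simp: \<kappa>'_def fst_in fst_inv')
    then have "\<kappa>' \<in> C - U" using \<kappa> V by blast
    then have fx: "fst x \<kappa>' = \<kappa>'" "snd x \<kappa>' = \<one>" using fixingD[OF x] by auto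
    have "fst (y \<odot> t) \<kappa>' = fst (t \<odot> x) \<kappa>'" "snd (y \<odot> t) \<kappa>' = snd (t \<odot> x) \<kappa>'"
      by (simp_all add: y(2))
    then have "fst y \<kappa> = \<kappa>" "snd y \<kappa> \<otimes> snd t \<kappa>' = snd t \<kappa>'"
      using \<kappa>' fx t by (simp_all add: fst_mult snd_mult snd_in)
    moreover have "snd y \<kappa> \<in> carrier G" "snd t \<kappa>' \<in> carrier G" using snd_in y(1) t \<kappa> \<kappa>'(1) by auto
    ultimately show ?thesis by simp
  qed
  then show ?thesis using y(1) by (simp add: fixing_def y_def)
qed

text \<open>Conjugation by a morphism \<open>C \<rightarrow> C - N\<close> identifies the whole group with the fixator of N.\<close>

lemma fixing_iso:
  assumes N: "clopen N" "N \<noteq> C"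
  obtains \<rho> where "\<rho> \<in> hom \<Gamma> \<Gamma>" "inj_on \<rho> (carrier \<Gamma>)" "\<rho> ` carrier \<Gamma> = fixing N"
proof -
  define U where "U = C - N"
  have NC: "N \<subseteq> C" using N by (simp add: clopen_def)
  have U: "clopen U" "U \<noteq> {}" "U \<subseteq> C" using N NC by (auto simp: U_def clopen_compl)
  obtain k c where kc: "mor C U k c" using mor_C_exists[OF U(1,2)] by blast
  have k: "bij_betw k C U" using kc by (simp add: mor_def)
  have k_in: "k \<kappa> \<in> U" if "\<kappa> \<in> C" for \<kappa> using k that by (auto simp: bij_betw_def)
  have kC: "k \<kappa> \<in> C" if "\<kappa> \<in> C" for \<kappa> using k_in[OF that] U(3) by blast
  have k_inj: "k \<kappa> = k \<kappa>' \<longleftrightarrow> \<kappa> = \<kappa>'" if "\<kappa> \<in> C" "\<kappa>' \<in> C" for \<kappa> \<kappa>'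
    using k that by (auto simp: bij_betw_def inj_on_def)
  have k_surj: "\<exists>\<kappa>'\<in>C. \<kappa> = k \<kappa>'" if "\<kappa> \<in> U" for \<kappa>
    using k that unfolding bij_betw_def by blast
  have c: "c \<kappa> \<in> carrier G" if "\<kappa> \<in> C" for \<kappa> using mor_label[OF kc that] .
  have k_inv: "inv_into C k (k \<kappa>) = \<kappa>" if "\<kappa> \<in> C" for \<kappa>
    using k that by (simp add: bij_betw_inv_into_left)
  \<comment> \<open>\<open>R x x'\<close> is a commuting square: x' after k equals k after x, for
    maps and labels alike and without inverses. Multiplicativity then amounts to composing two
    squares.\<close>
  define R where "R x x' \<longleftrightarrow> (\<forall>\<kappa>\<in>C. fst x' (k \<kappa>) = k (fst x \<kappa>) \<and> snd x' (k \<kappa>) \<otimes> c \<kappa> = c (fst x \<kappa>) \<otimes> snd x \<kappa>)"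
    for x x'
  have R1: "\<exists>x'\<in>fixing N. R x x'" if x: "x \<in> carrier \<Gamma>" for x
  proof -
    \<comment> \<open>Conjugate x by k to act on U, then glue with the identity on N.\<close>
    note m = mor_comp[OF mor_comp[OF mor_inv[OF kc] carrier_mor[OF x]] kc]
    note glued = mor_glue[OF m mor_id[of N]]
    have "U \<union> N = C" "U \<inter> N = {}" "brick_open N" using N NC by (auto simp: U_def clopen_def)
    from glued[OF NC this(3,2,2), unfolded this(1)] obtain x' where x': "x' \<in> carrier \<Gamma>"
      "\<And>\<kappa>. \<kappa> \<in> C \<Longrightarrow> fst x' \<kappa> = (if \<kappa> \<in> U then k (fst x (inv_into C k \<kappa>)) else \<kappa>)"
      "\<And>\<kappa>. \<kappa> \<in> C \<Longrightarrow> snd x' \<kappa> = (if \<kappa> \<in> U then c (fst x (inv_into C k \<kappa>)) \<otimes>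
         (snd x (inv_into C k \<kappa>) \<otimes> inv (c (inv_into C k \<kappa>))) else \<one>)"
      by (rule elementE) (rule that)
    have "x' \<in> fixing N" using x' NC by (auto simp: fixing_def U_def)
    moreover have "R x x'"
      unfolding R_def
    proof
      fix \<kappa> assume \<kappa>: "\<kappa> \<in> C"
      have "snd x' (k \<kappa>) = c (fst x \<kappa>) \<otimes> (snd x \<kappa> \<otimes> inv (c \<kappa>))"
        using x'(3)[OF kC[OF \<kappa>]] k_in[OF \<kappa>] k_inv[OF \<kappa>] by simp
      then have "snd x' (k \<kappa>) \<otimes> c \<kappa> = c (fst x \<kappa>) \<otimes> snd x \<kappa>"
        using c[OF \<kappa>] c[OF fst_in[OF x \<kappa>]] snd_in[OF x \<kappa>] by (simp add: m_assoc)
      then show "fst x' (k \<kappa>) = k (fst x \<kappa>) \<and> snd x' (k \<kappa>) \<otimes> c \<kappa> = c (fst x \<kappa>) \<otimes> snd x \<kappa>"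
        using x'(2)[OF kC[OF \<kappa>]] k_in[OF \<kappa>] k_inv[OF \<kappa>] by simp
    qed
    ultimately show ?thesis by blast
  qed
  have N_eq: "N = C - U" using NC by (auto simp: U_def)
  have R2: "\<exists>x\<in>carrier \<Gamma>. R x x'" if x': "x' \<in> fixing N" for x'
  proof -
    have x'c: "x' \<in> carrier \<Gamma>" using x' by (rule fixingD)
    have inU: "fst x' \<kappa> \<in> U" if "\<kappa> \<in> U" for \<kappa>
      using fixing_image[of x' U \<kappa>] x' that U(3) by (simp add: N_eq)
    have "fst x' ` U = U"
    proof (intro equalityI subsetI)
      fix \<kappa> assume \<kappa>: "\<kappa> \<in> U"
      then have "\<kappa> \<in> fst x' ` C" using fst_bij[OF x'c] U(3) by (auto simp: bij_betw_def)
      then obtain \<kappa>' where \<kappa>': "\<kappa>' \<in> C" "\<kappa> = fst x' \<kappa>'" by blast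
      then show "\<kappa> \<in> fst x' ` U" using fixingD(2)[OF x', of \<kappa>'] \<kappa> by (cases "\<kappa>' \<in> U") (auto simp: N_eq)
    qed (use inU in blast)
    then have "mor U U (fst x') (snd x')"
      using mor_restrict[OF carrier_mor[OF x'c] U(3)] U(1) by (simp add: clopen_def)
    from mor_comp[OF mor_comp[OF kc this] mor_inv[OF kc]] obtain x where x: "x \<in> carrier \<Gamma>"
      "\<And>\<kappa>. \<kappa> \<in> C \<Longrightarrow> fst x \<kappa> = inv_into C k (fst x' (k \<kappa>))"
      "\<And>\<kappa>. \<kappa> \<in> C \<Longrightarrow> snd x \<kappa> = inv (c (inv_into C k (fst x' (k \<kappa>)))) \<otimes> (snd x' (k \<kappa>) \<otimes> c \<kappa>)"
      by (rule elementE) (rule that)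
    have "R x x'"
      unfolding R_def
    proof
      fix \<kappa> assume \<kappa>: "\<kappa> \<in> C"
      have "fst x' (k \<kappa>) = k (fst x \<kappa>)"
        using x(2)[OF \<kappa>] k inU[OF k_in[OF \<kappa>]] by (metis bij_betw_inv_into_right)
      moreover have "snd x \<kappa> = inv (c (fst x \<kappa>)) \<otimes> (snd x' (k \<kappa>) \<otimes> c \<kappa>)"
        using x(2,3)[OF \<kappa>] by simp
      then have "c (fst x \<kappa>) \<otimes> snd x \<kappa> = snd x' (k \<kappa>) \<otimes> c \<kappa>"
        using c[OF fst_in[OF x(1) \<kappa>]] c[OF \<kappa>] snd_in[OF x'c kC[OF \<kappa>]] by (simp add: m_assoc[symmetric])
      ultimately show "fst x' (k \<kappa>) = k (fst x \<kappa>) \<and> snd x' (k \<kappa>) \<otimes> c \<kappa> = c (fst x \<kappa>) \<otimes> snd x \<kappa>" by simp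
    qed
    then show ?thesis using x(1) by blast
  qed
  have R_fun: "x' = y'" if "R x x'" "R x y'" "x' \<in> fixing N" "y' \<in> fixing N" for x x' y'
  proof (rule \<Gamma>_eqI)
    show x'y': "x' \<in> carrier \<Gamma>" "y' \<in> carrier \<Gamma>" using that fixingD by auto
    fix \<kappa> assume \<kappa>: "\<kappa> \<in> C"
    have "fst x' \<kappa> = fst y' \<kappa> \<and> snd x' \<kappa> = snd y' \<kappa>"
    proof (cases "\<kappa> \<in> U")
      case True
      then obtain \<kappa>' where \<kappa>': "\<kappa>' \<in> C" "\<kappa> = k \<kappa>'" using k_surj by blast
      have "fst x' \<kappa> = fst y' \<kappa>" using that(1,2) \<kappa>' by (simp add: R_def)
      moreover have "snd x' \<kappa> \<otimes> c \<kappa>' = snd y' \<kappa> \<otimes> c \<kappa>'" using that(1,2) \<kappa>' by (simp add: R_def)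
      ultimately show ?thesis using c[OF \<kappa>'(1)] snd_in[OF x'y'(1) \<kappa>] snd_in[OF x'y'(2) \<kappa>] by simp
    next
      case False
      then have "\<kappa> \<in> N" using \<kappa> by (simp add: N_eq)
      then show ?thesis using fixingD[OF that(3)] fixingD[OF that(4)] by simp
    qed
    then show "fst x' \<kappa> = fst y' \<kappa>" "snd x' \<kappa> = snd y' \<kappa>" by auto
  qed
  have R_inj: "x = y" if "R x x'" "R y x'" "x \<in> carrier \<Gamma>" "y \<in> carrier \<Gamma>" for x y x'
  proof (rule \<Gamma>_eqI[OF that(3,4)])
    fix \<kappa> assume \<kappa>: "\<kappa> \<in> C"
    have "k (fst x \<kappa>) = k (fst y \<kappa>)" using that(1,2) \<kappa> unfolding R_def by metis
    then show eq: "fst x \<kappa> = fst y \<kappa>" using k_inj fst_in that(3,4) \<kappa> by blast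
    have "c (fst x \<kappa>) \<otimes> snd x \<kappa> = c (fst y \<kappa>) \<otimes> snd y \<kappa>" using that(1,2) \<kappa> unfolding R_def by metis
    then show "snd x \<kappa> = snd y \<kappa>" using eq c[OF fst_in[OF that(4) \<kappa>]] snd_in that(3,4) \<kappa> by simp
  qed
  have R_mult: "R (x \<odot> y) (x' \<odot> y')"
    if "R x x'" "R y y'" "x \<in> carrier \<Gamma>" "y \<in> carrier \<Gamma>" "x' \<in> carrier \<Gamma>" "y' \<in> carrier \<Gamma>" for x y x' y'
    unfolding R_def
  proof
    fix \<kappa> assume \<kappa>: "\<kappa> \<in> C"
    note y\<kappa> = fst_in[OF that(4) \<kappa>]
    have 1: "fst y' (k \<kappa>) = k (fst y \<kappa>)" "snd y' (k \<kappa>) \<otimes> c \<kappa> = c (fst y \<kappa>) \<otimes> snd y \<kappa>"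
      using that(2) \<kappa> by (auto simp: R_def)
    have 2: "fst x' (k (fst y \<kappa>)) = k (fst x (fst y \<kappa>))"
      "snd x' (k (fst y \<kappa>)) \<otimes> c (fst y \<kappa>) = c (fst x (fst y \<kappa>)) \<otimes> snd x (fst y \<kappa>)"
      using that(1) y\<kappa> by (auto simp: R_def)
    have in_G: "snd x' (k (fst y \<kappa>)) \<in> carrier G" "snd y' (k \<kappa>) \<in> carrier G" "snd x (fst y \<kappa>) \<in> carrier G"
      "snd y \<kappa> \<in> carrier G" "c (fst x (fst y \<kappa>)) \<in> carrier G"
      using that \<kappa> y\<kappa> by (auto intro: snd_in kC c fst_in)
    have "snd (x' \<odot> y') (k \<kappa>) \<otimes> c \<kappa> = snd x' (k (fst y \<kappa>)) \<otimes> (snd y' (k \<kappa>) \<otimes> c \<kappa>)"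
      using kC[OF \<kappa>] in_G c[OF \<kappa>] by (simp add: snd_mult 1(1) m_assoc)
    also have "\<dots> = (snd x' (k (fst y \<kappa>)) \<otimes> c (fst y \<kappa>)) \<otimes> snd y \<kappa>"
      using in_G c[OF y\<kappa>] by (simp add: 1(2) m_assoc)
    also have "\<dots> = c (fst x (fst y \<kappa>)) \<otimes> (snd x (fst y \<kappa>) \<otimes> snd y \<kappa>)"
      using in_G by (simp add: 2(2) m_assoc)
    finally show "fst (x' \<odot> y') (k \<kappa>) = k (fst (x \<odot> y) \<kappa>) \<and>
        snd (x' \<odot> y') (k \<kappa>) \<otimes> c \<kappa> = c (fst (x \<odot> y) \<kappa>) \<otimes> snd (x \<odot> y) \<kappa>"
      using \<kappa> kC[OF \<kappa>] 1 2 by (simp add: fst_mult snd_mult)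
  qed
  \<comment> \<open>\<open>R_fun\<close> makes the chosen element unique, so the properties of
    \<open>\<rho>\<close> can be read off from those of \<open>R\<close>.\<close>
  define \<rho> where "\<rho> x = (SOME x'. x' \<in> fixing N \<and> R x x')" for x
  have \<rho>: "\<rho> x \<in> fixing N \<and> R x (\<rho> x)" if "x \<in> carrier \<Gamma>" for x
    unfolding \<rho>_def by (rule someI_ex) (use R1[OF that] in blast)
  have \<rho>c: "\<rho> x \<in> carrier \<Gamma>" if "x \<in> carrier \<Gamma>" for x using \<rho>[OF that] fixingD by blast
  show ?thesis
  proof
    show "\<rho> \<in> hom \<Gamma> \<Gamma>"
    proof (rule homI)
      fix x y assume xy: "x \<in> carrier \<Gamma>" "y \<in> carrier \<Gamma>"
      have "R (x \<odot> y) (\<rho> x \<odot> \<rho> y)" using R_mult \<rho> \<rho>c xy by blast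
      moreover have "\<rho> x \<odot> \<rho> y \<in> fixing N" using fixing_mult \<rho> xy NC by blast
      ultimately show "\<rho> (x \<odot> y) = \<rho> x \<odot> \<rho> y"
        using R_fun \<rho>[OF \<Gamma>.m_closed[OF xy]] by blast
    qed (rule \<rho>c)
    show "inj_on \<rho> (carrier \<Gamma>)" by (rule inj_onI) (metis \<rho> R_inj)
    show "\<rho> ` carrier \<Gamma> = fixing N"
    proof (intro equalityI subsetI)
      fix x' assume x': "x' \<in> fixing N"
      then obtain x where x: "x \<in> carrier \<Gamma>" "R x x'" using R2 by blast
      then have "x' = \<rho> x" using R_fun[OF x(2)] \<rho>[OF x(1)] x' by blast
      then show "x' \<in> \<rho> ` carrier \<Gamma>" using x(1) by blast
    qed (use \<rho> in blast)
  qed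
qed

text \<open>The class to be closed under doubling. Properness of U leaves room for a displaced copy
  of the support, and non-emptiness lets \<open>mor_exists\<close> carry U onto that copy.\<close>

definition proper_homs :: "(_ \<Rightarrow> _) set" where
  "proper_homs = {\<rho> \<in> hom \<Gamma> \<Gamma>. \<exists>U. clopen U \<and> U \<noteq> {} \<and> U \<noteq> C \<and> \<rho> ` carrier \<Gamma> \<subseteq> fixing (C - U)}"

text \<open>Take half of a brick inside W; a point of the other half shows that the inclusion is
  proper.\<close>

lemma split_clopen:
  assumes W: "clopen W" "W \<noteq> {}"
  obtains W1 where "clopen W1" "W1 \<noteq> {}" "W1 \<subseteq> W" "W1 \<noteq> W"
proof -
  obtain \<kappa> where "\<kappa> \<in> W" using W(2) by blast
  then obtain \<alpha> where \<alpha>: "lab \<alpha>" "br \<alpha> \<subseteq> W" using W(1) unfolding clopen_def brick_open_def by blast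
  obtain \<alpha>0 \<alpha>1 where l: "lab \<alpha>0" "lab \<alpha>1" "br \<alpha>0 \<inter> br \<alpha>1 = {}" "br \<alpha>0 \<union> br \<alpha>1 = C" by (rule halves)
  have ne: "br \<beta> \<noteq> {}" for \<beta> using C_nonempty by (auto simp: br_eq)
  obtain \<kappa>1 where \<kappa>1: "\<kappa>1 \<in> br \<alpha>1" using ne by blast
  then have \<kappa>1C: "\<kappa>1 \<in> C" using br_sub by blast
  have "bm \<alpha> \<kappa>1 \<notin> br (label_append \<alpha> \<alpha>0)"
  proof
    assume "bm \<alpha> \<kappa>1 \<in> br (label_append \<alpha> \<alpha>0)"
    then obtain \<kappa>' where "\<kappa>' \<in> C" "bm \<alpha> \<kappa>1 = bm \<alpha> (bm \<alpha>0 \<kappa>')" by (auto simp: br_eq bm_label_append)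
    then have "\<kappa>1 = bm \<alpha>0 \<kappa>'" using bm_inj[OF \<kappa>1C] by simp
    then have "\<kappa>1 \<in> br \<alpha>0" using \<open>\<kappa>' \<in> C\<close> by (simp add: br_eq)
    then show False using l(3) \<kappa>1 by blast
  qed
  moreover have "bm \<alpha> \<kappa>1 \<in> W" using \<alpha>(2) \<kappa>1C by (auto simp: br_eq)
  ultimately show ?thesis
    using that[of "br (label_append \<alpha> \<alpha>0)"] clopen_br[OF lab_label_append[OF \<alpha>(1) l(1)]] ne br_label_append[of \<alpha> \<alpha>0] \<alpha>(2) by blast
qed

text \<open>The element t carries U onto a proper part V of its complement, so \<open>\<rho>\<close>
  and its conjugate have disjoint supports and commute. As U \<union> V is again proper, the
  doubling can be repeated forever.\<close>

lemma proper_homs_double: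
  assumes "\<rho> \<in> proper_homs"
  shows "\<exists>t\<in>carrier \<Gamma>.
    (\<forall>a\<in>carrier \<Gamma>. \<forall>b\<in>carrier \<Gamma>. \<rho> a \<odot> (t \<odot> \<rho> b \<odot> inv\<^bsub>\<Gamma>\<^esub> t) = (t \<odot> \<rho> b \<odot> inv\<^bsub>\<Gamma>\<^esub> t) \<odot> \<rho> a) \<and>
    (\<lambda>a. \<rho> a \<odot> (t \<odot> \<rho> a \<odot> inv\<^bsub>\<Gamma>\<^esub> t)) \<in> proper_homs"
proof -
  obtain U where hom: "\<rho> \<in> hom \<Gamma> \<Gamma>" and U: "clopen U" "U \<noteq> {}" "U \<noteq> C" and \<rho>: "\<rho> ` carrier \<Gamma> \<subseteq> fixing (C - U)"
    using assms by (auto simp: proper_homs_def)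
  have UC: "U \<subseteq> C" using U by (simp add: clopen_def)
  have "C - U \<noteq> {}" using U UC by blast
  from split_clopen[OF clopen_compl[OF U(1)] this] obtain V where V: "clopen V" "V \<noteq> {}" "V \<subseteq> C - U" "V \<noteq> C - U" .
  have VC: "V \<noteq> C" "V \<subseteq> C" "U \<inter> V = {}" using V U UC by auto
  obtain h \<gamma> where m: "mor U V h \<gamma>" using mor_exists[OF U(1,2) V(1,2)] by blast
  obtain t where t: "t \<in> carrier \<Gamma>" "\<And>\<kappa>. \<kappa> \<in> U \<Longrightarrow> fst t \<kappa> = h \<kappa>"
    by (rule extend[OF m U(1) V(1) U(3) VC(1)]) (rule that)
  have "h ` U = V" using m by (simp add: mor_def bij_betw_def)
  then have tU: "fst t ` U = V" using t(2) by (auto simp: image_iff)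
  define \<tau> where "\<tau> a = t \<odot> \<rho> a \<odot> inv\<^bsub>\<Gamma>\<^esub> t" for a
  have \<rho>_fix: "\<rho> a \<in> fixing (C - U)" if "a \<in> carrier \<Gamma>" for a using \<rho> that by blast
  have \<tau>_fix: "\<tau> a \<in> fixing (C - V)" if "a \<in> carrier \<Gamma>" for a
    unfolding \<tau>_def by (rule fixing_conjugate[OF \<rho>_fix[OF that] t(1) tU])
  have \<tau>_in: "\<tau> a \<in> carrier \<Gamma>" and \<rho>_in: "\<rho> a \<in> carrier \<Gamma>" if "a \<in> carrier \<Gamma>" for a
    using \<tau>_fix[OF that] \<rho>_fix[OF that] fixingD by auto
  have comm: "\<rho> a \<odot> \<tau> b = \<tau> b \<odot> \<rho> a" if "a \<in> carrier \<Gamma>" "b \<in> carrier \<Gamma>" for a b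
    using fixing_commute[OF \<rho>_fix[OF that(1)] \<tau>_fix[OF that(2)] VC(3) UC VC(2)] .
  have \<rho>_mult: "\<rho> (a \<odot> b) = \<rho> a \<odot> \<rho> b" if "a \<in> carrier \<Gamma>" "b \<in> carrier \<Gamma>" for a b
    using hom that by (simp add: hom_def)
  have \<tau>_mult: "\<tau> (a \<odot> b) = \<tau> a \<odot> \<tau> b" if "a \<in> carrier \<Gamma>" "b \<in> carrier \<Gamma>" for a b
  proof -
    have "inv\<^bsub>\<Gamma>\<^esub> t \<odot> (t \<odot> z) = z" if "z \<in> carrier \<Gamma>" for z
      using t(1) that by (simp add: \<Gamma>.m_assoc[symmetric])
    then show ?thesis using that t(1) \<rho>_in by (simp add: \<tau>_def \<rho>_mult \<Gamma>.m_assoc)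
  qed
  have "(\<lambda>a. \<rho> a \<odot> \<tau> a) \<in> hom \<Gamma> \<Gamma>"
  proof (rule homI)
    fix a b assume ab: "a \<in> carrier \<Gamma>" "b \<in> carrier \<Gamma>"
    have "\<rho> a \<odot> \<rho> b \<odot> (\<tau> a \<odot> \<tau> b) = \<rho> a \<odot> (\<rho> b \<odot> \<tau> a) \<odot> \<tau> b"
      using ab \<rho>_in \<tau>_in by (simp add: \<Gamma>.m_assoc)
    also have "\<rho> b \<odot> \<tau> a = \<tau> a \<odot> \<rho> b" using comm ab by blast
    also have "\<rho> a \<odot> (\<tau> a \<odot> \<rho> b) \<odot> \<tau> b = \<rho> a \<odot> \<tau> a \<odot> (\<rho> b \<odot> \<tau> b)"
      using ab \<rho>_in \<tau>_in by (simp add: \<Gamma>.m_assoc)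
    finally show "\<rho> (a \<odot> b) \<odot> \<tau> (a \<odot> b) = \<rho> a \<odot> \<tau> a \<odot> (\<rho> b \<odot> \<tau> b)"
      using ab by (simp add: \<rho>_mult \<tau>_mult)
  qed (simp add: \<rho>_in \<tau>_in)
  moreover have "\<rho> a \<odot> \<tau> a \<in> fixing (C - (U \<union> V))" if "a \<in> carrier \<Gamma>" for a
    using \<rho>_fix[OF that] \<tau>_fix[OF that] fixing_mono[of "C - (U \<union> V)" "C - U"] fixing_mono[of "C - (U \<union> V)" "C - V"]
    by (intro fixing_mult) auto
  moreover have "clopen (U \<union> V)" "U \<union> V \<noteq> {}" "U \<union> V \<noteq> C" using clopen_union U V UC by auto
  ultimately have "(\<lambda>a. \<rho> a \<odot> \<tau> a) \<in> proper_homs"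
    unfolding proper_homs_def by blast
  then show ?thesis using t(1) comm unfolding \<tau>_def by blast
qed

subsection \<open>Germs at a base point\<close>

text \<open>The zero sequence is fixed by prefixing the letter 0 in a coordinate, which
  \<open>orbit_infinite\<close> exploits.\<close>

definition base :: "'s \<Rightarrow> nat \<Rightarrow> bool" where
  "base = (\<lambda>s\<in>S. \<lambda>_. False)"

definition agree where
  "agree x y N \<longleftrightarrow> (\<forall>\<kappa>\<in>N. fst x \<kappa> = fst y \<kappa> \<and> snd x \<kappa> = snd y \<kappa>)"

text \<open>The germ is the class itself, a set of group elements on which left translation acts
  elementwise. Agreement includes labels, so an element fixing the germ of x is trivial, with its
  label, near the image of the base point under x.\<close>

definition germ where
  "germ x = {y \<in> carrier \<Gamma>. \<exists>N. clopen N \<and> base \<in> N \<and> agree x y N}"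

definition act where
  "act x E = (\<lambda>y. x \<odot> y) ` E"

text \<open>Distinct image points are more than distinct germs: they have disjoint neighbourhoods,
  on which prescribed germs can be glued.\<close>

definition generic where
  "generic = {map germ as | as. set as \<subseteq> carrier \<Gamma> \<and> distinct (map (\<lambda>a. fst a base) as)}"

lemma base_in [simp]: "base \<in> C"
  by (simp add: base_def)

lemma germ_self: "x \<in> carrier \<Gamma> \<Longrightarrow> x \<in> germ x"
  unfolding germ_def agree_def using clopen_C base_in by blast

lemma germ_eqI:
  assumes "clopen N" "base \<in> N" "agree x y N"
  shows "germ x = germ y"
proof -
  have "germ x' \<subseteq> germ y'" if "agree x' y' N" for x' y'
  proof
    fix z assume "z \<in> germ x'"
    then obtain N' where N': "z \<in> carrier \<Gamma>" "clopen N'" "base \<in> N'" "agree x' z N'" by (auto simp: germ_def)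
    then have "clopen (N \<inter> N')" "base \<in> N \<inter> N'" "agree y' z (N \<inter> N')"
      using assms that by (auto simp: clopen_inter agree_def)
    then show "z \<in> germ y'" using N'(1) unfolding germ_def by blast
  qed
  moreover have "agree y x N" using assms(3) by (auto simp: agree_def)
  ultimately show ?thesis using assms(3) by blast
qed

lemma germ_eqD:
  assumes "germ x = germ y" "y \<in> carrier \<Gamma>"
  obtains N where "clopen N" "base \<in> N" "agree x y N"
  using germ_self[OF assms(2)] assms(1) by (auto simp: germ_def)

lemma agree_mult: "agree x y N \<Longrightarrow> N \<subseteq> C \<Longrightarrow> agree (a \<odot> x) (a \<odot> y) N"
  unfolding agree_def by (auto simp: fst_mult snd_mult subset_iff)

lemma act_germ:
  assumes "a \<in> carrier \<Gamma>" "x \<in> carrier \<Gamma>"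
  shows "act a (germ x) = germ (a \<odot> x)"
proof -
  have sub: "b \<odot> y \<in> germ (b \<odot> z)" if "y \<in> germ z" "b \<in> carrier \<Gamma>" for b y z
    using that agree_mult unfolding germ_def clopen_def by blast
  show ?thesis
    unfolding act_def
  proof (intro equalityI subsetI)
    fix y assume y: "y \<in> germ (a \<odot> x)"
    then have yc: "y \<in> carrier \<Gamma>" by (simp add: germ_def)
    have "inv\<^bsub>\<Gamma>\<^esub> a \<odot> y \<in> germ (inv\<^bsub>\<Gamma>\<^esub> a \<odot> (a \<odot> x))"
      using sub[OF y] assms by simp
    then have "inv\<^bsub>\<Gamma>\<^esub> a \<odot> y \<in> germ x" using assms by (simp add: \<Gamma>.m_assoc[symmetric])
    moreover have "y = a \<odot> (inv\<^bsub>\<Gamma>\<^esub> a \<odot> y)" using assms yc by (simp add: \<Gamma>.m_assoc[symmetric])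
    ultimately show "y \<in> (\<lambda>y. a \<odot> y) ` germ x" by (rule rev_image_eqI)
  next
    fix y assume "y \<in> (\<lambda>y. a \<odot> y) ` germ x"
    then obtain z where "z \<in> germ x" "y = a \<odot> z" by blast
    then show "y \<in> germ (a \<odot> x)" using sub assms(1) by blast
  qed
qed

lemma map_act_germ:
  "a \<in> carrier \<Gamma> \<Longrightarrow> set as \<subseteq> carrier \<Gamma> \<Longrightarrow> map (act a) (map germ as) = map germ (map (\<lambda>x. a \<odot> x) as)"
  by (auto simp: act_germ subset_iff)

section \<open>Separating and moving points in the orbit of the base point\<close>

lemma separate:
  assumes "p \<in> C" "q \<in> C" "p \<noteq> q"
  shows "\<exists>D. clopen D \<and> p \<in> D \<and> q \<notin> D"
proof -
  obtain s where s: "s \<in> S" "p s \<noteq> q s" using C_eqI assms by blast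
  then obtain n where n: "p s n \<noteq> q s n" by blast
  define \<alpha> where "\<alpha> = (\<lambda>t. if t = s then prefix (Suc n) (p s) else [])"
  have "lab \<alpha>" unfolding brick_label_def by (rule finite_subset[of _ "{s}"]) (auto simp: \<alpha>_def)
  moreover have "p \<in> br \<alpha>" using assms(1) by (auto simp: brick_def \<alpha>_def)
  moreover have "q \<notin> br \<alpha>"
  proof
    assume "q \<in> br \<alpha>"
    then have "prefix (Suc n) (q s) = prefix (Suc n) (p s)" using s by (auto simp: brick_def \<alpha>_def)
    then have "prefix (Suc n) (q s) ! n = prefix (Suc n) (p s) ! n" by (simp only:)
    then have "q s n = p s n" by (simp only: subsequence_nth[of n "Suc n" 0] diff_zero lessI add_0)
    with n show False by simp
  qed
  ultimately show ?thesis using clopen_br by blast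
qed

lemma orbit_infinite:
  obtains t where "\<And>k. t k \<in> carrier \<Gamma>" "inj (\<lambda>k::nat. fst (t k) base)"
proof -
  obtain s where s: "s \<in> S" using S_nonempty by blast
  \<comment> \<open>The labels 1^k 0 at one coordinate. Moving the brick of 0 onto the brick of 1^k
    0 sends the base point to 1^k 000... there, from which k can be read off.\<close>
  define \<beta> where "\<beta> k = (\<lambda>u. if u = s then replicate k True @ [False] else [])" for k
  have lab: "lab (\<beta> k)" for k
    unfolding brick_label_def by (rule finite_subset[of _ "{s}"]) (auto simp: \<beta>_def)
  have proper: "br (\<beta> k) \<noteq> C" for k
  proof -
    have "prefix (length (\<beta> k s)) (\<lambda>_. True) ! k \<noteq> \<beta> k s ! k"
      by (simp add: \<beta>_def nth_append)
    then have "prefix (length (\<beta> k s)) (\<lambda>_. True) \<noteq> \<beta> k s" by metis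
    then have "(\<lambda>_\<in>S. \<lambda>_. True) \<notin> br (\<beta> k)" using s by (auto simp: brick_def)
    then show ?thesis by (metis restrict_in_C)
  qed
  have "\<exists>x\<in>carrier \<Gamma>. fst x base = bm (\<beta> k) base" for k
  proof -
    have base: "base = bm (\<beta> 0) base"
      by (rule C_eqI) (auto simp: base_def brick_map_def \<beta>_def conc_def)
    have inv_base: "inv_into C (bm (\<beta> 0)) base = base"
      using brick_map_bij[of S "\<beta> 0"] base by (metis base_in bij_betw_inv_into_left)
    obtain x where x: "x \<in> carrier \<Gamma>" "\<And>\<kappa>. \<kappa> \<in> br (\<beta> 0) \<Longrightarrow> fst x \<kappa> = bm (\<beta> k) (inv_into C (bm (\<beta> 0)) \<kappa>)"
      by (rule extend[OF mor_comp[OF mor_inv[OF mor_brick[OF lab]] mor_brick[OF lab]] clopen_br[OF lab] clopen_br[OF lab] proper proper])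
        (rule that)
    have "base \<in> br (\<beta> 0)" using base by (metis base_in br_eq imageI)
    from x(2)[OF this] show ?thesis using inv_base x(1) by (intro bexI[of _ x]) simp_all
  qed
  then obtain t where t: "\<And>k. t k \<in> carrier \<Gamma>" "\<And>k. fst (t k) base = bm (\<beta> k) base" by metis
  have val: "fst (t k) base s n \<longleftrightarrow> n < k" for k n
    unfolding t(2) using s by (simp add: brick_map_def \<beta>_def base_def conc_def nth_append)
  have "inj (\<lambda>k. fst (t k) base)"
  proof (rule injI)
    fix k l assume "fst (t k) base = fst (t l) base"
    then have "n < k \<longleftrightarrow> n < l" for n using val by metis
    then show "k = l" by (metis linorder_neqE_nat less_irrefl)
  qed
  with t(1) show ?thesis by (rule that)
qed

lemma point_outside:
  assumes "finite Q"
  obtains z where "z \<in> C" "z \<notin> Q"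
proof -
  obtain t where t: "\<And>k. t k \<in> carrier \<Gamma>" "inj (\<lambda>k::nat. fst (t k) base)" by (rule orbit_infinite) (rule that)
  have "infinite (range (\<lambda>k. fst (t k) base))" using t(2) by (simp add: finite_image_iff)
  then have "\<not> range (\<lambda>k. fst (t k) base) \<subseteq> Q" using assms finite_subset by blast
  then obtain k where "fst (t k) base \<notin> Q" by blast
  then show ?thesis using that fst_in[OF t(1) base_in] by blast
qed

lemma clopen_pullback:
  assumes "a \<in> carrier \<Gamma>" "clopen N" "fst a \<kappa> \<in> N" "\<kappa> \<in> C"
  obtains M where "clopen M" "\<kappa> \<in> M" "fst a ` M \<subseteq> N"
proof
  show "clopen (fst (inv\<^bsub>\<Gamma>\<^esub> a) ` N)" by (rule clopen_fst_image[OF \<Gamma>.inv_closed[OF assms(1)] assms(2)])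
  show "\<kappa> \<in> fst (inv\<^bsub>\<Gamma>\<^esub> a) ` N" using fst_inv[OF assms(1,4)] assms(3) by (metis imageI)
  have "N \<subseteq> C" using assms(2) by (simp add: clopen_def)
  then show "fst a ` fst (inv\<^bsub>\<Gamma>\<^esub> a) ` N \<subseteq> N" using fst_inv'[OF assms(1)] by auto
qed

text \<open>Finitely many separating neighbourhoods of the base point are intersected to one. The
  spare point z keeps the union of the images proper, as \<open>extend\<close> requires.\<close>

lemma generic_separation:
  assumes as: "set as \<subseteq> carrier \<Gamma>" "distinct (map (\<lambda>a. fst a base) as)"
  obtains E z where "clopen E" "base \<in> E" "z \<in> C" "\<And>a. a \<in> set as \<Longrightarrow> z \<notin> fst a ` E"
    "\<And>i j. i < length as \<Longrightarrow> j < length as \<Longrightarrow> i \<noteq> j \<Longrightarrow> fst (as ! i) ` E \<inter> fst (as ! j) ` E = {}"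
proof -
  let ?q = "\<lambda>a. fst a base"
  have q_in: "?q a \<in> C" if "a \<in> set as" for a using fst_in as(1) that base_in by blast
  obtain z where z: "z \<in> C" "z \<notin> ?q ` set as" using point_outside[of "?q ` set as"] by blast
  have "\<exists>M. clopen M \<and> base \<in> M \<and> z \<notin> fst a ` M" if a: "a \<in> set as" for a
  proof -
    have "?q a \<noteq> z" using z(2) a by auto
    then obtain D where D: "clopen D" "?q a \<in> D" "z \<notin> D"
      using separate[OF q_in[OF a] z(1)] by blast
    obtain M where "clopen M" "base \<in> M" "fst a ` M \<subseteq> D"
      by (rule clopen_pullback[of a D base]) (use D a as in auto)
    then show ?thesis using D(3) by blast
  qed
  then obtain M where M: "\<And>a. a \<in> set as \<Longrightarrow> clopen (M a) \<and> base \<in> M a \<and> z \<notin> fst a ` M a" by metis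
  have "\<exists>M. clopen M \<and> base \<in> M \<and> fst a ` M \<inter> fst b ` M = {}"
    if a: "a \<in> set as" and b: "b \<in> set as" and ab: "?q a \<noteq> ?q b" for a b
  proof -
    obtain D where D: "clopen D" "?q a \<in> D" "?q b \<notin> D"
      using separate[OF q_in[OF a] q_in[OF b] ab] by blast
    obtain M1 where M1: "clopen M1" "base \<in> M1" "fst a ` M1 \<subseteq> D"
      by (rule clopen_pullback[of a D base]) (use D a as in auto)
    obtain M2 where M2: "clopen M2" "base \<in> M2" "fst b ` M2 \<subseteq> C - D"
      by (rule clopen_pullback[of b "C - D" base]) (use D b as q_in[OF b] clopen_compl[OF D(1)] in auto)
    have "fst a ` (M1 \<inter> M2) \<inter> fst b ` (M1 \<inter> M2) = {}" using M1(3) M2(3) by blast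
    then show ?thesis using M1 M2 clopen_inter by blast
  qed
  then obtain M' where M': "\<And>a b. a \<in> set as \<Longrightarrow> b \<in> set as \<Longrightarrow> ?q a \<noteq> ?q b \<Longrightarrow>
      clopen (M' a b) \<and> base \<in> M' a b \<and> fst a ` M' a b \<inter> fst b ` M' a b = {}" by metis
  define I where "I = {(a, b). a \<in> set as \<and> b \<in> set as \<and> ?q a \<noteq> ?q b}"
  have I: "finite I" by (rule finite_subset[of _ "set as \<times> set as"]) (auto simp: I_def)
  define E where "E = (C \<inter> (\<Inter>a\<in>set as. M a)) \<inter> (C \<inter> (\<Inter>p\<in>I. M' (fst p) (snd p)))"
  show ?thesis
  proof
    show "clopen E" unfolding E_def
      by (intro clopen_inter[OF clopen_Inter clopen_Inter] I) (use M M' in \<open>auto simp: I_def\<close>)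
    show "base \<in> E" unfolding E_def using M M' by (auto simp: I_def)
    show "z \<in> C" by (rule z)
    show "z \<notin> fst a ` E" if "a \<in> set as" for a using M[OF that] that by (auto simp: E_def)
    fix i j assume ij: "i < length as" "j < length as" "i \<noteq> j"
    have q: "?q (as ! i) \<noteq> ?q (as ! j)"
      using nth_eq_iff_index_eq[OF as(2)] ij by simp
    have mem: "as ! i \<in> set as" "as ! j \<in> set as" using ij by auto
    then have "(as ! i, as ! j) \<in> I" using q by (simp add: I_def)
    then have "E \<subseteq> M' (as ! i) (as ! j)" by (force simp: E_def)
    then show "fst (as ! i) ` E \<inter> fst (as ! j) ` E = {}" using M'[OF mem q] by blast
  qed
qed

lemma mor_UN:
  fixes n :: nat
  assumes "\<And>i. i < n \<Longrightarrow> mor (U i) (V i) h \<gamma>"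
    and "\<And>i j. i < n \<Longrightarrow> j < n \<Longrightarrow> i \<noteq> j \<Longrightarrow> V i \<inter> V j = {}"
  shows "mor (\<Union>i<n. U i) (\<Union>i<n. V i) h \<gamma>"
  using assms
proof (induction n)
  case 0
  then show ?case by (simp add: mor_def bij_betw_def)
next
  case (Suc n)
  have "(\<Union>i<n. V i) \<inter> V n = {}"
  proof -
    have "V i \<inter> V n = {}" if "i < n" for i using Suc.prems(2)[of i n] that by simp
    then show ?thesis by blast
  qed
  then have "mor ((\<Union>i<n. U i) \<union> U n) ((\<Union>i<n. V i) \<union> V n) h \<gamma>"
    using Suc by (intro mor_union) auto
  then show ?case by (simp add: lessThan_Suc Un_commute)
qed

text \<open>On the disjoint sets a_i(E) prescribe b_i a_i^-1 together with its label, and glue. The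
  spare points permit an extension to a group element g with g a_i = b_i on E, hence with the right
  germs.\<close>

lemma generic_transitive:
  assumes as: "set as \<subseteq> carrier \<Gamma>" "distinct (map (\<lambda>a. fst a base) as)"
    and bs: "set bs \<subseteq> carrier \<Gamma>" "distinct (map (\<lambda>a. fst a base) bs)" and len: "length as = length bs"
  shows "\<exists>g\<in>carrier \<Gamma>. map germ bs = map (act g) (map germ as)"
proof -
  obtain E1 z1 where E1: "clopen E1" "base \<in> E1" "z1 \<in> C" "\<And>a. a \<in> set as \<Longrightarrow> z1 \<notin> fst a ` E1"
    "\<And>i j. i < length as \<Longrightarrow> j < length as \<Longrightarrow> i \<noteq> j \<Longrightarrow> fst (as ! i) ` E1 \<inter> fst (as ! j) ` E1 = {}"
    using generic_separation[OF as] by metis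
  obtain E2 z2 where E2: "clopen E2" "base \<in> E2" "z2 \<in> C" "\<And>a. a \<in> set bs \<Longrightarrow> z2 \<notin> fst a ` E2"
    "\<And>i j. i < length bs \<Longrightarrow> j < length bs \<Longrightarrow> i \<noteq> j \<Longrightarrow> fst (bs ! i) ` E2 \<inter> fst (bs ! j) ` E2 = {}"
    using generic_separation[OF bs] by metis
  define E where "E = E1 \<inter> E2"
  have E: "clopen E" "base \<in> E" "E \<subseteq> C"
    unfolding E_def using E1(1,2) E2(1,2) clopen_inter[OF E1(1) E2(1)] by (simp_all add: clopen_def)
  let ?n = "length as"
  let ?U = "\<lambda>i. fst (as ! i) ` E" and ?V = "\<lambda>i. fst (bs ! i) ` E"
  have in_as: "as ! i \<in> carrier \<Gamma>" and in_bs: "bs ! i \<in> carrier \<Gamma>" if "i < ?n" for i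
    using as(1) bs(1) that len by auto
  have disjU: "?U i \<inter> ?U j = {}" if "i < ?n" "j < ?n" "i \<noteq> j" for i j
    using E1(5)[OF that] by (auto simp: E_def)
  have disjV: "?V i \<inter> ?V j = {}" if "i < ?n" "j < ?n" "i \<noteq> j" for i j
    using E2(5)[of i j] that len by (auto simp: E_def)
  define x where "x i = bs ! i \<odot> inv\<^bsub>\<Gamma>\<^esub> (as ! i)" for i
  have x: "x i \<in> carrier \<Gamma>" "x i \<odot> as ! i = bs ! i" if "i < ?n" for i
    using in_as[OF that] in_bs[OF that] by (auto simp: x_def \<Gamma>.m_assoc)
  have x_fst: "fst (x i) (fst (as ! i) \<kappa>) = fst (bs ! i) \<kappa>" if "i < ?n" "\<kappa> \<in> C" for i \<kappa>
    using fst_mult[OF that(2), of "x i" "as ! i"] x(2)[OF that(1)] by simp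
  have x_snd: "snd (x i) (fst (as ! i) \<kappa>) \<otimes> snd (as ! i) \<kappa> = snd (bs ! i) \<kappa>" if "i < ?n" "\<kappa> \<in> C" for i \<kappa>
    using snd_mult[OF that(2), of "x i" "as ! i"] x(2)[OF that(1)] by simp
  have x_image: "fst (x i) ` ?U i = ?V i" if "i < ?n" for i
  proof -
    have "fst (x i) ` ?U i = (\<lambda>\<kappa>. fst (x i) (fst (as ! i) \<kappa>)) ` E" by (simp add: image_image)
    also have "\<dots> = ?V i" by (rule image_cong) (use x_fst[OF that] E(3) in auto)
    finally show ?thesis .
  qed
  \<comment> \<open>The index of the piece containing \<kappa>, well defined by disjointness. It
    merges the pieces into one pair of functions, as \<open>mor_UN\<close> expects.\<close>
  define ix where "ix \<kappa> = (SOME i. i < ?n \<and> \<kappa> \<in> ?U i)" for \<kappa>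
  have ix: "ix \<kappa> = i" if "i < ?n" "\<kappa> \<in> ?U i" for i \<kappa>
  proof -
    have "ix \<kappa> < ?n \<and> \<kappa> \<in> ?U (ix \<kappa>)" unfolding ix_def by (rule someI[of _ i]) (use that in blast)
    then show ?thesis using disjU[of "ix \<kappa>" i] that by blast
  qed
  have piece: "mor (?U i) (?V i) (\<lambda>\<kappa>. fst (x (ix \<kappa>)) \<kappa>) (\<lambda>\<kappa>. snd (x (ix \<kappa>)) \<kappa>)" if i: "i < ?n" for i
  proof -
    have U: "?U i \<subseteq> C" "brick_open (?U i)" using clopen_fst_image[OF in_as[OF i] E(1)] by (auto simp: clopen_def)
    have "mor (?U i) (?V i) (fst (x i)) (snd (x i))"
      using mor_restrict[OF carrier_mor[OF x(1)[OF i]] U] x_image[OF i] by simp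
    then show ?thesis by (rule mor_cong) (use ix[OF i] in auto)
  qed
  have m: "mor (\<Union>i<?n. ?U i) (\<Union>i<?n. ?V i) (\<lambda>\<kappa>. fst (x (ix \<kappa>)) \<kappa>) (\<lambda>\<kappa>. snd (x (ix \<kappa>)) \<kappa>)"
    by (rule mor_UN) (use piece disjV in auto)
  have clops: "clopen (\<Union>i<?n. ?U i)" "clopen (\<Union>i<?n. ?V i)"
    using clopen_fst_image[OF in_as E(1)] clopen_fst_image[OF in_bs E(1)] by (auto intro!: clopen_Union)
  have "z1 \<notin> ?U i" if "i < ?n" for i using E1(4)[of "as ! i"] that by (auto simp: E_def)
  then have "z1 \<notin> (\<Union>i<?n. ?U i)" by blast
  moreover have "z2 \<notin> ?V i" if "i < ?n" for i using E2(4)[of "bs ! i"] that len by (auto simp: E_def)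
  then have "z2 \<notin> (\<Union>i<?n. ?V i)" by blast
  ultimately have proper: "(\<Union>i<?n. ?U i) \<noteq> C" "(\<Union>i<?n. ?V i) \<noteq> C" using E1(3) E2(3) by blast+
  obtain g where g: "g \<in> carrier \<Gamma>" "\<And>\<kappa>. \<kappa> \<in> (\<Union>i<?n. ?U i) \<Longrightarrow> fst g \<kappa> = fst (x (ix \<kappa>)) \<kappa>"
    "\<And>\<kappa>. \<kappa> \<in> (\<Union>i<?n. ?U i) \<Longrightarrow> snd g \<kappa> = snd (x (ix \<kappa>)) \<kappa>"
    by (rule extend[OF m clops proper]) (rule that)
  have "germ (g \<odot> as ! i) = germ (bs ! i)" if i: "i < ?n" for i
  proof (rule germ_eqI[OF E(1,2)])
    have "fst (g \<odot> as ! i) \<kappa> = fst (bs ! i) \<kappa> \<and> snd (g \<odot> as ! i) \<kappa> = snd (bs ! i) \<kappa>" if \<kappa>: "\<kappa> \<in> E" for \<kappa>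
    proof -
      have \<kappa>C: "\<kappa> \<in> C" and mem: "fst (as ! i) \<kappa> \<in> ?U i" using \<kappa> E(3) by auto
      then have "fst (as ! i) \<kappa> \<in> (\<Union>i<?n. ?U i)" using i by blast
      then show ?thesis
        using g(2,3) ix[OF i mem] x_fst[OF i \<kappa>C] x_snd[OF i \<kappa>C] by (simp add: fst_mult[OF \<kappa>C] snd_mult[OF \<kappa>C])
    qed
    then show "agree (g \<odot> as ! i) (bs ! i) E" by (simp add: agree_def)
  qed
  then have "map germ bs = map germ (map (\<lambda>a. g \<odot> a) as)"
    using len by (intro nth_equalityI) auto
  then show ?thesis using map_act_germ[OF g(1) as(1)] g(1) by (intro bexI[of _ g]) simp
qed

lemma generic_delete:
  assumes "xs \<in> generic" "i < length xs"
  shows "take i xs @ drop (Suc i) xs \<in> generic"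
proof -
  obtain as where as: "xs = map germ as" "set as \<subseteq> carrier \<Gamma>" "distinct (map (\<lambda>a. fst a base) as)"
    using assms(1) by (auto simp: generic_def)
  define bs where "bs = take i as @ drop (Suc i) as"
  have "as = take i as @ as ! i # drop (Suc i) as" using assms(2) as(1) by (simp add: id_take_nth_drop)
  then have "distinct (map (\<lambda>a. fst a base) (take i as @ as ! i # drop (Suc i) as))" using as(3) by simp
  then have "distinct (map (\<lambda>a. fst a base) bs)" by (auto simp: bs_def)
  moreover have "set bs \<subseteq> carrier \<Gamma>" using as(2) by (auto simp: bs_def dest: in_set_takeD in_set_dropD)
  moreover have "take i xs @ drop (Suc i) xs = map germ bs" by (simp add: as(1) bs_def take_map drop_map)
  ultimately show ?thesis unfolding generic_def by blast
qed

text \<open>The elements from \<open>orbit_infinite\<close> supply the generic sequence: their image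
  points are distinct, so a given tuple excludes only finitely many of them.\<close>

lemma generic_action:
  obtains y where "generic_action \<Gamma> act (germ ` carrier \<Gamma>) generic y"
proof -
  obtain t where t: "\<And>k. t k \<in> carrier \<Gamma>" "inj (\<lambda>k::nat. fst (t k) base)" by (rule orbit_infinite) (rule that)
  have "generic_action \<Gamma> act (germ ` carrier \<Gamma>) generic (\<lambda>k. germ (t k))"
  proof
    show "act \<one>\<^bsub>\<Gamma>\<^esub> x = x" if "x \<in> germ ` carrier \<Gamma>" for x using that by (auto simp: act_germ)
    show "act (a \<odot> b) x = act a (act b x)" if "a \<in> carrier \<Gamma>" "b \<in> carrier \<Gamma>" "x \<in> germ ` carrier \<Gamma>" for a b x
      using that by (auto simp: act_germ \<Gamma>.m_assoc)
    show "set xs \<subseteq> germ ` carrier \<Gamma>" if xs: "xs \<in> generic" for xs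
    proof -
      obtain as where "xs = map germ as" "set as \<subseteq> carrier \<Gamma>" using xs unfolding generic_def by blast
      then show ?thesis by (simp add: image_mono)
    qed
    have "map germ [] \<in> generic" unfolding generic_def by fastforce
    then show "[] \<in> generic" by simp
    show "map (act a) xs \<in> generic" if xs: "xs \<in> generic" and a: "a \<in> carrier \<Gamma>" for xs a
    proof -
      obtain as where as: "xs = map germ as" "set as \<subseteq> carrier \<Gamma>" "distinct (map (\<lambda>a. fst a base) as)"
        using xs by (auto simp: generic_def)
      have "inj_on (fst a) C" using fst_bij[OF a] by (simp add: bij_betw_def)
      moreover have "set (map (\<lambda>a. fst a base) as) \<subseteq> C" using as(2) fst_in by auto
      ultimately have "distinct (map (fst a) (map (\<lambda>a. fst a base) as))"
        using as(3) by (simp add: distinct_map inj_on_subset del: map_map)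
      then have "distinct (map (\<lambda>a. fst a base) (map (\<lambda>b. a \<odot> b) as))"
        by (simp add: fst_mult comp_def)
      moreover have "set (map (\<lambda>b. a \<odot> b) as) \<subseteq> carrier \<Gamma>" using as(2) a by auto
      ultimately show ?thesis unfolding as(1) map_act_germ[OF a as(2)] generic_def by blast
    qed
    show "take i xs @ drop (Suc i) xs \<in> generic" if "xs \<in> generic" "i < length xs" for xs i
      using generic_delete that .
    show "eventually (\<lambda>k. germ (t k) # xs \<in> generic) sequentially" if xs: "xs \<in> generic" for xs
    proof -
      obtain as where as: "xs = map germ as" "set as \<subseteq> carrier \<Gamma>" "distinct (map (\<lambda>a. fst a base) as)"
        using xs by (auto simp: generic_def)
      have "finite ((\<lambda>k. fst (t k) base) -` ((\<lambda>a. fst a base) ` set as))"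
        using t(2) by (intro finite_vimageI) auto
      moreover have "{k. \<not> germ (t k) # xs \<in> generic} \<subseteq> (\<lambda>k. fst (t k) base) -` ((\<lambda>a. fst a base) ` set as)"
      proof
        fix k assume k: "k \<in> {k. \<not> germ (t k) # xs \<in> generic}"
        show "k \<in> (\<lambda>k. fst (t k) base) -` ((\<lambda>a. fst a base) ` set as)"
        proof (rule ccontr)
          assume "k \<notin> (\<lambda>k. fst (t k) base) -` ((\<lambda>a. fst a base) ` set as)"
          then have "distinct (map (\<lambda>a. fst a base) (t k # as))" using as(3) by simp
          moreover have "set (t k # as) \<subseteq> carrier \<Gamma>" using as(2) t(1) by simp
          ultimately have "map germ (t k # as) \<in> generic" unfolding generic_def by blast
          then show False using k by (simp add: as(1))
        qed
      qed
      ultimately have "finite {k. \<not> germ (t k) # xs \<in> generic}" by (rule rev_finite_subset)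
      then show ?thesis by (simp add: eventually_cofinite cofinite_eq_sequentially[symmetric])
    qed
  qed
  then show ?thesis by (rule that)
qed

text \<open>
  An element fixing the germ of a at the base point is trivial near the image point of a, so
  finitely many elements of a stabiliser lie in the fixator of a common clopen set.
\<close>

lemma stabilizer_local:
  assumes as: "set as \<subseteq> carrier \<Gamma>" "as \<noteq> []"
    and F: "finite F" "F \<subseteq> carrier \<Gamma>" "\<And>g a. g \<in> F \<Longrightarrow> a \<in> set as \<Longrightarrow> act g (germ a) = germ a"
  shows "\<exists>\<rho>\<in>proper_homs. inj_on \<rho> (carrier \<Gamma>) \<and> F \<subseteq> \<rho> ` carrier \<Gamma> \<and>
    \<rho> ` carrier \<Gamma> \<subseteq> {g \<in> carrier \<Gamma>. \<forall>a\<in>set as. act g (germ a) = germ a}"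
proof -
  let ?q = "\<lambda>a. fst a base"
  have q_in: "?q a \<in> C" if "a \<in> set as" for a using fst_in as(1) that base_in by blast
  obtain z where z: "z \<in> C" "z \<notin> ?q ` set as" using point_outside[of "?q ` set as"] by blast
  have "\<exists>D. clopen D \<and> ?q a \<in> D \<and> z \<notin> D" if "a \<in> set as" for a
  proof -
    have "?q a \<noteq> z" using z(2) that by auto
    then show ?thesis using separate[OF q_in[OF that] z(1)] by blast
  qed
  \<comment> \<open>These neighbourhoods avoid z. Cutting N down to them keeps it different from
    C^S, even if F is empty.\<close>
  then obtain D where D: "\<And>a. a \<in> set as \<Longrightarrow> clopen (D a) \<and> ?q a \<in> D a \<and> z \<notin> D a" by metis
  have "\<exists>M. clopen M \<and> ?q a \<in> M \<and> (\<forall>\<kappa>\<in>M. fst g \<kappa> = \<kappa> \<and> snd g \<kappa> = \<one>)" if g: "g \<in> F" and a: "a \<in> set as" for g a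
  proof -
    have gc: "g \<in> carrier \<Gamma>" and ac: "a \<in> carrier \<Gamma>" using g a F as by auto
    have "germ (g \<odot> a) = germ a" using F(3)[OF g a] act_germ[OF gc ac] by simp
    then obtain N where N: "clopen N" "base \<in> N" "agree (g \<odot> a) a N" using germ_eqD ac by blast
    have NC: "N \<subseteq> C" using N(1) by (simp add: clopen_def)
    have "fst g (fst a \<kappa>) = fst a \<kappa> \<and> snd g (fst a \<kappa>) = \<one>" if "\<kappa> \<in> N" for \<kappa>
    proof -
      have \<kappa>: "\<kappa> \<in> C" using that NC by blast
      have "fst g (fst a \<kappa>) = fst a \<kappa>" "snd g (fst a \<kappa>) \<otimes> snd a \<kappa> = snd a \<kappa>"
        using N(3) that \<kappa> by (auto simp: agree_def fst_mult snd_mult)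
      then show ?thesis using snd_in[OF gc fst_in[OF ac \<kappa>]] snd_in[OF ac \<kappa>] by simp
    qed
    then have "clopen (fst a ` N) \<and> ?q a \<in> fst a ` N \<and> (\<forall>\<kappa>\<in>fst a ` N. fst g \<kappa> = \<kappa> \<and> snd g \<kappa> = \<one>)"
      using clopen_fst_image[OF ac N(1)] N(2) by simp
    then show ?thesis by (intro exI[of _ "fst a ` N"])
  qed
  then obtain M where M: "\<And>g a. g \<in> F \<Longrightarrow> a \<in> set as \<Longrightarrow>
      clopen (M g a) \<and> ?q a \<in> M g a \<and> (\<forall>\<kappa>\<in>M g a. fst g \<kappa> = \<kappa> \<and> snd g \<kappa> = \<one>)" by metis
  define N where "N = (\<Union>a\<in>set as. (C \<inter> (\<Inter>g\<in>F. M g a)) \<inter> D a)"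
  have clopN: "clopen N"
    unfolding N_def using D M by (intro clopen_Union clopen_inter clopen_Inter F(1)) auto
  then have NC: "N \<subseteq> C" by (simp add: clopen_def)
  have qN: "?q a \<in> N" if "a \<in> set as" for a
  proof -
    have "?q a \<in> C \<inter> (\<Inter>g\<in>F. M g a) \<inter> D a" using D[OF that] M[OF _ that] q_in[OF that] by simp
    then show ?thesis unfolding N_def using that by (rule UN_I[rotated])
  qed
  have "z \<notin> N" using D by (auto simp: N_def)
  then have N_proper: "N \<noteq> C" using z(1) by blast
  have N_ne: "N \<noteq> {}" using qN as(2) by (cases as) auto
  have "F \<subseteq> fixing N" using M F(2) by (auto simp: fixing_def N_def)
  obtain \<rho> where \<rho>: "\<rho> \<in> hom \<Gamma> \<Gamma>" "inj_on \<rho> (carrier \<Gamma>)" "\<rho> ` carrier \<Gamma> = fixing N"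
    by (rule fixing_iso[OF clopN N_proper]) (rule that)
  have "C - (C - N) = N" using NC by blast
  then have "\<rho> \<in> proper_homs"
    unfolding proper_homs_def using \<rho> clopen_compl[OF clopN] N_proper N_ne NC
    by (intro CollectI conjI exI[of _ "C - N"]) auto
  moreover have "act g (germ a) = germ a" if g: "g \<in> fixing N" and a: "a \<in> set as" for g a
  proof -
    have gc: "g \<in> carrier \<Gamma>" and ac: "a \<in> carrier \<Gamma>" using g a as fixingD by auto
    obtain L where L: "clopen L" "base \<in> L" "fst a ` L \<subseteq> N"
      by (rule clopen_pullback[OF ac clopN qN[OF a] base_in]) (rule that)
    have "agree (g \<odot> a) a L"
      unfolding agree_def
    proof
      fix \<kappa> assume \<kappa>: "\<kappa> \<in> L"
      then have "\<kappa> \<in> C" "fst a \<kappa> \<in> N" using L by (auto simp: clopen_def)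
      then show "fst (g \<odot> a) \<kappa> = fst a \<kappa> \<and> snd (g \<odot> a) \<kappa> = snd a \<kappa>"
        using fixingD[OF g] snd_in[OF ac] by (simp add: fst_mult snd_mult)
    qed
    then show ?thesis using germ_eqI[OF L(1,2)] act_germ[OF gc ac] by simp
  qed
  ultimately show ?thesis
    using \<rho>(2,3) \<open>F \<subseteq> fixing N\<close> fixingD(1) by (intro bexI[of _ \<rho>]) auto
qed

theorem boundedly_acyclic_\<Gamma>: "boundedly_acyclic \<Gamma>"
proof (rule \<Gamma>.boundedly_acyclicI)
  fix N :: nat assume N: "1 \<le> N"
  obtain y where "generic_action \<Gamma> act (germ ` carrier \<Gamma>) generic y" by (rule generic_action) (rule that)
  then interpret D: generic_action \<Gamma> act "germ ` carrier \<Gamma>" generic y .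
  have "\<exists>K\<ge>0. bounded_vanishing \<Gamma> N K"
  proof (rule D.vanishing_criterion[OF _ proper_homs_double _ _ N])
    show "proper_homs \<subseteq> hom \<Gamma> \<Gamma>" by (auto simp: proper_homs_def)
  next
    fix xs F assume xs: "xs \<in> generic" "xs \<noteq> []" and F: "finite F" "F \<subseteq> D.stab xs"
    obtain as where as: "xs = map germ as" "set as \<subseteq> carrier \<Gamma>" using xs by (auto simp: generic_def)
    have stab: "D.stab xs = {g \<in> carrier \<Gamma>. \<forall>a\<in>set as. act g (germ a) = germ a}"
      by (auto simp: D.stab_def as(1))
    show "\<exists>\<rho>\<in>proper_homs. inj_on \<rho> (carrier \<Gamma>) \<and> F \<subseteq> \<rho> ` carrier \<Gamma> \<and> \<rho> ` carrier \<Gamma> \<subseteq> D.stab xs"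
      unfolding stab by (rule stabilizer_local) (use as xs F stab in auto)
  next
    fix n xs ys assume "xs \<in> D.gtup n" "ys \<in> D.gtup n"
    then have "xs \<in> generic" "ys \<in> generic" "length xs = length ys" by (simp_all add: D.gtup_def)
    then obtain as bs where "xs = map germ as" "set as \<subseteq> carrier \<Gamma>" "distinct (map (\<lambda>a. fst a base) as)"
      "ys = map germ bs" "set bs \<subseteq> carrier \<Gamma>" "distinct (map (\<lambda>a. fst a base) bs)" "length as = length bs"
      by (auto simp: generic_def)
    then show "\<exists>a\<in>carrier \<Gamma>. ys = map (act a) xs" using generic_transitive by blast
  qed
  then show "\<exists>K. bounded_vanishing \<Gamma> N K" by blast
qed

end

theorem theorem7p9:
  fixes G :: "('g, 'm) monoid_scheme" and S :: "'s set" and \<phi> :: "'g \<Rightarrow> 's \<Rightarrow> 's"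
  assumes "group_action G S \<phi>" and "S \<noteq> {}"
  shows "boundedly_acyclic (abstract_twisted_BT G S \<phi>)"
proof -
  interpret twisted_bt G S \<phi> by (rule twisted_bt.intro) (rule assms)+
  show ?thesis by (rule boundedly_acyclic_\<Gamma>)
qed

end
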